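(* Let $R$ be an affine commutative $\mathbb{K}$-algebra generated by a set $X=\{x_1,\ldots,x_n\}$, let $G$ be a finitely generated abelian group acting on $R$ by algebra automorphisms via $g\cdot x_i=\chi_i(g)^{-1}x_i$ for characters $\chi_1,\ldots,\chi_n\in\widehat{G}$, and let $R\#G$ be the skew group ring. Then every simple torsion left $R\#G$-module $V$ is a simple $\mathbb{K}[G]$-module (the elements $x_i$ acting as zero), and since $G$ is finitely generated abelian, $V$ is one-dimensional and isomorphic to $\mathbb{K}_\lambda$ for some $\lambda\in\widehat{G}$. In particular, for $H=\mathbb{K}[x,y]\#G$, where $G$ acts on the commutative polynomial ring $\mathbb{K}[x,y]$ by $g\cdot x=\chi(g)^{-1}x$ and $g\cdot y=\eta(g)^{-1}y$ with $\chi,\eta\in\widehat{G}$ of finite order, one has $\widehat{G}\subseteq\operatorname{Irr}(H)$ via $\lambda\mapsto\mathbb{K}_\lambda$ (with $x$ and $y$ acting as zero).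
   Context: $\mathbb{K}$ is an algebraically closed field of characteristic zero; $\widehat{G}$ is the group of homomorphisms $G\to\mathbb{K}^\times$. In $R\#G$ one has $gx_i=\chi_i(g)^{-1}x_ig$, i.e. $x_ig=\chi_i(g)gx_i$. A module $M$ is $x_i$-torsion if every $m\in M$ satisfies $x_i^km=0$ for some $k\ge1$; an $R\#G$-module is torsion if it is $x_i$-torsion for every $i$. For $\lambda\in\widehat{G}$, $\mathbb{K}_\lambda$ is the one-dimensional $\mathbb{K}[G]$-module on which $g\in G$ acts by the scalar $\lambda(g)$. $\operatorname{Irr}(H)$ is the set of isomorphism classes of finite dimensional simple left $H$-modules. *)

theory Defs
  imports "HOL-Algebra.Algebra" "Jordan_Normal_Form.Missing_VectorSpace"
begin

section \<open>Left modules over rings that need not be commutative\<close>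

text \<open>The library locale \<^locale>\<open>module\<close> requires a commutative base ring. As there, a module is a
  record of type \<^typ>\<open>('a, 'm) module\<close> whose \<^const>\<open>monoid.mult\<close> and \<^const>\<open>monoid.one\<close> fields carry no meaning.
  \<^const>\<open>module_hom\<close> and the submodule locale of \<^theory>\<open>HOL-Algebra.Module\<close> do not assume
  commutativity and are used below.\<close>

locale left_module = A?: ring A + M?: abelian_group M
  for A :: "('a, 'c) ring_scheme" (structure) and M :: "('a, 'm, 'd) module_scheme" (structure) +
  assumes smult_closed: "\<lbrakk>a \<in> carrier A; v \<in> carrier M\<rbrakk> \<Longrightarrow> a \<odot>\<^bsub>M\<^esub> v \<in> carrier M"
    and smult_l_distr: "\<lbrakk>a \<in> carrier A; b \<in> carrier A; v \<in> carrier M\<rbrakk>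
      \<Longrightarrow> (a \<oplus>\<^bsub>A\<^esub> b) \<odot>\<^bsub>M\<^esub> v = a \<odot>\<^bsub>M\<^esub> v \<oplus>\<^bsub>M\<^esub> b \<odot>\<^bsub>M\<^esub> v"
    and smult_r_distr: "\<lbrakk>a \<in> carrier A; v \<in> carrier M; w \<in> carrier M\<rbrakk>
      \<Longrightarrow> a \<odot>\<^bsub>M\<^esub> (v \<oplus>\<^bsub>M\<^esub> w) = a \<odot>\<^bsub>M\<^esub> v \<oplus>\<^bsub>M\<^esub> a \<odot>\<^bsub>M\<^esub> w"
    and smult_assoc: "\<lbrakk>a \<in> carrier A; b \<in> carrier A; v \<in> carrier M\<rbrakk>
      \<Longrightarrow> (a \<otimes>\<^bsub>A\<^esub> b) \<odot>\<^bsub>M\<^esub> v = a \<odot>\<^bsub>M\<^esub> (b \<odot>\<^bsub>M\<^esub> v)"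
    and smult_one: "v \<in> carrier M \<Longrightarrow> \<one>\<^bsub>A\<^esub> \<odot>\<^bsub>M\<^esub> v = v"

definition simple_left_module ::
    "('a, 'c) ring_scheme \<Rightarrow> ('a, 'm, 'd) module_scheme \<Rightarrow> bool" where
  "simple_left_module A M \<longleftrightarrow> left_module A M \<and> carrier M \<noteq> {\<zero>\<^bsub>M\<^esub>} \<and>
     (\<forall>N. Module.submodule N A M \<longrightarrow> N = {\<zero>\<^bsub>M\<^esub>} \<or> N = carrier M)"

definition module_iso ::
    "('a, 'c) ring_scheme \<Rightarrow> ('a, 'm, 'd) module_scheme \<Rightarrow> ('a, 'n, 'e) module_scheme \<Rightarrow> bool" where
  "module_iso A M N \<longleftrightarrow> (\<exists>f \<in> module_hom A M N. bij_betw f (carrier M) (carrier N))"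

definition torsion_at ::
    "('a, 'c) ring_scheme \<Rightarrow> 'a \<Rightarrow> ('a, 'm, 'd) module_scheme \<Rightarrow> bool" where
  "torsion_at A a M \<longleftrightarrow>
     (\<forall>v \<in> carrier M. \<exists>k::nat. k \<ge> 1 \<and> (a [^]\<^bsub>A\<^esub> k) \<odot>\<^bsub>M\<^esub> v = \<zero>\<^bsub>M\<^esub>)"

definition restrict_scalars ::
    "('b \<Rightarrow> 'a) \<Rightarrow> ('a, 'm, 'd) module_scheme \<Rightarrow> ('b, 'm) module" where
  "restrict_scalars f M = \<lparr>carrier = carrier M, monoid.mult = monoid.mult M,
     monoid.one = monoid.one M, ring.zero = ring.zero M, ring.add = ring.add M,
     module.smult = (\<lambda>b v. f b \<odot>\<^bsub>M\<^esub> v)\<rparr>"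

text \<open>The vector space underlying a module \<open>M\<close> over a \<open>K\<close>-algebra \<open>A\<close>.\<close>

definition underlying_space ::
    "('k, 'a, 'c) module_scheme \<Rightarrow> ('a, 'm, 'd) module_scheme \<Rightarrow> ('k, 'm) module" where
  "underlying_space A M = restrict_scalars (\<lambda>c. c \<odot>\<^bsub>A\<^esub> \<one>\<^bsub>A\<^esub>) M"

definition finite_dimensional ::
    "('k, 'b) ring_scheme \<Rightarrow> ('k, 'm, 'd) module_scheme \<Rightarrow> bool" where
  "finite_dimensional K W \<longleftrightarrow> vectorspace K W \<and> vectorspace.fin_dim K W"

definition iso_class ::
    "('a, 'c) ring_scheme \<Rightarrow> ('a, 'm) module \<Rightarrow> ('a, 'm) module set" where
  "iso_class A M = {N. left_module A N \<and> module_iso A M N}"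

text \<open>Representatives are taken with elements in the type of the scalars. For an infinite field
  \<open>K\<close> (in particular an algebraically closed one) no isomorphism class is lost: every nonzero finite
  dimensional space is in bijection with \<open>K\<close>, so every finite dimensional module can be transported
  to one of this kind.\<close>

definition Irr ::
    "('k, 'b) ring_scheme \<Rightarrow> ('k, 'a, 'c) module_scheme \<Rightarrow> ('a, 'k) module set set" where
  "Irr K A = {iso_class A M | M.
     simple_left_module A M \<and> finite_dimensional K (underlying_space A M)}"


section \<open>Groups, characters and algebras\<close>

definition char_zero :: "('k, 'b) ring_scheme \<Rightarrow> bool" where
  "char_zero K \<longleftrightarrow> (\<forall>m::nat. m > 0 \<longrightarrow> add_pow K m \<one>\<^bsub>K\<^esub> \<noteq> \<zero>\<^bsub>K\<^esub>)"

definition finitely_generated_group :: "('g, 'b) monoid_scheme \<Rightarrow> bool" where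
  "finitely_generated_group G \<longleftrightarrow>
     group G \<and> (\<exists>S. finite S \<and> S \<subseteq> carrier G \<and> generate G S = carrier G)"

text \<open>Characters are extensional functions, so that two of them are equal iff they agree on \<open>G\<close>.\<close>

definition char_group ::
    "('g, 'b) monoid_scheme \<Rightarrow> ('k, 'c) ring_scheme \<Rightarrow> ('g \<Rightarrow> 'k) monoid" where
  "char_group G K = \<lparr>carrier = hom G (units_of K) \<inter> extensional (carrier G),
     monoid.mult = (\<lambda>\<phi> \<psi>. \<lambda>g \<in> carrier G. \<phi> g \<otimes>\<^bsub>K\<^esub> \<psi> g), monoid.one = (\<lambda>g \<in> carrier G. \<one>\<^bsub>K\<^esub>)\<rparr>"

definition finite_order :: "('g, 'b) monoid_scheme \<Rightarrow> 'g \<Rightarrow> bool" where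
  "finite_order G g \<longleftrightarrow> (\<exists>m::nat. m > 0 \<and> g [^]\<^bsub>G\<^esub> m = \<one>\<^bsub>G\<^esub>)"

text \<open>Subalgebras are the subrings that contain the multiples of \<open>1\<close> by scalars.\<close>

definition generates_algebra ::
    "('k, 'b) ring_scheme \<Rightarrow> ('k, 'r, 'c) module_scheme \<Rightarrow> 'r set \<Rightarrow> bool" where
  "generates_algebra K R S \<longleftrightarrow> S \<subseteq> carrier R \<and>
     generate_ring R (S \<union> {c \<odot>\<^bsub>R\<^esub> \<one>\<^bsub>R\<^esub> | c. c \<in> carrier K}) = carrier R"

definition algebra_action ::
    "('k, 'b) ring_scheme \<Rightarrow> ('g, 'c) monoid_scheme \<Rightarrow> ('k, 'r, 'd) module_scheme
      \<Rightarrow> ('g \<Rightarrow> 'r \<Rightarrow> 'r) \<Rightarrow> bool" where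
  "algebra_action K G R act \<longleftrightarrow> group_action G (carrier R) act \<and>
     (\<forall>g \<in> carrier G. act g \<in> ring_hom R R \<and>
       (\<forall>c \<in> carrier K. \<forall>r \<in> carrier R. act g (c \<odot>\<^bsub>R\<^esub> r) = c \<odot>\<^bsub>R\<^esub> act g r))"


section \<open>Skew group rings\<close>

text \<open>A function \<open>a\<close> represents the formal sum of the \<open>a g\<close> times \<open>g\<close>. The product is determined by
  \<open>(r g) (s h) = (r (g \<cdot> s)) (g h)\<close>, so the coefficient of \<open>k\<close> in \<open>a b\<close> is the sum over \<open>g\<close> of
  \<open>a g\<close> times \<open>g \<cdot> b (g\<inverse> k)\<close>. Scalars act coefficientwise.\<close>

definition skew_group_ring ::
    "('k, 'r, 'd) module_scheme \<Rightarrow> ('g, 'c) monoid_scheme \<Rightarrow> ('g \<Rightarrow> 'r \<Rightarrow> 'r)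
      \<Rightarrow> ('k, 'g \<Rightarrow> 'r) module" where
  "skew_group_ring R G act = \<lparr>
     carrier = {a. (\<forall>g \<in> carrier G. a g \<in> carrier R) \<and> (\<forall>g. g \<notin> carrier G \<longrightarrow> a g = \<zero>\<^bsub>R\<^esub>) \<and>
       finite {g \<in> carrier G. a g \<noteq> \<zero>\<^bsub>R\<^esub>}},
     monoid.mult = (\<lambda>a b k. if k \<in> carrier G
       then \<Oplus>\<^bsub>R\<^esub>g \<in> {g \<in> carrier G. a g \<noteq> \<zero>\<^bsub>R\<^esub>}. a g \<otimes>\<^bsub>R\<^esub> act g (b (inv\<^bsub>G\<^esub> g \<otimes>\<^bsub>G\<^esub> k))
       else \<zero>\<^bsub>R\<^esub>),
     monoid.one = (\<lambda>g. if g = \<one>\<^bsub>G\<^esub> then \<one>\<^bsub>R\<^esub> else \<zero>\<^bsub>R\<^esub>),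
     ring.zero = (\<lambda>g. \<zero>\<^bsub>R\<^esub>),
     ring.add = (\<lambda>a b g. a g \<oplus>\<^bsub>R\<^esub> b g),
     module.smult = (\<lambda>c a g. c \<odot>\<^bsub>R\<^esub> a g)\<rparr>"

text \<open>The inclusion of \<open>R\<close> into the skew group ring.\<close>

definition skew_const ::
    "('k, 'r, 'd) module_scheme \<Rightarrow> ('g, 'c) monoid_scheme \<Rightarrow> 'r \<Rightarrow> 'g \<Rightarrow> 'r" where
  "skew_const R G r = (\<lambda>g. if g = \<one>\<^bsub>G\<^esub> then r else \<zero>\<^bsub>R\<^esub>)"

definition regular_algebra :: "('k, 'b) ring_scheme \<Rightarrow> ('k, 'k) module" where
  "regular_algebra K = \<lparr>carrier = carrier K, monoid.mult = monoid.mult K, monoid.one = monoid.one K, ring.zero = ring.zero K,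
     ring.add = ring.add K, module.smult = monoid.mult K\<rparr>"

definition group_algebra ::
    "('k, 'b) ring_scheme \<Rightarrow> ('g, 'c) monoid_scheme \<Rightarrow> ('k, 'g \<Rightarrow> 'k) module" where
  "group_algebra K G = skew_group_ring (regular_algebra K) G (\<lambda>g c. c)"

text \<open>Restriction along the inclusion of \<open>K[G]\<close> into the skew group ring of \<open>R\<close>.\<close>

definition as_group_module ::
    "('k, 'r, 'd) module_scheme \<Rightarrow> ('g \<Rightarrow> 'r, 'm, 'e) module_scheme \<Rightarrow> ('g \<Rightarrow> 'k, 'm) module" where
  "as_group_module R M = restrict_scalars (\<lambda>a g. a g \<odot>\<^bsub>R\<^esub> \<one>\<^bsub>R\<^esub>) M"

definition char_module ::
    "('k, 'b) ring_scheme \<Rightarrow> ('g, 'c) monoid_scheme \<Rightarrow> ('g \<Rightarrow> 'k) \<Rightarrow> ('g \<Rightarrow> 'k, 'k) module" where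
  "char_module K G lam = \<lparr>carrier = carrier K, monoid.mult = monoid.mult K, monoid.one = monoid.one K, ring.zero = ring.zero K,
     ring.add = ring.add K,
     module.smult = (\<lambda>a v. (\<Oplus>\<^bsub>K\<^esub>g \<in> {g \<in> carrier G. a g \<noteq> \<zero>\<^bsub>K\<^esub>}. a g \<otimes>\<^bsub>K\<^esub> lam g) \<otimes>\<^bsub>K\<^esub> v)\<rparr>"


section \<open>The polynomial ring in two variables\<close>

text \<open>Polynomials in \<open>y\<close> whose coefficients are polynomials in \<open>x\<close>. The scalar multiplication of
  \<open>UP (UP K)\<close> is by \<open>UP K\<close>; here it is restricted to \<open>K\<close>.\<close>

definition poly_xy :: "('k, 'b) ring_scheme \<Rightarrow> ('k, nat \<Rightarrow> nat \<Rightarrow> 'k) module" where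
  "poly_xy K = restrict_scalars (\<lambda>c. up_ring.monom (UP K) c 0) (UP (UP K))"

definition var_x :: "('k, 'b) ring_scheme \<Rightarrow> nat \<Rightarrow> nat \<Rightarrow> 'k" where
  "var_x K = up_ring.monom (UP (UP K)) (up_ring.monom (UP K) \<one>\<^bsub>K\<^esub> 1) 0"

definition var_y :: "('k, 'b) ring_scheme \<Rightarrow> nat \<Rightarrow> nat \<Rightarrow> 'k" where
  "var_y K = up_ring.monom (UP (UP K)) \<one>\<^bsub>UP K\<^esub> 1"

definition const_term :: "('k, 'b) ring_scheme \<Rightarrow> (nat \<Rightarrow> nat \<Rightarrow> 'k) \<Rightarrow> 'k" where
  "const_term K p = up_ring.coeff (UP K) (up_ring.coeff (UP (UP K)) p 0) 0"

text \<open>Inflation of \<^const>\<open>char_module\<close> along the map from \<open>K[x,y]#G\<close> to \<open>K[G]\<close> sending \<open>x\<close> and \<open>y\<close>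
  to \<open>0\<close>.\<close>

definition char_module_xy ::
    "('k, 'b) ring_scheme \<Rightarrow> ('g, 'c) monoid_scheme \<Rightarrow> ('g \<Rightarrow> 'k)
      \<Rightarrow> ('g \<Rightarrow> nat \<Rightarrow> nat \<Rightarrow> 'k, 'k) module" where
  "char_module_xy K G lam = restrict_scalars (\<lambda>a g. const_term K (a g)) (char_module K G lam)"

end

theory Submission
  imports Defs
begin

text \<open>Let \<open>V\<close> be a simple torsion module over \<open>R#G\<close>. Each generator \<open>x\<close> of \<open>R\<close> is a common eigenvector
  of \<open>G\<close>, so \<open>x\<close> commutes with all terms \<open>r g\<close> up to nonzero scalars. Therefore the vectors killed by
  \<open>x\<close> form a submodule of \<open>V\<close>. Torsion makes it nonzero and simplicity makes it all of \<open>V\<close>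
  (\<open>torsion_simple_annihilated\<close>). Once the generators act as \<open>0\<close>, all of \<open>R\<close> acts by scalars, and
  submodules over \<open>R#G\<close> and over \<open>K[G]\<close> are the same (\<open>as_group_module_simple\<close>).

  It remains to see that a simple module over \<open>K[G]\<close> is one-dimensional. As \<open>G\<close> is finitely generated
  abelian, \<open>K[G]\<close> is a finitely generated commutative algebra, and the module is its quotient by a
  maximal ideal. By Hilbert's Nullstellensatz the quotient is \<open>K\<close> (\<open>simple_module_character\<close>). The
  Nullstellensatz is needed for arbitrary, possibly countable, algebraically closed fields. It is
  proved by Goldman's method: a field \<open>K[x\<^sub>1, \<dots>, x\<^sub>m]\<close> is a domain whose fraction field is obtained by
  inverting one element; this property descends from \<open>A[u]\<close> to \<open>A\<close> (\<open>goldman_descent\<close>) and forces \<open>u\<close>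
  to be algebraic over \<open>A\<close> (\<open>goldman_imp_algebraic\<close>).

  For \<open>R = K[x,y]\<close> the constant term is invariant under \<open>G\<close> (\<open>const_term_invariant\<close>). So it induces a
  ring homomorphism from \<open>K[x,y]#G\<close> onto \<open>K[G]\<close>, along which the module of each character is pulled
  back. The character is recovered from the action of \<open>G\<close> (\<open>char_module_xy_inj\<close>).\<close>

section \<open>Goldman domains and the Nullstellensatz\<close>

text \<open>These are the Goldman domains, Kaplansky's G-domains: the subrings \<open>A\<close> whose field of fractions
  is already \<open>A[1/t]\<close>. The condition is written without fractions, as every nonzero \<open>a\<close> dividing a
  power of \<open>t\<close>, so that it makes sense for a subring of any domain.\<close>

definition (in ring) goldman :: "'a set \<Rightarrow> bool" where
  "goldman A \<longleftrightarrow> (\<exists>t \<in> A - {\<zero>}. \<forall>a \<in> A - {\<zero>}. \<exists>n::nat. \<exists>b \<in> A. a \<otimes> b = t [^] n)"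

text \<open>Division by \<open>g\<close> needs the inverse of its leading coefficient \<open>c\<close>; over a domain this is
  replaced by multiplying the dividend by a power of \<open>c\<close>. The induction cancels the leading term of
  \<open>c f\<close>.\<close>

lemma (in domain) pseudo_division:
  assumes A: "subring A R" and g: "g \<in> carrier (A[X])" "g \<noteq> []"
  shows "f \<in> carrier (A[X]) \<Longrightarrow> \<exists>(N::nat) q r. q \<in> carrier (A[X]) \<and> r \<in> carrier (A[X]) \<and>
    [lead_coeff g] [^]\<^bsub>A[X]\<^esub> N \<otimes>\<^bsub>A[X]\<^esub> f = (g \<otimes>\<^bsub>A[X]\<^esub> q) \<oplus>\<^bsub>A[X]\<^esub> r \<and> (r = [] \<or> degree r < degree g)"
proof (induction "length f" arbitrary: f rule: less_induct)
  case less
  interpret UP: domain "A[X]" by (rule univ_poly_is_domain[OF A])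
  define c where "c = lead_coeff g"
  have pg: "polynomial A g" using g(1) by (simp add: univ_poly_carrier)
  have c: "c \<in> A" "c \<noteq> \<zero>" using pg g(2) by (auto simp: c_def polynomial_def)
  have pc: "polynomial A [c]" using c by auto
  have C: "[c] \<in> carrier (A[X])" using pc by (simp add: univ_poly_carrier)
  note f = less.prems
  have pf: "polynomial A f" using f by (simp add: univ_poly_carrier)
  show ?case
  proof (cases "f = [] \<or> degree f < degree g")
    case True
    have "[c] [^]\<^bsub>A[X]\<^esub> (0::nat) \<otimes>\<^bsub>A[X]\<^esub> f = (g \<otimes>\<^bsub>A[X]\<^esub> []) \<oplus>\<^bsub>A[X]\<^esub> f"
      using f g UP.r_null UP.zero_closed by (simp add: univ_poly_zero)
    moreover have "[] \<in> carrier (A[X])" by (rule univ_poly_zero_closed)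
    ultimately show ?thesis using True f unfolding c_def by blast
  next
    case False
    hence fne: "f \<noteq> []" and deg: "degree g \<le> degree f" by auto
    define a where "a = lead_coeff f"
    have a: "a \<in> A" "a \<noteq> \<zero>" using pf fne by (auto simp: a_def polynomial_def)
    have acarr: "a \<in> carrier R" "c \<in> carrier R" using a c subringE(1)[OF A] by auto
    have ma: "\<ominus> a \<in> A - {\<zero>}" using a subringE(5)[OF A] acarr by (metis DiffI local.minus_zero minus_minus singletonD)
    define s where "s = monom (\<ominus> a) (degree f - degree g)"
    have ps: "polynomial A s" unfolding s_def by (rule monom_is_polynomial[OF A ma])
    have s: "s \<in> carrier (A[X])" "s \<noteq> []" "degree s = degree f - degree g" "lead_coeff s = \<ominus> a"
      using ps by (auto simp: univ_poly_carrier s_def monom_def)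
    let ?u = "[c] \<otimes>\<^bsub>A[X]\<^esub> f" and ?v = "g \<otimes>\<^bsub>A[X]\<^esub> s"
    have u: "?u \<in> carrier (A[X])" "?u \<noteq> []" and v: "?v \<in> carrier (A[X])" "?v \<noteq> []"
      using UP.m_closed C f g s UP.integral fne by (auto simp: univ_poly_zero)
    have du: "degree ?u = degree f"
      unfolding univ_poly_mult using poly_mult_degree_eq[OF A pc pf] fne by simp
    have dv: "degree ?v = degree f"
      unfolding univ_poly_mult using poly_mult_degree_eq[OF A pg ps] g(2) s(2,3) deg fne
      by (cases f; cases g) simp_all
    have lu: "lead_coeff ?u = c \<otimes> a"
      unfolding univ_poly_mult using poly_mult_lead_coeff[OF A pc pf _ fne] a_def by simp
    have lv: "lead_coeff ?v = \<ominus> (c \<otimes> a)"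
      unfolding univ_poly_mult using poly_mult_lead_coeff[OF A pg ps g(2) s(2)] s(4) acarr
      by (simp add: c_def[symmetric] r_minus)
    have uvne: "(\<ominus> (c \<otimes> a)) \<oplus> (c \<otimes> a) = \<zero>" "(c \<otimes> a) \<oplus> (\<ominus> (c \<otimes> a)) = \<zero>" using acarr by (simp_all add: l_neg r_neg)
    obtain u' where u': "?u = (c \<otimes> a) # u'" using u(2) lu by (metis list.collapse)
    obtain v' where v': "?v = (\<ominus> (c \<otimes> a)) # v'" using v(2) lv by (metis list.collapse)
    have len: "length u' = length v'" "length f = Suc (length u')"
      using du dv fne unfolding u' v' by (cases f; simp)+
    let ?f' = "?u \<oplus>\<^bsub>A[X]\<^esub> ?v"
    have f': "?f' \<in> carrier (A[X])" using u v by simp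
    have "length ?f' < length f"
      unfolding u' v' univ_poly_add using normalize_length_le[of "map2 (\<oplus>) u' v'"] len
      by (auto simp: uvne)
    from less.hyps[OF this f'] obtain N q r where
      qr: "q \<in> carrier (A[X])" "r \<in> carrier (A[X])"
        "[c] [^]\<^bsub>A[X]\<^esub> (N::nat) \<otimes>\<^bsub>A[X]\<^esub> ?f' = (g \<otimes>\<^bsub>A[X]\<^esub> q) \<oplus>\<^bsub>A[X]\<^esub> r"
        "r = [] \<or> degree r < degree g" unfolding c_def by blast
    let ?cN = "[c] [^]\<^bsub>A[X]\<^esub> N"
    have cN: "?cN \<in> carrier (A[X])" using C by simp
    have "[c] [^]\<^bsub>A[X]\<^esub> Suc N \<otimes>\<^bsub>A[X]\<^esub> f = (?cN \<otimes>\<^bsub>A[X]\<^esub> ?f') \<ominus>\<^bsub>A[X]\<^esub> g \<otimes>\<^bsub>A[X]\<^esub> (?cN \<otimes>\<^bsub>A[X]\<^esub> s)"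
      using cN C f g(1) s(1) by (simp only: UP.nat_pow_Suc) algebra
    also have "\<dots> = (g \<otimes>\<^bsub>A[X]\<^esub> (q \<ominus>\<^bsub>A[X]\<^esub> (?cN \<otimes>\<^bsub>A[X]\<^esub> s))) \<oplus>\<^bsub>A[X]\<^esub> r"
      unfolding qr(3) using cN g(1) s(1) qr(1,2) by algebra
    finally have "[c] [^]\<^bsub>A[X]\<^esub> Suc N \<otimes>\<^bsub>A[X]\<^esub> f = (g \<otimes>\<^bsub>A[X]\<^esub> (q \<ominus>\<^bsub>A[X]\<^esub> (?cN \<otimes>\<^bsub>A[X]\<^esub> s))) \<oplus>\<^bsub>A[X]\<^esub> r" .
    moreover have "q \<ominus>\<^bsub>A[X]\<^esub> (?cN \<otimes>\<^bsub>A[X]\<^esub> s) \<in> carrier (A[X])" using qr(1) cN s(1) by simp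
    ultimately show ?thesis using qr(2,4) unfolding c_def by blast
  qed
qed

text \<open>Modulo \<open>1 + z\<close> the element \<open>z\<close> is \<open>-1\<close>, so all of its powers are units there.\<close>

lemma (in cring) one_plus_dvd_power_unit:
  assumes z: "z \<in> carrier R"
  shows "w \<in> carrier R \<Longrightarrow> (\<one> \<oplus> z) \<otimes> w = z [^] (n::nat) \<Longrightarrow> \<exists>w \<in> carrier R. (\<one> \<oplus> z) \<otimes> w = \<one>"
proof (induction n arbitrary: w)
  case 0
  then show ?case by auto
next
  case (Suc n)
  have "(\<one> \<oplus> z) \<otimes> (z [^] n \<ominus> w) = z [^] n \<oplus> z [^] n \<otimes> z \<ominus> ((\<one> \<oplus> z) \<otimes> w)"
    using z Suc.prems(1) nat_pow_closed[OF z, of n] by algebra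
  also have "\<dots> = z [^] n" using Suc.prems z nat_pow_closed[OF z, of n] by (simp add: minus_eq a_assoc r_neg)
  finally show ?case using Suc.IH[of "z [^] n \<ominus> w"] Suc.prems z by simp
qed

text \<open>If \<open>u\<close> were transcendental, \<open>A[u]\<close> would be a polynomial ring, and with \<open>t = f(u)\<close> the polynomial
  \<open>q = 1 + X f\<close>, which is Euclid's choice of an element prime to \<open>f\<close>, would divide a power of \<open>f\<close>,
  hence of \<open>X f\<close>. This makes \<open>q\<close> a unit although its degree is positive.\<close>

lemma (in domain) goldman_imp_algebraic:
  assumes A: "subring A R" and u: "u \<in> carrier R" and G: "goldman (simple_extension A u)"
  shows "(algebraic over A) u"
proof (rule ccontr)
  assume "\<not> (algebraic over A) u"
  hence tr: "(transcendental over A) u" by (simp add: over_def)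
  interpret UP: domain "A[X]" by (rule univ_poly_is_domain[OF A])
  interpret ev: ring_hom_ring "A[X]" R "\<lambda>p. eval p u" by (rule eval_ring_hom[OF A u])
  have im: "simple_extension A u = (\<lambda>p. eval p u) ` carrier (A[X])"
    by (rule simple_extension_as_eval_img[OF subringE(1)[OF A] u])
  have inj: "p = q" if "p \<in> carrier (A[X])" "q \<in> carrier (A[X])" "eval p u = eval q u" for p q
    using tr that unfolding over_def transcendental_def inj_on_def by auto
  have ev0: "eval [] u = \<zero>" by simp
  obtain f where f: "f \<in> carrier (A[X])" "eval f u \<noteq> \<zero>" and
    dv: "\<And>a. a \<in> simple_extension A u - {\<zero>} \<Longrightarrow> \<exists>n::nat. \<exists>b \<in> simple_extension A u. a \<otimes> b = eval f u [^] n"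
    using G unfolding goldman_def im by blast
  have fne: "f \<noteq> []" using f(2) by auto
  have Xc: "X \<in> carrier (A[X])" by (rule var_closed[OF A])
  let ?z = "f \<otimes>\<^bsub>A[X]\<^esub> X"
  let ?q = "\<one>\<^bsub>A[X]\<^esub> \<oplus>\<^bsub>A[X]\<^esub> ?z"
  have z: "?z \<in> carrier (A[X])" using f Xc by simp
  have zl: "?z = f @ [\<zero>]" using poly_mult_var[OF A f(1)] fne by simp
  have lz: "length ?z \<ge> 2" unfolding zl using fne by (cases f) auto
  have lq: "length ?q = length ?z"
  proof -
    have "poly_add [\<one>] ?z = poly_add ?z [\<one>]"
      using UP.a_comm[OF UP.one_closed z] by (simp add: univ_poly_add univ_poly_one)
    moreover have "length (poly_add ?z [\<one>]) = length ?z"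
      using poly_add_length_eq[OF A, of ?z "[\<one>]"] lz z UP.one_closed
      by (simp add: univ_poly_carrier univ_poly_one)
    ultimately show ?thesis by (simp add: univ_poly_add univ_poly_one)
  qed
  have q: "?q \<in> carrier (A[X])" using z by simp
  have qne: "?q \<noteq> []" using lq lz by auto
  have "eval ?q u \<noteq> \<zero>" using inj[OF q univ_poly_zero_closed] qne ev0 by auto
  then obtain n b where nb: "b \<in> simple_extension A u" "eval ?q u \<otimes> b = eval f u [^] (n::nat)"
    using dv[of "eval ?q u"] q unfolding im by auto
  then obtain g where g: "g \<in> carrier (A[X])" "b = eval g u" unfolding im by auto
  have "eval (?q \<otimes>\<^bsub>A[X]\<^esub> g) u = eval (f [^]\<^bsub>A[X]\<^esub> n) u"
    using nb(2) g q f by (simp add: ev.hom_nat_pow)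
  hence "?q \<otimes>\<^bsub>A[X]\<^esub> g = f [^]\<^bsub>A[X]\<^esub> n" using inj q g f by simp
  hence "?q \<otimes>\<^bsub>A[X]\<^esub> (g \<otimes>\<^bsub>A[X]\<^esub> X [^]\<^bsub>A[X]\<^esub> n) = ?z [^]\<^bsub>A[X]\<^esub> n"
    using q g f Xc by (metis UP.m_assoc UP.nat_pow_closed UP.nat_pow_distrib)
  then obtain w where w: "w \<in> carrier (A[X])" "?q \<otimes>\<^bsub>A[X]\<^esub> w = \<one>\<^bsub>A[X]\<^esub>"
    using UP.one_plus_dvd_power_unit[OF z] g Xc by (metis UP.m_closed UP.nat_pow_closed)
  have wne: "w \<noteq> []" using w UP.r_null[OF q] UP.one_not_zero by (auto simp: univ_poly_zero)
  have "degree (?q \<otimes>\<^bsub>A[X]\<^esub> w) = degree ?q + degree w"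
    using poly_mult_degree_eq[OF A, of ?q w] q w(1) qne wne by (simp add: univ_poly_carrier univ_poly_mult)
  thus False using w(2) lq lz by (simp add: univ_poly_one)
qed

lemma (in domain) pow_non_zero:
  "x \<in> carrier R \<Longrightarrow> x \<noteq> \<zero> \<Longrightarrow> x [^] (n::nat) \<noteq> \<zero>"
  by (induct n) (auto simp: integral_iff)

lemma (in domain) obtain_minimal_annihilator:
  assumes A: "subring A R" and u: "u \<in> carrier R" and alg: "(algebraic over A) u"
  obtains p where "p \<in> carrier (A[X])" "p \<noteq> []" "eval p u = \<zero>"
    and "\<And>q. q \<in> carrier (A[X]) \<Longrightarrow> eval q u = \<zero> \<Longrightarrow> q = [] \<or> degree p \<le> degree q"
proof -
  let ?Z = "\<lambda>p. p \<in> carrier (A[X]) \<and> p \<noteq> [] \<and> eval p u = \<zero>"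
  obtain p0 where "?Z p0" using algebraicE[OF A u alg] by metis
  define p where "p = arg_min degree ?Z"
  have "?Z p" using arg_min_natI[of ?Z, OF \<open>?Z p0\<close>] unfolding p_def .
  moreover have "degree p \<le> degree q" if "?Z q" for q
    using arg_min_nat_le[of ?Z, OF that] unfolding p_def .
  ultimately show thesis using that[of p] by blast
qed

lemma (in domain) lead_coeff_const:
  assumes A: "subring A R" and q: "q \<in> carrier (A[X])" "q \<noteq> []"
  shows "lead_coeff q \<in> A" "lead_coeff q \<noteq> \<zero>" "[lead_coeff q] \<in> carrier (A[X])"
    "u \<in> carrier R \<Longrightarrow> eval [lead_coeff q] u = lead_coeff q"
proof -
  have "polynomial A q" using q by (simp add: univ_poly_carrier)
  thus 1: "lead_coeff q \<in> A" "lead_coeff q \<noteq> \<zero>" using q(2) by (auto simp: polynomial_def)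
  thus "[lead_coeff q] \<in> carrier (A[X])" by (auto simp: univ_poly_carrier[symmetric])
  show "u \<in> carrier R \<Longrightarrow> eval [lead_coeff q] u = lead_coeff q" using 1 subringE(1)[OF A] by auto
qed

text \<open>Pseudo-division evaluated at \<open>u\<close>; the identity of polynomials is kept as well because degrees are
  read off from it.\<close>

lemma (in domain) pseudo_division_eval:
  assumes A: "subring A R" and u: "u \<in> carrier R"
    and g: "g \<in> carrier (A[X])" "g \<noteq> []" and f: "f \<in> carrier (A[X])"
  obtains N :: nat and q r where "q \<in> carrier (A[X])" "r \<in> carrier (A[X])"
    "lead_coeff g [^] N \<otimes> eval f u = (eval g u \<otimes> eval q u) \<oplus> eval r u" "r = [] \<or> degree r < degree g"
    "[lead_coeff g] [^]\<^bsub>A[X]\<^esub> N \<otimes>\<^bsub>A[X]\<^esub> f = (g \<otimes>\<^bsub>A[X]\<^esub> q) \<oplus>\<^bsub>A[X]\<^esub> r"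
proof -
  interpret UP: domain "A[X]" by (rule univ_poly_is_domain[OF A])
  interpret ev: ring_hom_ring "A[X]" R "\<lambda>p. eval p u" by (rule eval_ring_hom[OF A u])
  note c = lead_coeff_const[OF A g]
  obtain N q r where qr: "q \<in> carrier (A[X])" "r \<in> carrier (A[X])"
      "[lead_coeff g] [^]\<^bsub>A[X]\<^esub> (N::nat) \<otimes>\<^bsub>A[X]\<^esub> f = (g \<otimes>\<^bsub>A[X]\<^esub> q) \<oplus>\<^bsub>A[X]\<^esub> r"
      "r = [] \<or> degree r < degree g"
    using pseudo_division[OF A g f] by blast
  have "eval ([lead_coeff g] [^]\<^bsub>A[X]\<^esub> N \<otimes>\<^bsub>A[X]\<^esub> f) u = eval ((g \<otimes>\<^bsub>A[X]\<^esub> q) \<oplus>\<^bsub>A[X]\<^esub> r) u"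
    by (simp only: qr(3))
  moreover have "eval ([lead_coeff g] [^]\<^bsub>A[X]\<^esub> N \<otimes>\<^bsub>A[X]\<^esub> f) u = eval [lead_coeff g] u [^] N \<otimes> eval f u"
    using c(3) f by (simp only: ev.hom_mult ev.hom_nat_pow UP.nat_pow_closed)
  moreover have "eval ((g \<otimes>\<^bsub>A[X]\<^esub> q) \<oplus>\<^bsub>A[X]\<^esub> r) u = (eval g u \<otimes> eval q u) \<oplus> eval r u"
    using g qr(1,2) by (simp only: ev.hom_mult ev.hom_add UP.m_closed)
  ultimately have "lead_coeff g [^] N \<otimes> eval f u = (eval g u \<otimes> eval q u) \<oplus> eval r u"
    unfolding c(4)[OF u] by simp
  from that[OF qr(1,2) this qr(4,3)] show thesis .
qed

text \<open>Over the field of fractions of \<open>A\<close> one would write \<open>1/t\<close> as a polynomial in \<open>u\<close> and clear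
  denominators. Without fractions: among the polynomials \<open>h\<close> for which \<open>h(u)\<close> is a nonzero multiple of
  \<open>t\<close>, one of least degree is constant. Indeed its degree is less than that of the minimal annihilator
  \<open>p\<close> of \<open>u\<close>, and dividing \<open>p\<close> by \<open>h\<close> must leave remainder \<open>0\<close> by minimality of both. The quotient
  then annihilates \<open>u\<close>, and since its degree is \<open>deg p - deg h\<close>, minimality of \<open>p\<close> gives \<open>deg h = 0\<close>.\<close>

lemma (in domain) nonzero_multiple_in_base:
  assumes A: "subring A R" and u: "u \<in> carrier R" and alg: "(algebraic over A) u"
    and t: "t \<in> simple_extension A u" "t \<noteq> \<zero>"
  obtains e w where "e \<in> A" "e \<noteq> \<zero>" "w \<in> simple_extension A u" "e = t \<otimes> w"
proof -
  interpret UP: domain "A[X]" by (rule univ_poly_is_domain[OF A])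
  interpret ev: ring_hom_ring "A[X]" R "\<lambda>p. eval p u" by (rule eval_ring_hom[OF A u])
  let ?B = "simple_extension A u"
  have im: "?B = (\<lambda>p. eval p u) ` carrier (A[X])"
    by (rule simple_extension_as_eval_img[OF subringE(1)[OF A] u])
  have Ac: "A \<subseteq> carrier R" by (rule subringE(1)[OF A])
  note B = simple_extension_is_subring[OF A u]
  have Bc: "?B \<subseteq> carrier R" by (rule subringE(1)[OF B])
  have tc: "t \<in> carrier R" using t Bc by auto
  obtain p where p: "p \<in> carrier (A[X])" "p \<noteq> []" "eval p u = \<zero>"
    and pmin: "\<And>q. q \<in> carrier (A[X]) \<Longrightarrow> eval q u = \<zero> \<Longrightarrow> q = [] \<or> degree p \<le> degree q"
    by (rule obtain_minimal_annihilator[OF A u alg]) (assumption | blast)+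
  let ?I = "\<lambda>q. q \<in> carrier (A[X]) \<and> eval q u \<noteq> \<zero> \<and> (\<exists>w \<in> ?B. eval q u = t \<otimes> w)"
  have "\<exists>q. ?I q"
  proof -
    obtain q where "q \<in> carrier (A[X])" "t = eval q u" using t(1) unfolding im by blast
    moreover have "t = t \<otimes> \<one>" "\<one> \<in> ?B" using tc subringE(3)[OF B] by auto
    ultimately show ?thesis using t(2) by blast
  qed
  then obtain t0 where "?I t0" by blast
  define h where "h = arg_min degree ?I"
  have h: "h \<in> carrier (A[X])" "eval h u \<noteq> \<zero>" "\<exists>w \<in> ?B. eval h u = t \<otimes> w"
    using arg_min_natI[of ?I, OF \<open>?I t0\<close>] unfolding h_def by blast+
  have hmin: "degree h \<le> degree q" if "?I q" for q
    using arg_min_nat_le[of ?I, OF that] unfolding h_def .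
  have hne: "h \<noteq> []" using h(2) by auto
  obtain w where w: "w \<in> ?B" "eval h u = t \<otimes> w" using h(3) by blast
  have wc: "w \<in> carrier R" using w Bc by auto
  \<comment> \<open>otherwise the remainder of \<open>h\<close> modulo \<open>p\<close> would be a smaller candidate for \<open>h\<close>\<close>
  have hp: "degree h < degree p"
  proof -
    obtain N :: nat and q r where qr: "q \<in> carrier (A[X])" "r \<in> carrier (A[X])"
      "lead_coeff p [^] N \<otimes> eval h u = (eval p u \<otimes> eval q u) \<oplus> eval r u" "r = [] \<or> degree r < degree p"
      by (rule pseudo_division_eval[OF A u p(1,2) h(1)]) blast
    note c = lead_coeff_const[OF A p(1,2)]
    have cN: "lead_coeff p [^] N \<in> carrier R" "lead_coeff p [^] N \<noteq> \<zero>" "lead_coeff p [^] N \<in> ?B"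
    proof -
      have cc: "lead_coeff p \<in> carrier R" "lead_coeff p \<in> ?B"
        using c Ac simple_extension_incl[OF Ac u] by auto
      thus "lead_coeff p [^] N \<in> carrier R" "lead_coeff p [^] N \<noteq> \<zero>"
        using pow_non_zero c(2) by auto
      show "lead_coeff p [^] N \<in> ?B" using cc(2) by (induct N) (auto simp: subringE(3,6)[OF B])
    qed
    have er: "eval r u = lead_coeff p [^] N \<otimes> eval h u" using qr p(3) by simp
    also have "\<dots> = t \<otimes> (lead_coeff p [^] N \<otimes> w)" unfolding w(2) using cN wc tc by (simp add: m_lcomm)
    finally have "?I r" using qr(2) er h(1,2) cN integral subringE(6)[OF B cN(3) w(1)]
      by (metis ev.hom_closed)
    thus ?thesis using hmin[of r] qr(4) by auto
  qed
  obtain N :: nat and q r where qr: "q \<in> carrier (A[X])" "r \<in> carrier (A[X])"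
      "lead_coeff h [^] N \<otimes> eval p u = (eval h u \<otimes> eval q u) \<oplus> eval r u" "r = [] \<or> degree r < degree h"
      "[lead_coeff h] [^]\<^bsub>A[X]\<^esub> N \<otimes>\<^bsub>A[X]\<^esub> p = (h \<otimes>\<^bsub>A[X]\<^esub> q) \<oplus>\<^bsub>A[X]\<^esub> r"
    by (rule pseudo_division_eval[OF A u h(1) hne p(1)]) blast
  note c = lead_coeff_const[OF A h(1) hne]
  have ec: "eval h u \<in> carrier R" "eval q u \<in> carrier R" "eval r u \<in> carrier R" using h qr by auto
  have "lead_coeff h \<in> carrier R" using c Ac by auto
  hence er: "(eval h u \<otimes> eval q u) \<oplus> eval r u = \<zero>" using qr(3) p(3) by simp
  have r0: "eval r u = \<zero>"
  proof (rule ccontr)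
    assume "eval r u \<noteq> \<zero>"
    moreover have "eval r u = \<ominus> (eval h u \<otimes> eval q u)" using er ec by (metis m_closed minus_equality add.m_comm)
    hence "eval r u = t \<otimes> (\<ominus> (w \<otimes> eval q u))" unfolding w(2) using tc wc ec by (simp add: m_assoc r_minus)
    moreover have "\<ominus> (w \<otimes> eval q u) \<in> ?B"
      using subringE(5,6)[OF B] w qr(1) unfolding im by blast
    ultimately have "?I r" using qr(2) by blast
    thus False using hmin[of r] qr(4) \<open>eval r u \<noteq> \<zero>\<close> by auto
  qed
  hence r: "r = []" using pmin[OF qr(2)] qr(4) hp by auto
  have q0: "eval q u = \<zero>" using er r0 ec h(2) integral by auto
  let ?cN = "[lead_coeff h] [^]\<^bsub>A[X]\<^esub> N"
  have cN: "?cN \<in> carrier (A[X])" "?cN \<noteq> []" using c UP.pow_non_zero[of "[lead_coeff h]" N]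
    by (auto simp: univ_poly_zero)
  have prod: "?cN \<otimes>\<^bsub>A[X]\<^esub> p = h \<otimes>\<^bsub>A[X]\<^esub> q"
    using qr(5) r UP.r_zero[OF UP.m_closed[OF h(1) qr(1)]] by (simp add: univ_poly_zero)
  have qne: "q \<noteq> []"
    using prod UP.integral[of ?cN p] cN p(1,2) UP.r_null[OF h(1)] by (auto simp: univ_poly_zero)
  have "degree ?cN = 0"
  proof (induct N)
    case (Suc N)
    let ?d = "[lead_coeff h] [^]\<^bsub>A[X]\<^esub> N"
    have "?d \<in> carrier (A[X])" using c by simp
    thus ?case using Suc poly_mult_degree_eq[OF A, of ?d "[lead_coeff h]"] c(3)
      by (simp add: univ_poly_carrier univ_poly_mult)
  qed (simp add: univ_poly_one)
  hence "degree p = degree h + degree q"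
    using prod poly_mult_degree_eq[OF A, of ?cN p] poly_mult_degree_eq[OF A, of h q] cN p(1,2) h(1) hne qr(1) qne
    by (simp add: univ_poly_carrier univ_poly_mult)
  hence "degree h = 0" using pmin[OF qr(1) q0] qne by auto
  then obtain e where "h = [e]" using hne by (cases h) auto
  hence "e \<in> A" "e \<noteq> \<zero>" "eval h u = e" using c c(4)[OF u] by auto
  thus thesis using that w by metis
qed

text \<open>Let \<open>t\<close> witness the property for \<open>A[u]\<close>, let \<open>c\<close> be the leading coefficient of a minimal
  annihilator \<open>p\<close> of \<open>u\<close>, and let \<open>e = t w\<close> be a nonzero multiple of \<open>t\<close> in \<open>A\<close>. Then \<open>c e\<close> is a witness
  for \<open>A\<close>: a nonzero \<open>a \<in> A\<close> divides some \<open>e\<^sup>n\<close> in \<open>A[u]\<close>, and reducing the cofactor modulo \<open>p\<close> gives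
  \<open>a r(u) = c\<^sup>N e\<^sup>n\<close> with \<open>deg r < deg p\<close>. As the powers of \<open>u\<close> below \<open>deg p\<close> are linearly independent,
  constant terms can be compared, and \<open>a\<close> divides \<open>c\<^sup>N e\<^sup>n\<close> in \<open>A\<close>. This replaces the usual appeal to
  integral dependence.\<close>

lemma (in domain) goldman_descent:
  assumes A: "subring A R" and u: "u \<in> carrier R" and G: "goldman (simple_extension A u)"
  shows "goldman A"
proof -
  interpret UP: domain "A[X]" by (rule univ_poly_is_domain[OF A])
  interpret ev: ring_hom_ring "A[X]" R "\<lambda>p. eval p u" by (rule eval_ring_hom[OF A u])
  let ?B = "simple_extension A u"
  have im: "?B = (\<lambda>p. eval p u) ` carrier (A[X])"
    by (rule simple_extension_as_eval_img[OF subringE(1)[OF A] u])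
  have Ac: "A \<subseteq> carrier R" by (rule subringE(1)[OF A])
  note B = simple_extension_is_subring[OF A u]
  have Bc: "?B \<subseteq> carrier R" by (rule subringE(1)[OF B])
  note alg = goldman_imp_algebraic[OF A u G]
  obtain t where t: "t \<in> ?B" "t \<noteq> \<zero>" and
    dv: "\<And>a. a \<in> ?B - {\<zero>} \<Longrightarrow> \<exists>n::nat. \<exists>b \<in> ?B. a \<otimes> b = t [^] n"
    using G unfolding goldman_def by blast
  have tc: "t \<in> carrier R" using t Bc by auto
  obtain e w where e: "e \<in> A" "e \<noteq> \<zero>" and w: "w \<in> ?B" "e = t \<otimes> w"
    using nonzero_multiple_in_base[OF A u alg t] by blast
  have wc: "w \<in> carrier R" using w Bc by auto
  obtain p where p: "p \<in> carrier (A[X])" "p \<noteq> []" "eval p u = \<zero>"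
    and pmin: "\<And>q. q \<in> carrier (A[X]) \<Longrightarrow> eval q u = \<zero> \<Longrightarrow> q = [] \<or> degree p \<le> degree q"
    by (rule obtain_minimal_annihilator[OF A u alg]) (assumption | blast)+
  note c = lead_coeff_const[OF A p(1,2)]
  let ?c = "lead_coeff p"
  have pow: "x [^] (n::nat) \<in> A" if "x \<in> A" for x n
    using that by (induct n) (auto simp: subringE(3,6)[OF A])
  have carr: "?c \<in> carrier R" "e \<in> carrier R" using c e Ac by auto
  have degp: "degree p > 0"
  proof (rule ccontr)
    assume "\<not> degree p > 0"
    hence "p = [?c]" using p(2) by (cases p) auto
    thus False using p(3) c(2) c(4)[OF u] by metis
  qed
  have "\<exists>n::nat. \<exists>b \<in> A. a \<otimes> b = (?c \<otimes> e) [^] n" if a: "a \<in> A - {\<zero>}" for a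
  proof -
    have ac: "a \<in> carrier R" "a \<in> ?B" using a Ac simple_extension_incl[OF Ac u] by auto
    obtain n :: nat and b where b: "b \<in> ?B" "a \<otimes> b = t [^] n" using dv[of a] ac a by blast
    have bc: "b \<in> carrier R" using b Bc by auto
    have "b \<otimes> w [^] n \<in> ?B"
    proof -
      have "w [^] k \<in> ?B" for k :: nat using w(1) by (induct k) (auto simp: subringE(3,6)[OF B])
      thus ?thesis using b(1) subringE(6)[OF B] by blast
    qed
    then obtain f where f: "f \<in> carrier (A[X])" "eval f u = b \<otimes> w [^] n" unfolding im by force
    have en: "a \<otimes> eval f u = e [^] n"
      using b ac bc wc tc unfolding w(2) f(2) by (simp add: nat_pow_distrib m_assoc[symmetric])
    obtain N :: nat and q r where qr: "q \<in> carrier (A[X])" "r \<in> carrier (A[X])"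
      "?c [^] N \<otimes> eval f u = (eval p u \<otimes> eval q u) \<oplus> eval r u" "r = [] \<or> degree r < degree p"
      by (rule pseudo_division_eval[OF A u p(1,2) f(1)]) blast
    have er: "eval r u = ?c [^] N \<otimes> eval f u" using qr p(3) by simp
    let ?d = "?c [^] N \<otimes> e [^] n"
    have cN: "?c [^] N \<in> carrier R" "e [^] n \<in> carrier R" using carr by simp_all
    have d: "?d \<in> A" using pow[OF c(1)] pow[OF e(1)] by (rule subringE(6)[OF A])
    have "?c [^] N \<noteq> \<zero>" "e [^] n \<noteq> \<zero>" using pow_non_zero carr c(2) e(2) by blast+
    hence d0: "?d \<noteq> \<zero>" using integral[OF _ cN] by blast
    \<comment> \<open>the relation \<open>a r(u) = d\<close> as a polynomial of degree less than \<open>deg p\<close> annihilating \<open>u\<close>\<close>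
    let ?k = "([a] \<otimes>\<^bsub>A[X]\<^esub> r) \<oplus>\<^bsub>A[X]\<^esub> [\<ominus> ?d]"
    have dc: "?d \<in> carrier R" using cN by simp
    have md: "\<ominus> ?d \<in> A" "\<ominus> ?d \<noteq> \<zero>"
      using subringE(5)[OF A d] d0 dc a_inv_closed minus_minus[OF dc] minus_zero by auto
    have poly: "[a] \<in> carrier (A[X])" "[\<ominus> ?d] \<in> carrier (A[X])"
      using a md by (auto simp: univ_poly_carrier[symmetric])
    have fe: "eval f u \<in> carrier R" using f(1) by (rule ev.hom_closed)
    have "eval ?k u = a \<otimes> eval r u \<oplus> \<ominus> ?d"
      using poly qr(2) ac dc by (simp only: ev.hom_add ev.hom_mult UP.m_closed) simp
    also have "a \<otimes> eval r u = ?d" unfolding er en[symmetric] using carr ac fe by (simp add: m_lcomm)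
    finally have "eval ?k u = \<zero>" using r_neg[OF dc] by simp
    moreover have "degree ?k < degree p"
    proof -
      have "degree ?k \<le> max (degree ([a] \<otimes>\<^bsub>A[X]\<^esub> r)) (degree [\<ominus> ?d])"
        unfolding univ_poly_add by (rule poly_add_degree)
      moreover have "degree ([a] \<otimes>\<^bsub>A[X]\<^esub> r) \<le> degree r"
        using poly_mult_degree_eq[OF A, of "[a]" r] poly qr(2) by (simp add: univ_poly_carrier univ_poly_mult)
      ultimately show ?thesis using qr(4) degp by auto
    qed
    ultimately have "?k = []" using pmin[of ?k] poly qr(2) by force
    hence "const_term ?k = \<zero>" by (simp add: const_term_def)
    moreover have "const_term ?k = a \<otimes> const_term r \<oplus> \<ominus> ?d"
      using const_term_simprules_shell(2,3)[OF A] poly qr(2) const_term_eq_last[of "[]"] ac md carr by simp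
    moreover have r0: "const_term r \<in> A" by (rule const_term_simprules_shell(1)[OF A qr(2)])
    ultimately have ar: "a \<otimes> const_term r = ?d" using ac(1) dc Ac
      by (metis r_right_minus_eq minus_eq m_closed subsetD)
    \<comment> \<open>the factors \<open>c\<^sup>n e\<^sup>N\<close> make the two exponents equal\<close>
    let ?b = "const_term r \<otimes> (?c [^] n \<otimes> e [^] N)"
    have "a \<otimes> ?b = (?c \<otimes> e) [^] (N + n)"
    proof -
      have "a \<otimes> ?b = ?d \<otimes> (?c [^] n \<otimes> e [^] N)"
        unfolding ar[symmetric] using ac carr r0 Ac by (intro m_assoc[symmetric]) auto
      also have "\<dots> = (?c [^] N \<otimes> ?c [^] n) \<otimes> (e [^] N \<otimes> e [^] n)"
        using nat_pow_closed[OF carr(1)] nat_pow_closed[OF carr(2)] by algebra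
      also have "\<dots> = (?c \<otimes> e) [^] (N + n)" using carr by (simp add: nat_pow_mult nat_pow_distrib)
      finally show ?thesis .
    qed
    moreover have "?b \<in> A" using r0 pow c e subringE(6)[OF A] by auto
    ultimately show ?thesis by blast
  qed
  moreover have "?c \<otimes> e \<in> A - {\<zero>}" using c e carr subringE(6)[OF A] integral by auto
  ultimately show ?thesis unfolding goldman_def by blast
qed

lemma (in domain) goldman_finite_extension:
  assumes A: "subring A R"
  shows "set xs \<subseteq> carrier R \<Longrightarrow> goldman (finite_extension A xs) \<Longrightarrow> goldman A"
proof (induct xs)
  case (Cons x xs)
  have "goldman (finite_extension A xs)"
    using Cons.prems by (intro goldman_descent[OF finite_extension_is_subring[OF A], of xs x]) auto
  thus ?case using Cons by auto
qed simp

text \<open>A field is a Goldman domain with witness \<open>1\<close>. Descending through all generators but the last makes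
  \<open>K[x]\<close> a Goldman domain, so \<open>x\<close> is algebraic, lies in \<open>K\<close> and can be discarded.\<close>

lemma (in field) finite_extension_of_closed_subfield:
  assumes K: "subfield K R" and closed: "\<And>u. u \<in> carrier R \<Longrightarrow> (algebraic over K) u \<Longrightarrow> u \<in> K"
  shows "set xs \<subseteq> carrier R \<Longrightarrow> finite_extension K xs = carrier R \<Longrightarrow> K = carrier R"
proof (induct xs rule: rev_induct)
  case (snoc x xs)
  note KR = subfieldE(1)[OF K]
  have x: "x \<in> carrier R" and xs: "set xs \<subseteq> carrier R" using snoc.prems by auto
  have fe: "finite_extension K (xs @ [x]) = finite_extension (simple_extension K x) xs" by simp
  have "\<exists>n::nat. \<exists>b \<in> carrier R. a \<otimes> b = \<one> [^] n" if "a \<in> carrier R - {\<zero>}" for a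
    using that field_Units by (intro exI[of _ 0] bexI[of _ "inv a"]) auto
  hence "goldman (carrier R)" unfolding goldman_def by (intro bexI[of _ \<one>]) auto
  hence "goldman (finite_extension (simple_extension K x) xs)" using snoc.prems fe by simp
  hence "goldman (simple_extension K x)"
    by (rule goldman_finite_extension[OF simple_extension_is_subring[OF KR x] xs])
  hence "x \<in> K" using closed[OF x] goldman_imp_algebraic[OF KR x] by blast
  hence "simple_extension K x = K"
    using simple_extension_subring_incl[OF KR subset_refl] simple_extension_incl[OF subringE(1)[OF KR] x] by blast
  thus ?case using snoc fe xs by simp
qed simp

text \<open>An annihilating polynomial of \<open>u\<close> is the image of a polynomial over \<open>K\<close>, which splits off linear
  factors until one of them vanishes at \<open>u\<close>.\<close>

lemma algebraically_closed_image:
  assumes K: "algebraically_closed K" and L: "field L" and h: "h \<in> ring_hom K L"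
    and u: "u \<in> carrier L" and alg: "(ring.algebraic L over (h ` carrier K)) u"
  shows "u \<in> h ` carrier K"
proof -
  interpret K: algebraically_closed K by fact
  interpret L: field L by fact
  interpret h: ring_hom_ring K L h using h by unfold_locales
  have sf: "subfield (h ` carrier K) L" and inj: "inj_on h (carrier K)"
    using h.img_is_subfield[OF K.carrier_is_subfield] by simp_all
  have root: "u \<in> h ` carrier K"
    if "q \<in> carrier (poly_ring K)" "q \<noteq> []" "L.eval (map h q) u = \<zero>\<^bsub>L\<^esub>" for q
    using that
  proof (induction "length q" arbitrary: q rule: less_induct)
    case less
    interpret UP: domain "poly_ring K" by (rule K.univ_poly_is_domain[OF K.carrier_is_subring])
    have pq: "polynomial\<^bsub>K\<^esub> (carrier K) q" using less.prems(1) by (simp add: univ_poly_carrier)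
    show ?case
    proof (cases "degree q = 0")
      case True
      then obtain c where c: "q = [c]" using less.prems(2) by (cases q) auto
      hence cK: "c \<in> carrier K" "c \<noteq> \<zero>\<^bsub>K\<^esub>" using pq by (auto simp: polynomial_def)
      hence "h c = \<zero>\<^bsub>L\<^esub>" using less.prems(3) c u by simp
      hence "c = \<zero>\<^bsub>K\<^esub>" using inj cK h.hom_zero by (metis K.zero_closed inj_onD)
      thus ?thesis using cK by simp
    next
      case False
      have "K.splitted q" using K.roots_over_carrier[OF less.prems(1)] .
      hence "K.roots q \<noteq> {#}" using False unfolding K.splitted_def by auto
      then obtain a where a: "a \<in># K.roots q" by blast
      hence "K.is_root q a" using K.roots_mem_iff_is_root[OF less.prems(1)] by blast
      hence aK: "a \<in> carrier K" and dv: "[\<one>\<^bsub>K\<^esub>, \<ominus>\<^bsub>K\<^esub> a] pdivides\<^bsub>K\<^esub> q"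
        using K.is_root_imp_pdivides[OF less.prems(1)] by (auto simp: K.is_root_def)
      let ?l = "[\<one>\<^bsub>K\<^esub>, \<ominus>\<^bsub>K\<^esub> a]"
      obtain q' where q': "q' \<in> carrier (poly_ring K)" "q = ?l \<otimes>\<^bsub>poly_ring K\<^esub> q'"
        using dv unfolding pdivides_def factor_def by blast
      have l: "?l \<in> carrier (poly_ring K)" using aK
        by (simp add: univ_poly_carrier[symmetric] polynomial_def)
      have q'ne: "q' \<noteq> []" using q' UP.r_null[OF l] less.prems(2) by (auto simp: univ_poly_zero)
      have "degree q = degree ?l + degree q'"
        unfolding q'(2) univ_poly_mult
        using K.poly_mult_degree_eq[OF K.carrier_is_subring, of ?l q'] l q'(1) q'ne
        by (simp add: univ_poly_carrier)
      hence len: "length q' < length q" using q'ne less.prems(2) by (cases q; cases q') auto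
      have set: "set ?l \<subseteq> carrier K" "set q' \<subseteq> carrier K"
        using aK q'(1) by (auto simp: univ_poly_carrier[symmetric] polynomial_def)
      have hset: "set (map h ?l) \<subseteq> carrier L" "set (map h q') \<subseteq> carrier L" "set (map h q) \<subseteq> carrier L"
        using set pq by (auto simp: polynomial_def)
      have "L.eval (map h q) u = L.eval (L.normalize (map h q)) u"
        using L.eval_normalize[OF hset(3) u] by simp
      also have "L.normalize (map h q) = L.poly_mult (map h ?l) (map h q')"
        unfolding q'(2) univ_poly_mult by (rule h.poly_mult_hom'[OF set])
      also have "L.eval \<dots> u = L.eval (map h ?l) u \<otimes>\<^bsub>L\<^esub> L.eval (map h q') u"
        by (rule L.eval_poly_mult[OF hset(1,2) u])
      finally have "L.eval (map h ?l) u = \<zero>\<^bsub>L\<^esub> \<or> L.eval (map h q') u = \<zero>\<^bsub>L\<^esub>"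
        using less.prems(3) L.integral L.eval_in_carrier[OF hset(1) u] L.eval_in_carrier[OF hset(2) u] by metis
      thus ?thesis
      proof
        assume "L.eval (map h ?l) u = \<zero>\<^bsub>L\<^esub>"
        hence "u \<oplus>\<^bsub>L\<^esub> \<ominus>\<^bsub>L\<^esub> h a = \<zero>\<^bsub>L\<^esub>" using u aK h.hom_closed[OF aK] by simp
        hence "u = h a" using u h.hom_closed[OF aK] by (metis L.minus_eq L.r_right_minus_eq)
        thus ?thesis using aK by blast
      next
        assume "L.eval (map h q') u = \<zero>\<^bsub>L\<^esub>"
        thus ?thesis by (rule less.hyps[OF len q'(1) q'ne])
      qed
    qed
  qed
  obtain p where p: "p \<in> carrier ((h ` carrier K)[X]\<^bsub>L\<^esub>)" "p \<noteq> []" "L.eval p u = \<zero>\<^bsub>L\<^esub>"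
    by (rule L.algebraicE[OF subfieldE(1)[OF sf] u alg])
  have pp: "set p \<subseteq> h ` carrier K" "hd p \<noteq> \<zero>\<^bsub>L\<^esub>"
    using p by (auto simp: univ_poly_carrier[symmetric] polynomial_def)
  define q where "q = map (inv_into (carrier K) h) p"
  have mq: "map h q = p" unfolding q_def using pp(1) by (auto simp: map_idI f_inv_into_f subset_iff)
  have "set q \<subseteq> carrier K" unfolding q_def using pp(1) by (auto intro: inv_into_into)
  moreover have "q \<noteq> []" using mq p(2) by auto
  moreover have "hd q \<noteq> \<zero>\<^bsub>K\<^esub>" using mq pp(2) calculation(2) h.hom_zero by (metis list.map_sel(1))
  ultimately have "q \<in> carrier (poly_ring K)" "q \<noteq> []"
    by (auto simp: univ_poly_carrier[symmetric] polynomial_def)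
  thus ?thesis using root mq p(3) by simp
qed

theorem weak_nullstellensatz:
  assumes K: "algebraically_closed K" and L: "field L" and h: "h \<in> ring_hom K L"
    and S: "finite S" "S \<subseteq> carrier L" and gen: "generate_ring L (h ` carrier K \<union> S) = carrier L"
  shows "h ` carrier K = carrier L"
proof -
  interpret K: algebraically_closed K by fact
  interpret L: field L by fact
  interpret h: ring_hom_ring K L h using h by unfold_locales
  have sf: "subfield (h ` carrier K) L"
    using h.img_is_subfield[OF K.carrier_is_subfield] by simp
  note sr = subfieldE(1)[OF sf]
  obtain xs where xs: "set xs = S" using finite_list[OF S(1)] by blast
  have "generate_ring L (h ` carrier K \<union> S) \<subseteq> L.finite_extension (h ` carrier K) xs"
    using L.finite_extension_is_subring[OF sr, of xs] L.finite_extension_mem[OF sr, of xs]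
      L.finite_extension_incl[OF subringE(1)[OF sr], of xs] subringE(1)[OF sr] S(2) xs
    by (intro L.generate_ring_min_subring1) auto
  hence "L.finite_extension (h ` carrier K) xs = carrier L"
    using gen L.finite_extension_in_carrier[OF subringE(1)[OF sr], of xs] S(2) xs by auto
  thus ?thesis
    using L.finite_extension_of_closed_subfield[OF sf algebraically_closed_image[OF K L h]] xs S(2) by blast
qed

text \<open>The residue field of \<open>I\<close> is generated over \<open>K\<close> by finitely many elements, so it is \<open>K\<close>.\<close>

lemma nullstellensatz_maximal_ideal:
  assumes K: "algebraically_closed K" and A: "cring A" and h: "h \<in> ring_hom K A"
    and S: "finite S" "S \<subseteq> carrier A" and gen: "generate_ring A (h ` carrier K \<union> S) = carrier A"
    and I: "maximalideal I A" and a: "a \<in> carrier A"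
  obtains c where "c \<in> carrier K" "a \<ominus>\<^bsub>A\<^esub> h c \<in> I"
proof -
  interpret K: algebraically_closed K by fact
  interpret A: cring A by fact
  interpret I: maximalideal I A by fact
  let ?L = "A Quot I" and ?\<pi> = "(+>\<^bsub>A\<^esub>) I"
  interpret L: field ?L using I.quotient_is_field[OF A] .
  interpret \<pi>: ring_hom_ring A ?L ?\<pi> by (rule I.rcos_ring_hom_ring)
  have ph: "?\<pi> \<circ> h \<in> ring_hom K ?L" by (rule ring_hom_trans[OF h \<pi>.homh])
  have hc: "h ` carrier K \<subseteq> carrier A" using ring_hom_closed[OF h] by auto
  have T: "(?\<pi> \<circ> h) ` carrier K \<union> ?\<pi> ` S \<subseteq> carrier ?L" using hc S(2) by auto
  have "?\<pi> b \<in> generate_ring ?L ((?\<pi> \<circ> h) ` carrier K \<union> ?\<pi> ` S)"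
    if "b \<in> generate_ring A (h ` carrier K \<union> S)" for b
    using that
  proof induct
    case one
    thus ?case using generate_ring.one[of ?L] by (simp only: \<pi>.hom_one)
  next
    case (incl b)
    thus ?case by (auto intro!: generate_ring.incl)
  next
    case (a_inv b)
    hence "b \<in> carrier A" using A.generate_ring_in_carrier[of "h ` carrier K \<union> S"] hc S(2) by auto
    thus ?case using generate_ring.a_inv[OF a_inv(2)] by (simp only: \<pi>.hom_a_inv)
  next
    case (eng_add b b')
    hence "b \<in> carrier A" "b' \<in> carrier A" using A.generate_ring_in_carrier[of "h ` carrier K \<union> S"] hc S(2) by auto
    thus ?case using generate_ring.eng_add[OF eng_add(2,4)] by (simp only: \<pi>.hom_add)
  next
    case (eng_mult b b')
    hence "b \<in> carrier A" "b' \<in> carrier A" using A.generate_ring_in_carrier[of "h ` carrier K \<union> S"] hc S(2) by auto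
    thus ?case using generate_ring.eng_mult[OF eng_mult(2,4)] by (simp only: \<pi>.hom_mult)
  qed
  hence "?\<pi> ` carrier A \<subseteq> generate_ring ?L ((?\<pi> \<circ> h) ` carrier K \<union> ?\<pi> ` S)" using gen by auto
  moreover have "?\<pi> ` carrier A = carrier ?L" by (auto simp: FactRing_def A_RCOSETS_def' a_r_coset_def')
  ultimately have "generate_ring ?L ((?\<pi> \<circ> h) ` carrier K \<union> ?\<pi> ` S) = carrier ?L"
    using L.generate_ring_incl[OF T] by auto
  hence "(?\<pi> \<circ> h) ` carrier K = carrier ?L"
    using S by (intro weak_nullstellensatz[OF K L.field_axioms ph]) auto
  moreover have "?\<pi> a \<in> carrier ?L" using a by simp
  ultimately obtain c where c: "c \<in> carrier K" "?\<pi> a = ?\<pi> (h c)" by (metis comp_apply imageE)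
  hence "a \<ominus>\<^bsub>A\<^esub> h c \<in> I" using A.quotient_eq_iff_same_a_r_cos[OF I.is_ideal a, of "h c"] hc by auto
  thus thesis using that c by blast
qed

section \<open>Skew group rings\<close>

text \<open>The group algebra is the case of the trivial action on \<open>K\<close>, so one development serves both
  \<open>K[G]\<close> and \<open>R#G\<close>.\<close>

locale skew_ring = R?: ring R + G?: group G
  for R :: "('k, 'r, 'd) module_scheme" (structure) and G :: "('g, 'c) monoid_scheme" (structure) +
  fixes act :: "'g \<Rightarrow> 'r \<Rightarrow> 'r"
  assumes act_ring_hom: "g \<in> carrier G \<Longrightarrow> act g \<in> ring_hom R R"
    and act_one: "r \<in> carrier R \<Longrightarrow> act \<one>\<^bsub>G\<^esub> r = r"
    and act_mult: "\<lbrakk>g \<in> carrier G; h \<in> carrier G; r \<in> carrier R\<rbrakk>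
      \<Longrightarrow> act (g \<otimes>\<^bsub>G\<^esub> h) r = act g (act h r)"
begin

abbreviation "H \<equiv> skew_group_ring R G act"

text \<open>The formal sum with the single term \<open>r g\<close>.\<close>

definition mon :: "'r \<Rightarrow> 'g \<Rightarrow> 'g \<Rightarrow> 'r" where
  "mon r g = (\<lambda>k. if k = g then r else \<zero>)"

definition supp :: "('g \<Rightarrow> 'r) \<Rightarrow> 'g set" where
  "supp a = {g \<in> carrier G. a g \<noteq> \<zero>}"

lemma act_hom [simp]:
  assumes "g \<in> carrier G"
  shows "r \<in> carrier R \<Longrightarrow> act g r \<in> carrier R"
    and "r \<in> carrier R \<Longrightarrow> s \<in> carrier R \<Longrightarrow> act g (r \<oplus> s) = act g r \<oplus> act g s"
    and "r \<in> carrier R \<Longrightarrow> s \<in> carrier R \<Longrightarrow> act g (r \<otimes> s) = act g r \<otimes> act g s"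
    and "act g \<one> = \<one>" and "act g \<zero> = \<zero>"
proof -
  note h = act_ring_hom[OF assms]
  show "r \<in> carrier R \<Longrightarrow> act g r \<in> carrier R" by (rule ring_hom_closed[OF h])
  show "r \<in> carrier R \<Longrightarrow> s \<in> carrier R \<Longrightarrow> act g (r \<oplus> s) = act g r \<oplus> act g s" by (rule ring_hom_add[OF h])
  show "r \<in> carrier R \<Longrightarrow> s \<in> carrier R \<Longrightarrow> act g (r \<otimes> s) = act g r \<otimes> act g s" by (rule ring_hom_mult[OF h])
  show "act g \<one> = \<one>" by (rule ring_hom_one[OF h])
  show "act g \<zero> = \<zero>" by (rule ring_hom_zero[OF h R.ring_axioms R.ring_axioms])
qed

lemma carrier_iff: "a \<in> carrier H \<longleftrightarrow>
    (\<forall>g \<in> carrier G. a g \<in> carrier R) \<and> (\<forall>g. g \<notin> carrier G \<longrightarrow> a g = \<zero>) \<and> finite (supp a)"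
  by (simp add: skew_group_ring_def supp_def)

lemma coeff_closed: "a \<in> carrier H \<Longrightarrow> a g \<in> carrier R"
  by (cases "g \<in> carrier G") (auto simp: carrier_iff)

lemma coeff_outside: "a \<in> carrier H \<Longrightarrow> g \<notin> carrier G \<Longrightarrow> a g = \<zero>"
  by (simp add: carrier_iff)

lemma finite_supp: "a \<in> carrier H \<Longrightarrow> finite (supp a)"
  by (simp add: carrier_iff)

lemma supp_carrier: "supp a \<subseteq> carrier G"
  by (auto simp: supp_def)

lemma H_zero: "\<zero>\<^bsub>H\<^esub> = (\<lambda>g. \<zero>)" and H_one: "\<one>\<^bsub>H\<^esub> = mon \<one> \<one>\<^bsub>G\<^esub>"
  and H_add: "a \<oplus>\<^bsub>H\<^esub> b = (\<lambda>g. a g \<oplus> b g)"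
  unfolding skew_group_ring_def mon_def by simp_all

lemma skew_const_mon: "skew_const R G r = mon r \<one>\<^bsub>G\<^esub>"
  by (simp only: skew_const_def mon_def)

text \<open>Enlarging the index set of the sum to any finite \<open>S\<close> containing the support allows sums
  belonging to different elements to be added.\<close>

lemma H_mult:
  assumes a: "a \<in> carrier H" and b: "b \<in> carrier H"
    and S: "finite S" "supp a \<subseteq> S" "S \<subseteq> carrier G" and k: "k \<in> carrier G"
  shows "(a \<otimes>\<^bsub>H\<^esub> b) k = (\<Oplus>g \<in> S. a g \<otimes> act g (b (inv\<^bsub>G\<^esub> g \<otimes>\<^bsub>G\<^esub> k)))"
proof -
  have "(a \<otimes>\<^bsub>H\<^esub> b) k = (\<Oplus>g \<in> supp a. a g \<otimes> act g (b (inv\<^bsub>G\<^esub> g \<otimes>\<^bsub>G\<^esub> k)))"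
    using k by (simp add: skew_group_ring_def supp_def)
  also have "\<dots> = (\<Oplus>g \<in> S. a g \<otimes> act g (b (inv\<^bsub>G\<^esub> g \<otimes>\<^bsub>G\<^esub> k)))"
    using S(1,2) subsetD[OF S(3)] coeff_closed[OF a] coeff_closed[OF b]
    by (intro add.finprod_mono_neutral_cong_left) (auto simp: supp_def)
  finally show ?thesis .
qed

lemma H_mult_outside: "k \<notin> carrier G \<Longrightarrow> (a \<otimes>\<^bsub>H\<^esub> b) k = \<zero>"
  by (simp add: skew_group_ring_def)

lemma mon_closed [simp]: "r \<in> carrier R \<Longrightarrow> g \<in> carrier G \<Longrightarrow> mon r g \<in> carrier H"
proof -
  assume "r \<in> carrier R" "g \<in> carrier G"
  moreover have "supp (mon r g) \<subseteq> {g}" by (auto simp: supp_def mon_def)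
  ultimately show ?thesis by (auto simp: carrier_iff mon_def finite_subset)
qed

lemma zero_closed_H [simp]: "(\<lambda>g. \<zero>) \<in> carrier H"
  by (auto simp: carrier_iff supp_def)

lemma add_closed_H:
  assumes "a \<in> carrier H" "b \<in> carrier H" shows "(\<lambda>g. a g \<oplus> b g) \<in> carrier H"
proof -
  have "supp (\<lambda>g. a g \<oplus> b g) \<subseteq> supp a \<union> supp b" by (auto simp: supp_def)
  thus ?thesis using assms by (auto simp: carrier_iff finite_subset)
qed

text \<open>Every element is a finite sum of terms \<open>r g\<close>. As the product is biadditive, identities need to be
  checked for such terms only.\<close>

lemma induct_mon [consumes 1, case_names zero mon add]:
  assumes a: "a \<in> carrier H" and zero: "P \<zero>\<^bsub>H\<^esub>"
    and mon: "\<And>r g. r \<in> carrier R \<Longrightarrow> g \<in> carrier G \<Longrightarrow> P (mon r g)"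
    and add: "\<And>a b. a \<in> carrier H \<Longrightarrow> b \<in> carrier H \<Longrightarrow> P a \<Longrightarrow> P b \<Longrightarrow> P (a \<oplus>\<^bsub>H\<^esub> b)"
  shows "P a"
  using a
proof (induction "card (supp a)" arbitrary: a)
  case 0
  hence "supp a = {}" using finite_supp by auto
  hence "a = (\<lambda>g. \<zero>)" using coeff_outside[OF 0(2)] by (auto simp: supp_def fun_eq_iff)
  thus ?case using zero by (simp add: H_zero)
next
  case (Suc n)
  then obtain g where g: "g \<in> supp a" by (metis card.empty equals0I nat.distinct(1))
  hence gG: "g \<in> carrier G" by (simp add: supp_def)
  let ?b = "\<lambda>k. if k = g then \<zero> else a k"
  have sb: "supp ?b = supp a - {g}" by (auto simp: supp_def)
  have b: "?b \<in> carrier H" using Suc.prems finite_supp[OF Suc.prems] by (auto simp: carrier_iff sb)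
  have "a = ?b \<oplus>\<^bsub>H\<^esub> mon (a g) g" using coeff_closed[OF Suc.prems] by (auto simp: H_add mon_def)
  moreover have "P ?b" using Suc.hyps g finite_supp[OF Suc.prems] by (intro Suc.hyps(1)[OF _ b]) (simp add: sb)
  moreover have "P (mon (a g) g)" using coeff_closed[OF Suc.prems] gG by (intro mon) auto
  ultimately show ?case using add[OF b mon_closed[OF coeff_closed[OF Suc.prems] gG]] by metis
qed

lemma abelian_group_H: "abelian_group H"
proof (rule abelian_groupI)
  fix a assume a: "a \<in> carrier H"
  have "supp (\<lambda>g. \<ominus> a g) = supp a"
    using coeff_closed[OF a] by (auto simp: supp_def)
  hence "(\<lambda>g. \<ominus> a g) \<in> carrier H" using a by (simp add: carrier_iff)
  moreover have "(\<lambda>g. \<ominus> a g) \<oplus>\<^bsub>H\<^esub> a = \<zero>\<^bsub>H\<^esub>" using coeff_closed[OF a] by (auto simp: H_add H_zero R.l_neg)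
  ultimately show "\<exists>b \<in> carrier H. b \<oplus>\<^bsub>H\<^esub> a = \<zero>\<^bsub>H\<^esub>" by blast
qed (auto simp: H_add H_zero add_closed_H coeff_closed R.a_ac)

lemma add_H_closed [simp]: "a \<in> carrier H \<Longrightarrow> b \<in> carrier H \<Longrightarrow> a \<oplus>\<^bsub>H\<^esub> b \<in> carrier H"
  by (simp add: H_add add_closed_H)

lemma H_l_distr:
  assumes a: "a \<in> carrier H" "a' \<in> carrier H" and b: "b \<in> carrier H"
  shows "(a \<oplus>\<^bsub>H\<^esub> a') \<otimes>\<^bsub>H\<^esub> b = a \<otimes>\<^bsub>H\<^esub> b \<oplus>\<^bsub>H\<^esub> a' \<otimes>\<^bsub>H\<^esub> b"
proof
  fix k
  let ?S = "supp a \<union> supp a'"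
  have S: "finite ?S" "supp (a \<oplus>\<^bsub>H\<^esub> a') \<subseteq> ?S" "supp a \<subseteq> ?S" "supp a' \<subseteq> ?S" "?S \<subseteq> carrier G"
    using a finite_supp by (auto simp: supp_def H_add)
  show "((a \<oplus>\<^bsub>H\<^esub> a') \<otimes>\<^bsub>H\<^esub> b) k = (a \<otimes>\<^bsub>H\<^esub> b \<oplus>\<^bsub>H\<^esub> a' \<otimes>\<^bsub>H\<^esub> b) k"
  proof (cases "k \<in> carrier G")
    case True
    have "((a \<oplus>\<^bsub>H\<^esub> a') \<otimes>\<^bsub>H\<^esub> b) k
        = (\<Oplus>g \<in> ?S. a g \<otimes> act g (b (inv\<^bsub>G\<^esub> g \<otimes>\<^bsub>G\<^esub> k)) \<oplus> a' g \<otimes> act g (b (inv\<^bsub>G\<^esub> g \<otimes>\<^bsub>G\<^esub> k)))"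
      unfolding H_mult[OF add_H_closed[OF a] b S(1,2,5) True]
      using coeff_closed[OF a(1)] coeff_closed[OF a(2)] coeff_closed[OF b] subsetD[OF S(5)]
      by (intro R.finsum_cong') (auto simp: H_add R.l_distr)
    also have "\<dots> = (a \<otimes>\<^bsub>H\<^esub> b \<oplus>\<^bsub>H\<^esub> a' \<otimes>\<^bsub>H\<^esub> b) k"
      unfolding H_add H_mult[OF a(1) b S(1,3,5) True] H_mult[OF a(2) b S(1,4,5) True]
      using coeff_closed[OF a(1)] coeff_closed[OF a(2)] coeff_closed[OF b] subsetD[OF S(5)]
      by (intro R.finsum_addf) auto
    finally show ?thesis .
  qed (simp add: H_mult_outside H_add)
qed

lemma H_r_distr:
  assumes a: "a \<in> carrier H" and b: "b \<in> carrier H" "b' \<in> carrier H"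
  shows "a \<otimes>\<^bsub>H\<^esub> (b \<oplus>\<^bsub>H\<^esub> b') = a \<otimes>\<^bsub>H\<^esub> b \<oplus>\<^bsub>H\<^esub> a \<otimes>\<^bsub>H\<^esub> b'"
proof
  fix k
  note S = finite_supp[OF a] subset_refl supp_carrier[of a]
  show "(a \<otimes>\<^bsub>H\<^esub> (b \<oplus>\<^bsub>H\<^esub> b')) k = (a \<otimes>\<^bsub>H\<^esub> b \<oplus>\<^bsub>H\<^esub> a \<otimes>\<^bsub>H\<^esub> b') k"
  proof (cases "k \<in> carrier G")
    case True
    have "(a \<otimes>\<^bsub>H\<^esub> (b \<oplus>\<^bsub>H\<^esub> b')) k
        = (\<Oplus>g \<in> supp a. a g \<otimes> act g (b (inv\<^bsub>G\<^esub> g \<otimes>\<^bsub>G\<^esub> k)) \<oplus> a g \<otimes> act g (b' (inv\<^bsub>G\<^esub> g \<otimes>\<^bsub>G\<^esub> k)))"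
      unfolding H_mult[OF a add_H_closed[OF b] S True]
      using coeff_closed[OF a] coeff_closed[OF b(1)] coeff_closed[OF b(2)] subsetD[OF S(3)]
      by (intro R.finsum_cong') (auto simp: H_add R.r_distr)
    also have "\<dots> = (a \<otimes>\<^bsub>H\<^esub> b \<oplus>\<^bsub>H\<^esub> a \<otimes>\<^bsub>H\<^esub> b') k"
      unfolding H_add H_mult[OF a b(1) S True] H_mult[OF a b(2) S True]
      using coeff_closed[OF a] coeff_closed[OF b(1)] coeff_closed[OF b(2)] subsetD[OF S(3)]
      by (intro R.finsum_addf) auto
    finally show ?thesis .
  qed (simp add: H_mult_outside H_add)
qed

lemma mon_mult_apply:
  assumes r: "r \<in> carrier R" and g: "g \<in> carrier G" and b: "b \<in> carrier H" and k: "k \<in> carrier G"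
  shows "(mon r g \<otimes>\<^bsub>H\<^esub> b) k = r \<otimes> act g (b (inv\<^bsub>G\<^esub> g \<otimes>\<^bsub>G\<^esub> k))"
proof -
  have "supp (mon r g) \<subseteq> {g}" by (auto simp: supp_def mon_def)
  thus ?thesis using H_mult[OF mon_closed[OF r g] b _ _ _ k, of "{g}"] r g coeff_closed[OF b] by (simp add: mon_def)
qed

lemma mon_mult:
  assumes r: "r \<in> carrier R" and g: "g \<in> carrier G" and s: "s \<in> carrier R" and h: "h \<in> carrier G"
  shows "mon r g \<otimes>\<^bsub>H\<^esub> mon s h = mon (r \<otimes> act g s) (g \<otimes>\<^bsub>G\<^esub> h)"
proof
  fix k
  have "inv\<^bsub>G\<^esub> g \<otimes>\<^bsub>G\<^esub> k = h \<longleftrightarrow> k = g \<otimes>\<^bsub>G\<^esub> h" if "k \<in> carrier G"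
    using that g h by (metis G.inv_solve_left)
  thus "(mon r g \<otimes>\<^bsub>H\<^esub> mon s h) k = mon (r \<otimes> act g s) (g \<otimes>\<^bsub>G\<^esub> h) k"
    using assms mon_mult_apply[OF r g mon_closed[OF s h]] H_mult_outside[of k]
    by (cases "k \<in> carrier G") (auto simp: mon_def)
qed

lemma H_zero_closed: "\<zero>\<^bsub>H\<^esub> \<in> carrier H"
  by (simp add: H_zero)

lemma H_l_zero: "b \<in> carrier H \<Longrightarrow> \<zero>\<^bsub>H\<^esub> \<otimes>\<^bsub>H\<^esub> b = \<zero>\<^bsub>H\<^esub>"
proof
  fix k assume b: "b \<in> carrier H"
  show "(\<zero>\<^bsub>H\<^esub> \<otimes>\<^bsub>H\<^esub> b) k = \<zero>\<^bsub>H\<^esub> k"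
    using H_mult[OF H_zero_closed b, of "{}" k] H_mult_outside[of k]
    by (cases "k \<in> carrier G") (auto simp: H_zero supp_def)
qed

lemma H_r_zero: "a \<in> carrier H \<Longrightarrow> a \<otimes>\<^bsub>H\<^esub> \<zero>\<^bsub>H\<^esub> = \<zero>\<^bsub>H\<^esub>"
proof
  fix k assume a: "a \<in> carrier H"
  have "(\<Oplus>g \<in> supp a. a g \<otimes> act g (\<zero>\<^bsub>H\<^esub> (inv\<^bsub>G\<^esub> g \<otimes>\<^bsub>G\<^esub> k))) = (\<Oplus>g \<in> supp a. \<zero>)"
    using coeff_closed[OF a] by (intro R.finsum_cong') (auto simp: H_zero supp_def)
  thus "(a \<otimes>\<^bsub>H\<^esub> \<zero>\<^bsub>H\<^esub>) k = \<zero>\<^bsub>H\<^esub> k"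
    using H_mult[OF a H_zero_closed finite_supp[OF a] subset_refl supp_carrier, of k] H_mult_outside[of k]
    by (cases "k \<in> carrier G") (auto simp: H_zero)
qed

lemma H_m_closed:
  assumes a: "a \<in> carrier H" and b: "b \<in> carrier H" shows "a \<otimes>\<^bsub>H\<^esub> b \<in> carrier H"
  using a
proof (induct rule: induct_mon)
  case zero
  show ?case using b by (simp add: H_l_zero H_zero_closed)
next
  case (mon r g)
  show ?case using b
    by (induct rule: induct_mon) (use mon in \<open>simp_all add: H_r_zero H_zero_closed mon_mult H_r_distr\<close>)
next
  case (add a a')
  thus ?case using b by (simp add: H_l_distr)
qed

lemma H_assoc:
  assumes a: "a \<in> carrier H" and b: "b \<in> carrier H" and c: "c \<in> carrier H"
  shows "(a \<otimes>\<^bsub>H\<^esub> b) \<otimes>\<^bsub>H\<^esub> c = a \<otimes>\<^bsub>H\<^esub> (b \<otimes>\<^bsub>H\<^esub> c)"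
  using a
proof (induct rule: induct_mon)
  case zero
  show ?case using b c by (simp add: H_l_zero H_m_closed)
next
  case (add a a')
  thus ?case using b c by (simp add: H_l_distr H_m_closed)
next
  case m1: (mon r g)
  show ?case using b
  proof (induct rule: induct_mon)
    case zero
    show ?case using m1 c by (simp add: H_l_zero H_r_zero)
  next
    case (add b b')
    thus ?case using m1 c by (simp add: H_l_distr H_r_distr H_m_closed)
  next
    case m2: (mon s h)
    show ?case using c
    proof (induct rule: induct_mon)
      case zero
      show ?case using m1 m2 by (simp add: H_r_zero H_m_closed)
    next
      case (add c c')
      thus ?case using m1 m2 by (simp add: H_r_distr H_m_closed)
    next
      case (mon t l)
      thus ?case using m1 m2 by (simp add: mon_mult act_mult R.m_assoc G.m_assoc)
    qed
  qed
qed

lemma H_l_one: "a \<in> carrier H \<Longrightarrow> \<one>\<^bsub>H\<^esub> \<otimes>\<^bsub>H\<^esub> a = a"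
  by (induct rule: induct_mon)
    (simp_all add: H_one H_r_zero mon_mult H_r_distr act_one)

lemma H_r_one: "a \<in> carrier H \<Longrightarrow> a \<otimes>\<^bsub>H\<^esub> \<one>\<^bsub>H\<^esub> = a"
  by (induct rule: induct_mon)
    (simp_all add: H_one H_l_zero mon_mult H_l_distr)

lemma ring_H: "ring H"
proof -
  interpret abelian_group H by (rule abelian_group_H)
  have "\<one>\<^bsub>H\<^esub> \<in> carrier H" by (simp add: H_one)
  thus ?thesis
    by unfold_locales (simp_all add: H_m_closed H_assoc H_l_one H_r_one H_l_distr H_r_distr)
qed

lemma mon_add: "r \<in> carrier R \<Longrightarrow> s \<in> carrier R \<Longrightarrow> mon (r \<oplus> s) g = mon r g \<oplus>\<^bsub>H\<^esub> mon s g"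
  by (auto simp: mon_def H_add)

lemma embedding_hom: "(\<lambda>r. mon r \<one>\<^bsub>G\<^esub>) \<in> ring_hom R H"
  by (rule ring_hom_memI) (simp_all add: mon_add mon_mult act_one H_one)

lemma mon_split: "r \<in> carrier R \<Longrightarrow> g \<in> carrier G \<Longrightarrow> mon r g = mon r \<one>\<^bsub>G\<^esub> \<otimes>\<^bsub>H\<^esub> mon \<one> g"
  by (simp add: mon_mult act_one)

end

text \<open>Applied to \<open>K \<rightarrow> R\<close> this is the inclusion of \<open>K[G]\<close> in \<open>R#G\<close>; applied to the constant term
  \<open>K[x,y] \<rightarrow> K\<close> it is the projection of \<open>K[x,y]#G\<close> onto \<open>K[G]\<close>.\<close>

lemma skew_ring_hom:
  assumes R: "skew_ring R G act" and S: "skew_ring S G act'" and \<phi>: "\<phi> \<in> ring_hom R S"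
    and eq: "\<And>g r. g \<in> carrier G \<Longrightarrow> r \<in> carrier R \<Longrightarrow> \<phi> (act g r) = act' g (\<phi> r)"
  shows "(\<lambda>a g. \<phi> (a g)) \<in> ring_hom (skew_group_ring R G act) (skew_group_ring S G act')"
proof -
  interpret R: skew_ring R G act by fact
  interpret S: skew_ring S G act' by fact
  interpret \<phi>: ring_hom_ring R S \<phi> using \<phi> by unfold_locales
  have supp: "S.supp (\<lambda>g. \<phi> (a g)) \<subseteq> R.supp a" for a
    by (auto simp: R.supp_def S.supp_def)
  have cl: "(\<lambda>g. \<phi> (a g)) \<in> carrier S.H" if a: "a \<in> carrier R.H" for a
    using finite_subset[OF supp R.finite_supp[OF a]] R.coeff_outside[OF a] R.coeff_closed[OF a]
    by (auto simp: S.carrier_iff)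
  show ?thesis
  proof (rule ring_hom_memI)
    fix a b assume ab: "a \<in> carrier R.H" "b \<in> carrier R.H"
    note coeff = R.coeff_closed[OF ab(1)] R.coeff_closed[OF ab(2)]
    show "(\<lambda>g. \<phi> ((a \<oplus>\<^bsub>R.H\<^esub> b) g)) = (\<lambda>g. \<phi> (a g)) \<oplus>\<^bsub>S.H\<^esub> (\<lambda>g. \<phi> (b g))"
      using coeff by (simp add: R.H_add S.H_add)
    show "(\<lambda>g. \<phi> ((a \<otimes>\<^bsub>R.H\<^esub> b) g)) = (\<lambda>g. \<phi> (a g)) \<otimes>\<^bsub>S.H\<^esub> (\<lambda>g. \<phi> (b g))"
    proof
      fix k
      show "\<phi> ((a \<otimes>\<^bsub>R.H\<^esub> b) k) = ((\<lambda>g. \<phi> (a g)) \<otimes>\<^bsub>S.H\<^esub> (\<lambda>g. \<phi> (b g))) k"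
      proof (cases "k \<in> carrier G")
        case True
        have "\<phi> ((a \<otimes>\<^bsub>R.H\<^esub> b) k)
            = \<phi> (\<Oplus>\<^bsub>R\<^esub>g \<in> R.supp a. a g \<otimes>\<^bsub>R\<^esub> act g (b (inv\<^bsub>G\<^esub> g \<otimes>\<^bsub>G\<^esub> k)))"
          using R.H_mult[OF ab R.finite_supp[OF ab(1)] subset_refl R.supp_carrier True] by simp
        also have "\<dots> = (\<Oplus>\<^bsub>S\<^esub>g \<in> R.supp a. \<phi> (a g \<otimes>\<^bsub>R\<^esub> act g (b (inv\<^bsub>G\<^esub> g \<otimes>\<^bsub>G\<^esub> k))))"
          using ab coeff by (subst \<phi>.hom_finsum) (auto simp: R.supp_def o_def)
        also have "\<dots> = (\<Oplus>\<^bsub>S\<^esub>g \<in> R.supp a. \<phi> (a g) \<otimes>\<^bsub>S\<^esub> act' g (\<phi> (b (inv\<^bsub>G\<^esub> g \<otimes>\<^bsub>G\<^esub> k))))"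
          using coeff by (intro S.R.finsum_cong') (auto simp: R.supp_def eq)
        also have "\<dots> = ((\<lambda>g. \<phi> (a g)) \<otimes>\<^bsub>S.H\<^esub> (\<lambda>g. \<phi> (b g))) k"
          by (rule S.H_mult[OF cl[OF ab(1)] cl[OF ab(2)] R.finite_supp[OF ab(1)] supp R.supp_carrier True, symmetric])
        finally show ?thesis .
      qed (simp add: R.H_mult_outside S.H_mult_outside)
    qed
  qed (auto simp: cl R.H_one S.H_one R.mon_def S.mon_def)
qed

section \<open>Modules and restriction of scalars\<close>

lemma restrict_scalars_simps [simp]:
  "carrier (restrict_scalars f M) = carrier M"
  "\<zero>\<^bsub>restrict_scalars f M\<^esub> = \<zero>\<^bsub>M\<^esub>"
  "v \<oplus>\<^bsub>restrict_scalars f M\<^esub> w = v \<oplus>\<^bsub>M\<^esub> w"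
  "b \<odot>\<^bsub>restrict_scalars f M\<^esub> v = f b \<odot>\<^bsub>M\<^esub> v"
  by (simp_all add: restrict_scalars_def)

lemma restrict_scalars_compose:
  "restrict_scalars f (restrict_scalars g M) = restrict_scalars (g \<circ> f) M"
  by (simp add: restrict_scalars_def fun_eq_iff)

lemma restrict_scalars_left_module:
  assumes A: "ring A" and f: "f \<in> ring_hom A B" and M: "left_module B M"
  shows "left_module A (restrict_scalars f M)"
proof -
  interpret M: left_module B M by fact
  interpret A: ring A by fact
  interpret N: abelian_group "restrict_scalars f M"
  proof (rule abelian_groupI)
    fix v assume "v \<in> carrier (restrict_scalars f M)"
    thus "\<exists>w \<in> carrier (restrict_scalars f M). w \<oplus>\<^bsub>restrict_scalars f M\<^esub> v = \<zero>\<^bsub>restrict_scalars f M\<^esub>"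
      by (intro bexI[of _ "\<ominus>\<^bsub>M\<^esub> v"]) (simp_all add: M.M.l_neg)
  qed (simp_all add: M.M.a_ac)
  show ?thesis
    by unfold_locales
      (simp_all add: ring_hom_closed[OF f] ring_hom_add[OF f] ring_hom_mult[OF f] ring_hom_one[OF f]
        M.smult_closed M.smult_l_distr M.smult_r_distr M.smult_assoc M.smult_one)
qed

context left_module
begin

lemma smult_r_zero: "a \<in> carrier A \<Longrightarrow> a \<odot>\<^bsub>M\<^esub> \<zero>\<^bsub>M\<^esub> = \<zero>\<^bsub>M\<^esub>"
  using smult_r_distr[of a "\<zero>\<^bsub>M\<^esub>" "\<zero>\<^bsub>M\<^esub>"] smult_closed[of a "\<zero>\<^bsub>M\<^esub>"]
  by (metis M.add.r_cancel_one M.l_zero M.zero_closed)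

lemma smult_l_zero: "v \<in> carrier M \<Longrightarrow> \<zero>\<^bsub>A\<^esub> \<odot>\<^bsub>M\<^esub> v = \<zero>\<^bsub>M\<^esub>"
  using smult_l_distr[of "\<zero>\<^bsub>A\<^esub>" "\<zero>\<^bsub>A\<^esub>" v] smult_closed[of "\<zero>\<^bsub>A\<^esub>" v]
  by (metis M.add.r_cancel_one A.l_zero A.zero_closed)

lemma smult_l_minus:
  "a \<in> carrier A \<Longrightarrow> v \<in> carrier M \<Longrightarrow> (\<ominus>\<^bsub>A\<^esub> a) \<odot>\<^bsub>M\<^esub> v = \<ominus>\<^bsub>M\<^esub> (a \<odot>\<^bsub>M\<^esub> v)"
  using smult_l_distr[of "\<ominus>\<^bsub>A\<^esub> a" a v] smult_closed[of a v] smult_closed[of "\<ominus>\<^bsub>A\<^esub> a" v]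
  by (simp add: A.l_neg smult_l_zero M.minus_equality)

lemma submodule_iff: "Module.submodule N A M \<longleftrightarrow>
  N \<subseteq> carrier M \<and> \<zero>\<^bsub>M\<^esub> \<in> N \<and> (\<forall>v \<in> N. \<forall>w \<in> N. v \<oplus>\<^bsub>M\<^esub> w \<in> N) \<and>
  (\<forall>a \<in> carrier A. \<forall>v \<in> N. a \<odot>\<^bsub>M\<^esub> v \<in> N)" (is "?l \<longleftrightarrow> ?r")
proof
  assume ?l
  then interpret N: Module.submodule N A M .
  show ?r using N.subset N.one_closed N.m_closed N.smult_closed by auto
next
  assume r: ?r
  have "\<ominus>\<^bsub>M\<^esub> v \<in> N" if "v \<in> N" for v
  proof -
    have "v \<in> carrier M" using r that by auto
    hence "\<ominus>\<^bsub>M\<^esub> v = (\<ominus>\<^bsub>A\<^esub> \<one>\<^bsub>A\<^esub>) \<odot>\<^bsub>M\<^esub> v" by (simp add: smult_l_minus smult_one)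
    thus ?thesis using r that by auto
  qed
  hence "subgroup N (add_monoid M)"
    using r by (intro M.add.subgroupI) (auto simp: a_inv_def)
  thus ?l using r by (intro Module.submodule.intro) (auto simp: submodule_axioms_def)
qed

end

text \<open>If each element of \<open>B\<close> acts like some element of \<open>A\<close>, both rings have the same submodules.\<close>

lemma restrict_scalars_simple:
  assumes A: "ring A" and f: "f \<in> ring_hom A B" and M: "simple_left_module B M"
    and onto: "\<And>b. b \<in> carrier B \<Longrightarrow> \<exists>a \<in> carrier A. \<forall>v \<in> carrier M. f a \<odot>\<^bsub>M\<^esub> v = b \<odot>\<^bsub>M\<^esub> v"
  shows "simple_left_module A (restrict_scalars f M)"
proof -
  have BM: "left_module B M" using M by (simp add: simple_left_module_def)
  interpret M: left_module B M by (rule BM)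
  interpret N: left_module A "restrict_scalars f M" by (rule restrict_scalars_left_module[OF A f BM])
  have "Module.submodule W B M" if W: "Module.submodule W A (restrict_scalars f M)" for W
    unfolding M.submodule_iff
  proof (intro conjI ballI)
    note W' = W[unfolded N.submodule_iff, simplified]
    show "W \<subseteq> carrier M" "\<zero>\<^bsub>M\<^esub> \<in> W" "\<And>v w. v \<in> W \<Longrightarrow> w \<in> W \<Longrightarrow> v \<oplus>\<^bsub>M\<^esub> w \<in> W"
      using W' by auto
    fix b v assume b: "b \<in> carrier B" and v: "v \<in> W"
    obtain a where "a \<in> carrier A" "f a \<odot>\<^bsub>M\<^esub> v = b \<odot>\<^bsub>M\<^esub> v" using onto[OF b] v W' by blast
    thus "b \<odot>\<^bsub>M\<^esub> v \<in> W" using W' v by metis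
  qed
  thus ?thesis using M N.left_module_axioms by (simp add: simple_left_module_def)
qed

lemma (in ring) regular_left_module: "left_module R (regular_algebra R)"
proof -
  interpret M: abelian_group "regular_algebra R"
  proof (rule abelian_groupI)
    fix v assume "v \<in> carrier (regular_algebra R)"
    thus "\<exists>w \<in> carrier (regular_algebra R). w \<oplus>\<^bsub>regular_algebra R\<^esub> v = \<zero>\<^bsub>regular_algebra R\<^esub>"
      by (intro bexI[of _ "\<ominus> v"]) (simp_all add: regular_algebra_def l_neg)
  qed (simp_all add: regular_algebra_def a_ac)
  show ?thesis
    by unfold_locales (auto simp: regular_algebra_def l_distr r_distr m_assoc)
qed

lemma (in field) regular_simple: "simple_left_module R (regular_algebra R)"
proof -
  interpret M: left_module R "regular_algebra R" by (rule regular_left_module)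
  have "N = {\<zero>} \<or> N = carrier R" if "Module.submodule N R (regular_algebra R)" for N
  proof -
    have N: "N \<subseteq> carrier R" "\<zero> \<in> N" "\<And>a v. a \<in> carrier R \<Longrightarrow> v \<in> N \<Longrightarrow> a \<otimes> v \<in> N"
      using that[unfolded M.submodule_iff] by (auto simp: regular_algebra_def)
    have "carrier R \<subseteq> N" if v: "v \<in> N" "v \<noteq> \<zero>" for v
    proof
      fix c assume c: "c \<in> carrier R"
      have "v \<in> Units R" using v N(1) field_Units by auto
      moreover from this have "(c \<otimes> inv v) \<otimes> v = c"
        using c by (simp add: m_assoc Units_closed Units_l_inv)
      ultimately show "c \<in> N" using N(3)[of "c \<otimes> inv v" v] v(1) c by simp
    qed
    thus ?thesis using N(1,2) by blast
  qed
  moreover have "carrier R \<noteq> {\<zero>}" using one_not_zero one_closed by blast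
  ultimately show ?thesis using M.left_module_axioms
    unfolding simple_left_module_def by (simp add: regular_algebra_def)
qed

lemma left_module_vectorspace:
  assumes "field K" "left_module K W" shows "vectorspace K W"
proof -
  interpret K: field K by fact
  interpret W: left_module K W by fact
  show ?thesis
    by unfold_locales (auto simp: W.smult_closed W.smult_l_distr W.smult_r_distr W.smult_assoc W.smult_one)
qed

lemma one_dimensional:
  assumes K: "field K" and W: "left_module K W" and v: "v \<in> carrier W" "v \<noteq> \<zero>\<^bsub>W\<^esub>"
    and gen: "\<And>w. w \<in> carrier W \<Longrightarrow> \<exists>c \<in> carrier K. w = c \<odot>\<^bsub>W\<^esub> v"
  shows "finite_dimensional K W" "vectorspace.dim K W = 1"
proof -
  interpret W: vectorspace K W by (rule left_module_vectorspace[OF K W])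
  have "carrier W \<subseteq> W.span {v}"
  proof
    fix w assume "w \<in> carrier W"
    then obtain c where c: "c \<in> carrier K" "w = c \<odot>\<^bsub>W\<^esub> v" using gen by blast
    have "W.lincomb (\<lambda>_. c) {v} = w" using c v by (simp add: W.lincomb_def)
    thus "w \<in> W.span {v}" using c(1) unfolding W.span_def
      by (intro CollectI exI[of _ "\<lambda>_. c"] exI[of _ "{v}"]) auto
  qed
  moreover have "W.span {v} \<subseteq> carrier W" by (rule W.span_is_subset2) (use v in auto)
  ultimately have span: "W.gen_set {v}" by (rule equalityI[rotated])
  have fd: "W.fin_dim" unfolding W.fin_dim_def by (rule exI[of _ "{v}"]) (use span v in auto)
  show "finite_dimensional K W" using fd W.vectorspace_axioms by (simp add: finite_dimensional_def)
  show "W.dim = 1" by (rule W.dim1I[OF span v(2,1)])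
qed

section \<open>Simple modules over finitely generated commutative algebras\<close>

text \<open>For \<open>v \<noteq> 0\<close> the annihilator of \<open>v\<close> is a maximal ideal, and \<open>A v\<close> is everything. By the
  Nullstellensatz each \<open>a\<close> is congruent to a scalar \<open>\<mu> a\<close> modulo the annihilator. So \<open>a v = \<mu>(a) v\<close>, and
  since \<open>A\<close> is commutative this holds on all of \<open>A v\<close>.\<close>

lemma simple_module_character:
  assumes K: "algebraically_closed K" and A: "cring A" and h: "h \<in> ring_hom K A"
    and S: "finite S" "S \<subseteq> carrier A" and gen: "generate_ring A (h ` carrier K \<union> S) = carrier A"
    and M: "simple_left_module A M"
  obtains \<mu> v where "\<mu> \<in> ring_hom A K" "\<And>c. c \<in> carrier K \<Longrightarrow> \<mu> (h c) = c"
    "\<And>a w. a \<in> carrier A \<Longrightarrow> w \<in> carrier M \<Longrightarrow> a \<odot>\<^bsub>M\<^esub> w = h (\<mu> a) \<odot>\<^bsub>M\<^esub> w"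
    "v \<in> carrier M" "v \<noteq> \<zero>\<^bsub>M\<^esub>" "\<And>w. w \<in> carrier M \<Longrightarrow> \<exists>!c. c \<in> carrier K \<and> w = h c \<odot>\<^bsub>M\<^esub> v"
proof -
  interpret K: algebraically_closed K by fact
  interpret A: cring A by fact
  interpret M: left_module A M using M by (simp add: simple_left_module_def)
  interpret h: ring_hom_ring K A h using h by unfold_locales
  obtain v where v: "v \<in> carrier M" "v \<noteq> \<zero>\<^bsub>M\<^esub>"
    using M M.M.zero_closed unfolding simple_left_module_def by blast
  have dich: "N = {\<zero>\<^bsub>M\<^esub>} \<or> N = carrier M" if "Module.submodule N A M" for N
    using M that unfolding simple_left_module_def by blast
  define I where "I = {a \<in> carrier A. a \<odot>\<^bsub>M\<^esub> v = \<zero>\<^bsub>M\<^esub>}"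
  have I: "ideal I A"
  proof (rule idealI[OF A.ring_axioms])
    show "subgroup I (add_monoid A)"
      by (rule A.add.subgroupI)
        (auto simp: I_def M.smult_l_zero M.smult_l_distr M.smult_l_minus v a_inv_def[symmetric])
    show "x \<otimes>\<^bsub>A\<^esub> a \<in> I" if "a \<in> I" "x \<in> carrier A" for a x
      using that v by (simp add: I_def M.smult_assoc M.smult_r_zero)
    thus "a \<otimes>\<^bsub>A\<^esub> x \<in> I" if "a \<in> I" "x \<in> carrier A" for a x
      using that A.m_comm[of a x] by (simp add: I_def)
  qed
  have sub: "Module.submodule ((\<lambda>a. a \<odot>\<^bsub>M\<^esub> v) ` J) A M" if J: "ideal J A" for J
  proof -
    interpret J: ideal J A by fact
    have Jc: "J \<subseteq> carrier A" by (rule J.a_subset)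
    show ?thesis unfolding M.submodule_iff
    proof (intro conjI ballI)
      show "(\<lambda>a. a \<odot>\<^bsub>M\<^esub> v) ` J \<subseteq> carrier M" using Jc v M.smult_closed by auto
      show "\<zero>\<^bsub>M\<^esub> \<in> (\<lambda>a. a \<odot>\<^bsub>M\<^esub> v) ` J"
        by (rule image_eqI[of _ _ "\<zero>\<^bsub>A\<^esub>"]) (simp_all add: M.smult_l_zero[OF v(1)] J.zero_closed)
      fix x assume x: "x \<in> (\<lambda>a. a \<odot>\<^bsub>M\<^esub> v) ` J"
      then obtain a where a: "a \<in> J" "x = a \<odot>\<^bsub>M\<^esub> v" by blast
      show "x \<oplus>\<^bsub>M\<^esub> y \<in> (\<lambda>a. a \<odot>\<^bsub>M\<^esub> v) ` J" if y: "y \<in> (\<lambda>a. a \<odot>\<^bsub>M\<^esub> v) ` J" for y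
      proof -
        obtain b where b: "b \<in> J" "y = b \<odot>\<^bsub>M\<^esub> v" using y by blast
        have "x \<oplus>\<^bsub>M\<^esub> y = (a \<oplus>\<^bsub>A\<^esub> b) \<odot>\<^bsub>M\<^esub> v" using a b Jc v by (simp add: M.smult_l_distr subset_iff)
        thus ?thesis using J.a_closed[OF a(1) b(1)] by blast
      qed
      show "c \<odot>\<^bsub>M\<^esub> x \<in> (\<lambda>a. a \<odot>\<^bsub>M\<^esub> v) ` J" if c: "c \<in> carrier A" for c
      proof -
        have "c \<odot>\<^bsub>M\<^esub> x = (c \<otimes>\<^bsub>A\<^esub> a) \<odot>\<^bsub>M\<^esub> v" using a c Jc v by (simp add: M.smult_assoc subset_iff)
        thus ?thesis using J.I_l_closed[OF a(1) c] by blast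
      qed
    qed
  qed
  have one_v: "\<one>\<^bsub>A\<^esub> \<odot>\<^bsub>M\<^esub> v = v" by (rule M.smult_one[OF v(1)])
  have oneI: "\<one>\<^bsub>A\<^esub> \<notin> I" using one_v v by (auto simp: I_def)
  have max: "maximalideal I A"
  proof (rule maximalidealI[OF I])
    show "carrier A \<noteq> I" using oneI by auto
    fix J assume J: "ideal J A" and IJ: "I \<subseteq> J" "J \<subseteq> carrier A"
    interpret J: ideal J A by fact
    show "J = I \<or> J = carrier A"
      using dich[OF sub[OF J]]
    proof
      assume "(\<lambda>a. a \<odot>\<^bsub>M\<^esub> v) ` J = {\<zero>\<^bsub>M\<^esub>}"
      hence "J \<subseteq> I" using IJ by (auto simp: I_def)
      thus ?thesis using IJ by blast
    next
      assume "(\<lambda>a. a \<odot>\<^bsub>M\<^esub> v) ` J = carrier M"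
      then obtain j where j: "j \<in> J" "v = j \<odot>\<^bsub>M\<^esub> v" using v by blast
      have jc: "j \<in> carrier A" using j IJ by auto
      have "\<one>\<^bsub>A\<^esub> \<oplus>\<^bsub>A\<^esub> \<ominus>\<^bsub>A\<^esub> j \<in> I"
        using jc v j(2) one_v by (simp add: I_def M.smult_l_distr M.smult_l_minus M.M.r_neg)
      hence "(\<one>\<^bsub>A\<^esub> \<oplus>\<^bsub>A\<^esub> \<ominus>\<^bsub>A\<^esub> j) \<oplus>\<^bsub>A\<^esub> j \<in> J" using IJ j(1) J.a_closed by blast
      hence "\<one>\<^bsub>A\<^esub> \<in> J" using jc by (simp add: A.a_assoc A.l_neg)
      thus ?thesis using J.one_imp_carrier by blast
    qed
  qed
  have cyc: "\<exists>a \<in> carrier A. w = a \<odot>\<^bsub>M\<^esub> v" if "w \<in> carrier M" for w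
  proof -
    have "v \<in> (\<lambda>a. a \<odot>\<^bsub>M\<^esub> v) ` carrier A"
      by (rule image_eqI[of _ _ "\<one>\<^bsub>A\<^esub>"]) (simp_all add: one_v)
    thus ?thesis using dich[OF sub[OF A.oneideal]] v that by blast
  qed
  have scal: "\<exists>c \<in> carrier K. a \<odot>\<^bsub>M\<^esub> v = h c \<odot>\<^bsub>M\<^esub> v" if a: "a \<in> carrier A" for a
  proof -
    obtain c where c: "c \<in> carrier K" "a \<ominus>\<^bsub>A\<^esub> h c \<in> I"
      by (rule nullstellensatz_maximal_ideal[OF K A h S gen max a])
    have hc: "h c \<in> carrier A" using c by simp
    have "a = (a \<ominus>\<^bsub>A\<^esub> h c) \<oplus>\<^bsub>A\<^esub> h c" using a hc by (simp add: A.minus_eq A.a_assoc A.l_neg)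
    hence "a \<odot>\<^bsub>M\<^esub> v = (a \<ominus>\<^bsub>A\<^esub> h c) \<odot>\<^bsub>M\<^esub> v \<oplus>\<^bsub>M\<^esub> h c \<odot>\<^bsub>M\<^esub> v"
      using a hc v M.smult_l_distr[of "a \<ominus>\<^bsub>A\<^esub> h c" "h c" v] by simp
    also have "\<dots> = h c \<odot>\<^bsub>M\<^esub> v" using c(2) hc v by (simp add: I_def M.smult_closed)
    finally show ?thesis using c(1) by blast
  qed
  have inj: "c = d" if "c \<in> carrier K" "d \<in> carrier K" "h c \<odot>\<^bsub>M\<^esub> v = h d \<odot>\<^bsub>M\<^esub> v" for c d
  proof (rule ccontr)
    assume "c \<noteq> d"
    let ?e = "c \<ominus>\<^bsub>K\<^esub> d"
    have e: "?e \<in> Units K" using that \<open>c \<noteq> d\<close> K.field_Units by simp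
    have ec: "?e \<in> carrier K" using that by simp
    have "h ?e = h c \<oplus>\<^bsub>A\<^esub> \<ominus>\<^bsub>A\<^esub> h d" using that by (simp add: K.minus_eq)
    hence "h ?e \<odot>\<^bsub>M\<^esub> v = \<zero>\<^bsub>M\<^esub>"
      using that v by (simp add: M.smult_l_distr M.smult_l_minus M.smult_closed M.M.r_neg)
    moreover have "h (inv\<^bsub>K\<^esub> ?e) \<otimes>\<^bsub>A\<^esub> h ?e = \<one>\<^bsub>A\<^esub>"
      using e ec h.hom_mult[of "inv\<^bsub>K\<^esub> ?e" ?e] K.Units_inv_closed K.Units_l_inv by simp
    ultimately have "v = h (inv\<^bsub>K\<^esub> ?e) \<odot>\<^bsub>M\<^esub> \<zero>\<^bsub>M\<^esub>"
      using M.smult_assoc[of "h (inv\<^bsub>K\<^esub> ?e)" "h ?e" v] one_v e ec v by simp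
    thus False using M.smult_r_zero[of "h (inv\<^bsub>K\<^esub> ?e)"] e v(2) by simp
  qed
  define \<mu> where "\<mu> a = (THE c. c \<in> carrier K \<and> a \<odot>\<^bsub>M\<^esub> v = h c \<odot>\<^bsub>M\<^esub> v)" for a
  have \<mu>: "\<mu> a \<in> carrier K" "a \<odot>\<^bsub>M\<^esub> v = h (\<mu> a) \<odot>\<^bsub>M\<^esub> v" if "a \<in> carrier A" for a
  proof -
    have "\<exists>!c. c \<in> carrier K \<and> a \<odot>\<^bsub>M\<^esub> v = h c \<odot>\<^bsub>M\<^esub> v" using scal[OF that] inj by metis
    from theI'[OF this] show "\<mu> a \<in> carrier K" "a \<odot>\<^bsub>M\<^esub> v = h (\<mu> a) \<odot>\<^bsub>M\<^esub> v"
      unfolding \<mu>_def by blast+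
  qed
  have \<mu>_eq: "\<mu> a = c" if "a \<in> carrier A" "c \<in> carrier K" "a \<odot>\<^bsub>M\<^esub> v = h c \<odot>\<^bsub>M\<^esub> v" for a c
    using inj \<mu>[OF that(1)] that by metis
  have hom: "\<mu> \<in> ring_hom A K"
  proof (rule ring_hom_memI)
    fix a b assume ab: "a \<in> carrier A" "b \<in> carrier A"
    note ma = \<mu>[OF ab(1)] and mb = \<mu>[OF ab(2)]
    have hma: "h (\<mu> a) \<in> carrier A" "h (\<mu> b) \<in> carrier A" using ma mb by simp_all
    show "\<mu> (a \<oplus>\<^bsub>A\<^esub> b) = \<mu> a \<oplus>\<^bsub>K\<^esub> \<mu> b"
      using ab ma mb hma v by (intro \<mu>_eq) (simp_all add: M.smult_l_distr)
    have "(a \<otimes>\<^bsub>A\<^esub> b) \<odot>\<^bsub>M\<^esub> v = a \<odot>\<^bsub>M\<^esub> (h (\<mu> b) \<odot>\<^bsub>M\<^esub> v)" using ab v mb by (simp add: M.smult_assoc)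
    also have "\<dots> = h (\<mu> b) \<odot>\<^bsub>M\<^esub> (a \<odot>\<^bsub>M\<^esub> v)"
      using ab v hma A.m_comm[of a "h (\<mu> b)"] by (simp add: M.smult_assoc[symmetric])
    also have "\<dots> = (h (\<mu> b) \<otimes>\<^bsub>A\<^esub> h (\<mu> a)) \<odot>\<^bsub>M\<^esub> v" using ma hma v by (simp add: M.smult_assoc)
    also have "h (\<mu> b) \<otimes>\<^bsub>A\<^esub> h (\<mu> a) = h (\<mu> a \<otimes>\<^bsub>K\<^esub> \<mu> b)" using ma mb hma A.m_comm by simp
    finally show "\<mu> (a \<otimes>\<^bsub>A\<^esub> b) = \<mu> a \<otimes>\<^bsub>K\<^esub> \<mu> b" using ab ma mb by (intro \<mu>_eq) simp_all
  next
    show "\<mu> \<one>\<^bsub>A\<^esub> = \<one>\<^bsub>K\<^esub>" by (rule \<mu>_eq) (simp_all only: A.one_closed K.one_closed h.hom_one)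
  qed (rule \<mu>(1))
  have mh: "\<mu> (h c) = c" if "c \<in> carrier K" for c using that by (intro \<mu>_eq) simp_all
  have gen_v: "\<exists>c \<in> carrier K. w = h c \<odot>\<^bsub>M\<^esub> v" if "w \<in> carrier M" for w
    using cyc[OF that] \<mu> by metis
  have act: "a \<odot>\<^bsub>M\<^esub> w = h (\<mu> a) \<odot>\<^bsub>M\<^esub> w" if a: "a \<in> carrier A" and w: "w \<in> carrier M" for a w
  proof -
    obtain c where c: "c \<in> carrier K" "w = h c \<odot>\<^bsub>M\<^esub> v" using gen_v[OF w] by blast
    have comm: "b \<odot>\<^bsub>M\<^esub> w = h c \<odot>\<^bsub>M\<^esub> (b \<odot>\<^bsub>M\<^esub> v)" if "b \<in> carrier A" for b
      unfolding c(2) using that c(1) v A.m_comm[of b "h c"] by (simp add: M.smult_assoc[symmetric])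
    show ?thesis using comm[OF a] comm[of "h (\<mu> a)"] \<mu>[OF a] by simp
  qed
  have "\<exists>!c. c \<in> carrier K \<and> w = h c \<odot>\<^bsub>M\<^esub> v" if "w \<in> carrier M" for w
    using gen_v[OF that] inj by metis
  from that[OF hom mh act v this] show thesis .
qed

section \<open>Group algebras of abelian groups\<close>

lemma regular_algebra_simps [simp]:
  "carrier (regular_algebra K) = carrier K" "\<zero>\<^bsub>regular_algebra K\<^esub> = \<zero>\<^bsub>K\<^esub>"
  "\<one>\<^bsub>regular_algebra K\<^esub> = \<one>\<^bsub>K\<^esub>" "a \<oplus>\<^bsub>regular_algebra K\<^esub> b = a \<oplus>\<^bsub>K\<^esub> b"
  "a \<otimes>\<^bsub>regular_algebra K\<^esub> b = a \<otimes>\<^bsub>K\<^esub> b" "a \<odot>\<^bsub>regular_algebra K\<^esub> b = a \<otimes>\<^bsub>K\<^esub> b"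
  by (simp_all add: regular_algebra_def)

lemma ring_hom_regular: "ring_hom (regular_algebra K) B = ring_hom K B"
  "ring_hom B (regular_algebra K) = ring_hom B K"
  by (simp_all add: ring_hom_def)

lemma (in ring) regular_ring: "ring (regular_algebra R)"
proof -
  interpret M: left_module R "regular_algebra R" by (rule regular_left_module)
  show ?thesis by unfold_locales (simp_all add: m_assoc l_distr r_distr)
qed

lemma group_algebra_skew_ring:
  assumes "ring K" "group G" shows "skew_ring (regular_algebra K) G (\<lambda>g c. c)"
proof -
  interpret K: ring K by fact
  interpret KK: ring "regular_algebra K" by (rule K.regular_ring)
  interpret G: group G by fact
  show ?thesis by unfold_locales (simp_all add: ring_hom_def)
qed

lemma algebra_action_skew_ring:
  assumes "algebra K R" "algebra_action K G R act" shows "skew_ring R G act"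
proof -
  interpret A: algebra K R by fact
  interpret act: group_action G "carrier R" act using assms(2) by (simp add: algebra_action_def)
  interpret G: group G using act.group_hom by (simp add: group_hom_def)
  show ?thesis
  proof unfold_locales
    show "act g \<in> ring_hom R R" if "g \<in> carrier G" for g
      using assms(2) that by (simp add: algebra_action_def)
    show "act \<one>\<^bsub>G\<^esub> r = r" if "r \<in> carrier R" for r
      using act.id_eq_one that by (metis restrict_apply')
    show "act (g \<otimes>\<^bsub>G\<^esub> h) r = act g (act h r)" if "g \<in> carrier G" "h \<in> carrier G" "r \<in> carrier R" for g h r
      using act.composition_rule that by blast
  qed
qed

locale commutative_group_algebra = K?: cring K + G?: comm_group G
  for K :: "('k, 'b) ring_scheme" (structure) and G :: "('g, 'c) monoid_scheme" (structure)
begin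

sublocale KG: skew_ring "regular_algebra K" G "\<lambda>g c. c"
  by (rule group_algebra_skew_ring[OF K.ring_axioms G.is_group])

abbreviation "A \<equiv> group_algebra K G"

lemma group_algebra_eq: "A = KG.H" by (simp add: group_algebra_def)

lemma cring_A: "cring A"
proof -
  interpret ring A unfolding group_algebra_eq by (rule KG.ring_H)
  have "a \<otimes>\<^bsub>A\<^esub> b = b \<otimes>\<^bsub>A\<^esub> a" if a: "a \<in> carrier A" and b: "b \<in> carrier A" for a b
    using a unfolding group_algebra_eq
  proof (induct rule: KG.induct_mon)
    case zero
    show ?case using b by (simp add: group_algebra_eq KG.H_l_zero KG.H_r_zero)
  next
    case (add a a')
    thus ?case using b by (simp add: group_algebra_eq KG.H_l_distr KG.H_r_distr)
  next
    case m: (mon r g)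
    show ?case using b unfolding group_algebra_eq
      by (induct rule: KG.induct_mon)
        (use m in \<open>simp_all add: KG.H_l_zero KG.H_r_zero KG.H_l_distr KG.H_r_distr KG.mon_mult K.m_comm G.m_comm\<close>)
  qed
  thus ?thesis by unfold_locales
qed

abbreviation scalar :: "'k \<Rightarrow> 'g \<Rightarrow> 'k" where "scalar c \<equiv> KG.mon c \<one>\<^bsub>G\<^esub>"

lemma scalar_hom: "scalar \<in> ring_hom K A"
  using KG.embedding_hom by (simp add: group_algebra_eq ring_hom_regular)

text \<open>Generating a group uses inverses, which generating a ring does not provide; hence the inverses of
  the generators are added.\<close>

lemma group_algebra_finitely_generated:
  assumes S: "finite S" "S \<subseteq> carrier G" "generate G S = carrier G"
  defines "T \<equiv> KG.mon \<one>\<^bsub>K\<^esub> ` (S \<union> m_inv G ` S)"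
  shows "finite T" "T \<subseteq> carrier A" "generate_ring A (scalar ` carrier K \<union> T) = carrier A"
proof -
  show "finite T" using S by (simp add: T_def)
  show T: "T \<subseteq> carrier A" using S(2) by (auto simp: T_def group_algebra_eq)
  interpret A: cring A by (rule cring_A)
  let ?Z = "scalar ` carrier K \<union> T"
  have Z: "?Z \<subseteq> carrier A" using T by (auto simp: group_algebra_eq)
  have grp: "KG.mon \<one>\<^bsub>K\<^esub> g \<in> generate_ring A ?Z" if "g \<in> generate G S" for g
    using that
  proof induct
    case one
    show ?case by (intro generate_ring.incl) (auto simp: image_iff intro!: bexI[of _ "\<one>\<^bsub>K\<^esub>"])
  next
    case (incl g)
    thus ?case by (intro generate_ring.incl) (auto simp: T_def)
  next
    case (inv g)
    thus ?case by (intro generate_ring.incl) (auto simp: T_def)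
  next
    case (eng g h)
    hence "g \<in> carrier G" "h \<in> carrier G" using S(3) by auto
    hence "KG.mon \<one>\<^bsub>K\<^esub> (g \<otimes>\<^bsub>G\<^esub> h) = KG.mon \<one>\<^bsub>K\<^esub> g \<otimes>\<^bsub>A\<^esub> KG.mon \<one>\<^bsub>K\<^esub> h"
      by (simp add: group_algebra_eq KG.mon_mult)
    thus ?case using generate_ring.eng_mult[OF eng(2,4)] by simp
  qed
  have "a \<in> generate_ring A ?Z" if "a \<in> carrier KG.H" for a
    using that
  proof (induct rule: KG.induct_mon)
    case zero
    show ?case using A.zero_in_generate by (simp add: group_algebra_eq)
  next
    case (mon c g)
    have "scalar c \<in> generate_ring A ?Z" using mon by (intro generate_ring.incl) auto
    moreover have "KG.mon c g = scalar c \<otimes>\<^bsub>A\<^esub> KG.mon \<one>\<^bsub>K\<^esub> g"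
      using KG.mon_split[of c g] mon by (simp add: group_algebra_eq)
    ultimately show ?case using generate_ring.eng_mult grp[of g] mon(2) S(3) by metis
  next
    case (add a b)
    thus ?case using generate_ring.eng_add[of a A ?Z b] by (simp add: group_algebra_eq)
  qed
  thus "generate_ring A ?Z = carrier A" using A.generate_ring_incl[OF Z] by (auto simp: group_algebra_eq)
qed

text \<open>The linear extension of the character \<open>lam\<close> to \<open>K[G]\<close>.\<close>

definition char_sum :: "('g \<Rightarrow> 'k) \<Rightarrow> ('g \<Rightarrow> 'k) \<Rightarrow> 'k" where
  "char_sum lam a = (\<Oplus>\<^bsub>K\<^esub>g \<in> KG.supp a. a g \<otimes>\<^bsub>K\<^esub> lam g)"

lemma char_module_restrict:
  "char_module K G lam = restrict_scalars (char_sum lam) (regular_algebra K)"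
  unfolding char_sum_def KG.supp_def
  by (simp add: char_module_def restrict_scalars_def regular_algebra_def)

lemma char_closed:
  assumes "lam \<in> carrier (char_group G K)" "g \<in> carrier G"
  shows "lam g \<in> Units K" "lam g \<in> carrier K"
proof -
  have "lam g \<in> carrier (units_of K)" using assms by (auto simp: char_group_def hom_def)
  thus "lam g \<in> Units K" by (simp add: units_of_def)
  thus "lam g \<in> carrier K" by (rule K.Units_closed)
qed

lemma char_mult:
  assumes "lam \<in> carrier (char_group G K)" "g \<in> carrier G" "h \<in> carrier G"
  shows "lam (g \<otimes>\<^bsub>G\<^esub> h) = lam g \<otimes>\<^bsub>K\<^esub> lam h"
  using assms by (auto simp: char_group_def hom_def units_of_def)

lemma char_one:
  assumes l: "lam \<in> carrier (char_group G K)" shows "lam \<one>\<^bsub>G\<^esub> = \<one>\<^bsub>K\<^esub>"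
proof -
  note c = char_closed[OF l G.one_closed]
  have "lam \<one>\<^bsub>G\<^esub> \<otimes>\<^bsub>K\<^esub> lam \<one>\<^bsub>G\<^esub> = lam \<one>\<^bsub>G\<^esub> \<otimes>\<^bsub>K\<^esub> \<one>\<^bsub>K\<^esub>"
    using char_mult[OF l, of "\<one>\<^bsub>G\<^esub>" "\<one>\<^bsub>G\<^esub>"] c by simp
  thus ?thesis using K.Units_l_cancel[OF c(1) c(2) K.one_closed] by simp
qed

lemma char_sum_superset:
  assumes l: "lam \<in> carrier (char_group G K)" and a: "a \<in> carrier A"
    and S: "finite S" "KG.supp a \<subseteq> S" "S \<subseteq> carrier G"
  shows "char_sum lam a = (\<Oplus>\<^bsub>K\<^esub>g \<in> S. a g \<otimes>\<^bsub>K\<^esub> lam g)"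
  unfolding char_sum_def
  using S(1,2) subsetD[OF S(3)] KG.coeff_closed[OF a[unfolded group_algebra_eq]] char_closed(2)[OF l]
  by (intro K.add.finprod_mono_neutral_cong_left) (auto simp: KG.supp_def)

lemma char_sum_mon:
  assumes l: "lam \<in> carrier (char_group G K)" and c: "c \<in> carrier K" and g: "g \<in> carrier G"
  shows "char_sum lam (KG.mon c g) = c \<otimes>\<^bsub>K\<^esub> lam g"
proof -
  have "KG.mon c g \<in> carrier A" using c g by (simp add: group_algebra_eq)
  moreover have "KG.supp (KG.mon c g) \<subseteq> {g}" by (auto simp: KG.supp_def KG.mon_def)
  ultimately have "char_sum lam (KG.mon c g) = (\<Oplus>\<^bsub>K\<^esub>k \<in> {g}. KG.mon c g k \<otimes>\<^bsub>K\<^esub> lam k)"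
    using g by (intro char_sum_superset[OF l]) auto
  thus ?thesis using c g char_closed(2)[OF l g] by (simp add: KG.mon_def)
qed

lemma char_sum_add:
  assumes l: "lam \<in> carrier (char_group G K)" and a: "a \<in> carrier A" and b: "b \<in> carrier A"
  shows "char_sum lam (a \<oplus>\<^bsub>A\<^esub> b) = char_sum lam a \<oplus>\<^bsub>K\<^esub> char_sum lam b"
proof -
  let ?S = "KG.supp a \<union> KG.supp b"
  note ab = a[unfolded group_algebra_eq] b[unfolded group_algebra_eq]
  note cc = KG.coeff_closed[OF ab(1)] KG.coeff_closed[OF ab(2)]
  have S: "finite ?S" "KG.supp a \<subseteq> ?S" "KG.supp b \<subseteq> ?S" "?S \<subseteq> carrier G" "KG.supp (a \<oplus>\<^bsub>A\<^esub> b) \<subseteq> ?S"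
    using KG.finite_supp[OF ab(1)] KG.finite_supp[OF ab(2)] by (auto simp: KG.supp_def group_algebra_eq KG.H_add)
  have abc: "a \<oplus>\<^bsub>A\<^esub> b \<in> carrier A" using ab unfolding group_algebra_eq by (rule KG.add_H_closed)
  have "char_sum lam (a \<oplus>\<^bsub>A\<^esub> b) = (\<Oplus>\<^bsub>K\<^esub>g \<in> ?S. a g \<otimes>\<^bsub>K\<^esub> lam g \<oplus>\<^bsub>K\<^esub> b g \<otimes>\<^bsub>K\<^esub> lam g)"
    unfolding char_sum_superset[OF l abc S(1,5,4)]
    using cc char_closed(2)[OF l] subsetD[OF S(4)]
    by (intro K.finsum_cong') (auto simp: group_algebra_eq KG.H_add K.l_distr)
  also have "\<dots> = char_sum lam a \<oplus>\<^bsub>K\<^esub> char_sum lam b"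
    unfolding char_sum_superset[OF l a S(1,2,4)] char_sum_superset[OF l b S(1,3,4)]
    using cc char_closed(2)[OF l] subsetD[OF S(4)] by (intro K.finsum_addf) auto
  finally show ?thesis .
qed

lemma char_sum_closed:
  assumes l: "lam \<in> carrier (char_group G K)" and a: "a \<in> carrier A"
  shows "char_sum lam a \<in> carrier K"
  unfolding char_sum_def
  using KG.coeff_closed[OF a[unfolded group_algebra_eq]] char_closed(2)[OF l] subsetD[OF KG.supp_carrier]
  by (intro K.finsum_closed) auto

lemma char_sum_zero: "char_sum lam \<zero>\<^bsub>A\<^esub> = \<zero>\<^bsub>K\<^esub>"
  by (simp add: char_sum_def group_algebra_eq KG.H_zero KG.supp_def)

lemma char_sum_hom:
  assumes l: "lam \<in> carrier (char_group G K)" shows "char_sum lam \<in> ring_hom A K"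
proof (rule ring_hom_memI)
  interpret A: cring A by (rule cring_A)
  fix a b assume a: "a \<in> carrier A" and b: "b \<in> carrier A"
  show "char_sum lam a \<in> carrier K" by (rule char_sum_closed[OF l a])
  show "char_sum lam (a \<oplus>\<^bsub>A\<^esub> b) = char_sum lam a \<oplus>\<^bsub>K\<^esub> char_sum lam b" by (rule char_sum_add[OF l a b])
  show "char_sum lam (a \<otimes>\<^bsub>A\<^esub> b) = char_sum lam a \<otimes>\<^bsub>K\<^esub> char_sum lam b"
    using a[unfolded group_algebra_eq]
  proof (induct rule: KG.induct_mon)
    case zero
    show ?case unfolding group_algebra_eq[symmetric] using b
      by (simp only: A.l_null char_sum_zero K.l_null char_sum_closed[OF l])
  next
    case (add a a')
    note aa = add(1,2)[unfolded group_algebra_eq[symmetric]]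
    show ?case unfolding group_algebra_eq[symmetric]
      using add(3,4) aa b by (simp add: A.l_distr char_sum_add[OF l] char_sum_closed[OF l] K.l_distr)
  next
    case m: (mon c g)
    show ?case using b[unfolded group_algebra_eq]
    proof (induct rule: KG.induct_mon)
      case zero
      have "KG.mon c g \<in> carrier A" using m by (simp add: group_algebra_eq)
      thus ?case unfolding group_algebra_eq[symmetric]
        by (simp only: A.r_null char_sum_zero K.r_null char_sum_closed[OF l])
    next
      case (add b b')
      note bb = add(1,2)[unfolded group_algebra_eq[symmetric]]
      have "KG.mon c g \<in> carrier A" using m by (simp add: group_algebra_eq)
      thus ?case unfolding group_algebra_eq[symmetric]
        using add(3,4) bb by (simp add: A.r_distr char_sum_add[OF l] char_sum_closed[OF l] K.r_distr)
    next
      case (mon d h)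
      note lc = char_closed(2)[OF l]
      show ?case using m mon lc[of g] lc[of h]
        by (simp add: group_algebra_eq KG.mon_mult char_sum_mon[OF l] char_mult[OF l] K.m_ac)
    qed
  qed
next
  show "char_sum lam \<one>\<^bsub>A\<^esub> = \<one>\<^bsub>K\<^esub>"
    using char_sum_mon[OF l K.one_closed G.one_closed] by (simp add: group_algebra_eq KG.H_one char_one[OF l])
qed

text \<open>The homomorphism \<open>\<mu> : K[G] \<rightarrow> K\<close> through which \<open>K[G]\<close> acts on \<open>W\<close> is determined by its values on
  \<open>G\<close>, which form the character \<open>lam\<close>. The isomorphism sends \<open>c v\<close> to \<open>c\<close>.\<close>

lemma simple_module_one_dimensional:
  assumes K: "algebraically_closed K" and fg: "finitely_generated_group G"
    and W: "simple_left_module A W"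
  obtains lam v where "lam \<in> carrier (char_group G K)" "module_iso A W (char_module K G lam)"
    "v \<in> carrier W" "v \<noteq> \<zero>\<^bsub>W\<^esub>" "\<And>w. w \<in> carrier W \<Longrightarrow> \<exists>c \<in> carrier K. w = scalar c \<odot>\<^bsub>W\<^esub> v"
proof -
  interpret A: cring A by (rule cring_A)
  interpret W: left_module A W using W by (simp add: simple_left_module_def)
  interpret s: ring_hom_ring K A scalar using scalar_hom by unfold_locales
  obtain S where S: "finite S" "S \<subseteq> carrier G" "generate G S = carrier G"
    using fg unfolding finitely_generated_group_def by blast
  obtain \<mu> v where \<mu>: "\<mu> \<in> ring_hom A K" "\<And>c. c \<in> carrier K \<Longrightarrow> \<mu> (scalar c) = c"
    "\<And>a w. a \<in> carrier A \<Longrightarrow> w \<in> carrier W \<Longrightarrow> a \<odot>\<^bsub>W\<^esub> w = scalar (\<mu> a) \<odot>\<^bsub>W\<^esub> w"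
    and v: "v \<in> carrier W" "v \<noteq> \<zero>\<^bsub>W\<^esub>"
    "\<And>w. w \<in> carrier W \<Longrightarrow> \<exists>!c. c \<in> carrier K \<and> w = scalar c \<odot>\<^bsub>W\<^esub> v"
    by (rule simple_module_character[OF K cring_A scalar_hom group_algebra_finitely_generated[OF S] W]) blast
  interpret \<mu>: ring_hom_ring A K \<mu> using \<mu>(1) by unfold_locales
  let ?m = "KG.mon \<one>\<^bsub>K\<^esub>"
  have mA: "?m g \<in> carrier A" if "g \<in> carrier G" for g using that by (simp add: group_algebra_eq)
  have mm: "?m (g \<otimes>\<^bsub>G\<^esub> h) = ?m g \<otimes>\<^bsub>A\<^esub> ?m h" if "g \<in> carrier G" "h \<in> carrier G" for g h
    using that by (simp add: group_algebra_eq KG.mon_mult)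
  have m1: "?m \<one>\<^bsub>G\<^esub> = \<one>\<^bsub>A\<^esub>" by (rule s.hom_one)
  define lam where "lam = (\<lambda>g \<in> carrier G. \<mu> (?m g))"
  have unit: "\<mu> (?m g) \<in> Units K" if g: "g \<in> carrier G" for g
  proof -
    let ?x = "\<mu> (?m g)" and ?y = "\<mu> (?m (inv\<^bsub>G\<^esub> g))"
    have x: "?x \<in> carrier K" and y: "?y \<in> carrier K" using g mA by simp_all
    have "?y \<otimes>\<^bsub>K\<^esub> ?x = \<mu> (?m (inv\<^bsub>G\<^esub> g \<otimes>\<^bsub>G\<^esub> g))"
      using mm[of "inv\<^bsub>G\<^esub> g" g] g mA \<mu>.hom_mult[of "?m (inv\<^bsub>G\<^esub> g)" "?m g"] by simp
    also have "\<dots> = \<one>\<^bsub>K\<^esub>" using g m1 \<mu>.hom_one by simp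
    finally have "?y \<otimes>\<^bsub>K\<^esub> ?x = \<one>\<^bsub>K\<^esub>" .
    moreover from this have "?x \<otimes>\<^bsub>K\<^esub> ?y = \<one>\<^bsub>K\<^esub>" using K.m_comm[OF y x] by simp
    ultimately show ?thesis using x y unfolding Units_def by blast
  qed
  have lam: "lam \<in> carrier (char_group G K)"
    using unit mA mm \<mu>.hom_mult by (auto simp: lam_def char_group_def hom_def units_of_def)
  have \<mu>_sum: "\<mu> a = char_sum lam a" if a: "a \<in> carrier A" for a
    using a[unfolded group_algebra_eq]
  proof (induct rule: KG.induct_mon)
    case zero
    show ?case unfolding group_algebra_eq[symmetric] by (simp only: char_sum_zero \<mu>.hom_zero)
  next
    case (add a b)
    thus ?case unfolding group_algebra_eq[symmetric] by (simp add: char_sum_add[OF lam])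
  next
    case (mon c g)
    have "KG.mon c g = scalar c \<otimes>\<^bsub>A\<^esub> ?m g" using mon KG.mon_split[of c g] by (simp only: group_algebra_eq regular_algebra_simps)
    moreover have "c \<in> carrier K" using mon by simp
    ultimately have "\<mu> (KG.mon c g) = c \<otimes>\<^bsub>K\<^esub> \<mu> (?m g)"
      using \<mu>.hom_mult[of "scalar c" "?m g"] mA[OF mon(2)] \<mu>(2) s.hom_closed[of c] by simp
    also have "\<mu> (?m g) = lam g" using mon(2) by (simp add: lam_def)
    also have "c \<otimes>\<^bsub>K\<^esub> lam g = char_sum lam (KG.mon c g)"
      by (rule char_sum_mon[OF lam \<open>c \<in> carrier K\<close> mon(2), symmetric])
    finally show ?case .
  qed
  define f where "f w = (THE c. c \<in> carrier K \<and> w = scalar c \<odot>\<^bsub>W\<^esub> v)" for w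
  have f: "f w \<in> carrier K" "w = scalar (f w) \<odot>\<^bsub>W\<^esub> v" if "w \<in> carrier W" for w
    using theI'[OF v(3)[OF that]] unfolding f_def by blast+
  have f_eq: "f w = c" if "w \<in> carrier W" "c \<in> carrier K" "w = scalar c \<odot>\<^bsub>W\<^esub> v" for w c
    using v(3)[OF that(1)] that f[OF that(1)] by blast
  have f_smult: "f (scalar c \<odot>\<^bsub>W\<^esub> v) = c" if "c \<in> carrier K" for c
    using that v by (intro f_eq) (simp_all add: W.smult_closed)
  have "f \<in> module_hom A W (char_module K G lam)"
    unfolding module_hom_def
  proof (intro CollectI conjI allI impI)
    show "f \<in> carrier W \<rightarrow> carrier (char_module K G lam)" using f by (simp add: char_module_def)
    fix w w' assume "w \<in> carrier W \<and> w' \<in> carrier W"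
    hence w: "w \<in> carrier W" "w' \<in> carrier W" by auto
    have "f (w \<oplus>\<^bsub>W\<^esub> w') = f w \<oplus>\<^bsub>K\<^esub> f w'"
    proof (rule f_eq)
      have "scalar (f w \<oplus>\<^bsub>K\<^esub> f w') \<odot>\<^bsub>W\<^esub> v = scalar (f w) \<odot>\<^bsub>W\<^esub> v \<oplus>\<^bsub>W\<^esub> scalar (f w') \<odot>\<^bsub>W\<^esub> v"
        using f(1)[OF w(1)] f(1)[OF w(2)] v(1) by (simp add: W.smult_l_distr)
      thus "w \<oplus>\<^bsub>W\<^esub> w' = scalar (f w \<oplus>\<^bsub>K\<^esub> f w') \<odot>\<^bsub>W\<^esub> v"
        using f(2)[OF w(1)] f(2)[OF w(2)] by simp
    qed (use w f in simp_all)
    thus "f (w \<oplus>\<^bsub>W\<^esub> w') = f w \<oplus>\<^bsub>char_module K G lam\<^esub> f w'" by (simp add: char_module_def)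
  next
    fix a w assume "a \<in> carrier A \<and> w \<in> carrier W"
    hence a: "a \<in> carrier A" and w: "w \<in> carrier W" by auto
    have "f (a \<odot>\<^bsub>W\<^esub> w) = char_sum lam a \<otimes>\<^bsub>K\<^esub> f w"
    proof (rule f_eq)
      have "a \<odot>\<^bsub>W\<^esub> w = scalar (char_sum lam a) \<odot>\<^bsub>W\<^esub> (scalar (f w) \<odot>\<^bsub>W\<^esub> v)"
        using \<mu>(3)[OF a w] \<mu>_sum[OF a] f(2)[OF w] by simp
      also have "\<dots> = scalar (char_sum lam a \<otimes>\<^bsub>K\<^esub> f w) \<odot>\<^bsub>W\<^esub> v"
        using char_sum_closed[OF lam a] f(1)[OF w] v(1) by (simp add: W.smult_assoc)
      finally show "a \<odot>\<^bsub>W\<^esub> w = scalar (char_sum lam a \<otimes>\<^bsub>K\<^esub> f w) \<odot>\<^bsub>W\<^esub> v" .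
    qed (use a w f char_sum_closed[OF lam a] W.smult_closed in simp_all)
    thus "f (a \<odot>\<^bsub>W\<^esub> w) = a \<odot>\<^bsub>char_module K G lam\<^esub> f w" by (simp add: char_module_restrict)
  qed
  moreover have "bij_betw f (carrier W) (carrier (char_module K G lam))"
  proof (rule bij_betwI[where g = "\<lambda>c. scalar c \<odot>\<^bsub>W\<^esub> v"])
    show "f \<in> carrier W \<rightarrow> carrier (char_module K G lam)" using f by (simp add: char_module_def)
    show "(\<lambda>c. scalar c \<odot>\<^bsub>W\<^esub> v) \<in> carrier (char_module K G lam) \<rightarrow> carrier W"
      using v by (auto simp: char_module_def W.smult_closed)
  qed (use f f_smult in \<open>simp_all add: char_module_def\<close>)
  ultimately have "module_iso A W (char_module K G lam)" unfolding module_iso_def by blast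
  thus thesis using that lam v by blast
qed

end

section \<open>Torsion modules over skew group rings\<close>

text \<open>If \<open>x r = s (g x)\<close> always has a solution \<open>s\<close>, then \<open>x a \<in> H x\<close> for all \<open>a \<in> H\<close>, so the vectors
  killed by \<open>x\<close> form a submodule. It is not \<open>0\<close>: if \<open>k\<close> is least with \<open>x\<^sup>k u = 0\<close>, where \<open>u \<noteq> 0\<close>, then
  \<open>x\<close> kills \<open>x\<^sup>k\<^sup>-\<^sup>1 u \<noteq> 0\<close>. By simplicity it is the whole module.\<close>

lemma (in skew_ring) torsion_simple_annihilated:
  assumes V: "simple_left_module H V" and x: "x \<in> carrier R" and tors: "torsion_at H (skew_const R G x) V"
    and normal: "\<And>r g. r \<in> carrier R \<Longrightarrow> g \<in> carrier G \<Longrightarrow> \<exists>s \<in> carrier R. x \<otimes> r = s \<otimes> act g x"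
    and v: "v \<in> carrier V"
  shows "skew_const R G x \<odot>\<^bsub>V\<^esub> v = \<zero>\<^bsub>V\<^esub>"
proof -
  interpret H: ring H by (rule ring_H)
  interpret V: left_module H V using V by (simp add: simple_left_module_def)
  let ?X = "mon x \<one>\<^bsub>G\<^esub>"
  have X: "?X \<in> carrier H" using x by simp
  have comm: "\<exists>b \<in> carrier H. ?X \<otimes>\<^bsub>H\<^esub> a = b \<otimes>\<^bsub>H\<^esub> ?X" if "a \<in> carrier H" for a
    using that
  proof (induct rule: induct_mon)
    case zero
    show ?case using X by (intro bexI[of _ "\<zero>\<^bsub>H\<^esub>"]) simp_all
  next
    case (add a b)
    then obtain a' b' where "a' \<in> carrier H" "?X \<otimes>\<^bsub>H\<^esub> a = a' \<otimes>\<^bsub>H\<^esub> ?X"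
      "b' \<in> carrier H" "?X \<otimes>\<^bsub>H\<^esub> b = b' \<otimes>\<^bsub>H\<^esub> ?X" by blast
    thus ?case using X add(1,2) by (intro bexI[of _ "a' \<oplus>\<^bsub>H\<^esub> b'"]) (simp_all add: H.r_distr H.l_distr)
  next
    case (mon r g)
    obtain s where s: "s \<in> carrier R" "x \<otimes> r = s \<otimes> act g x" using normal[OF mon] by blast
    have "?X \<otimes>\<^bsub>H\<^esub> mon r g = mon s g \<otimes>\<^bsub>H\<^esub> ?X"
      using mon x s by (simp add: mon_mult act_one)
    thus ?case using s mon by (intro bexI[of _ "mon s g"]) simp_all
  qed
  let ?W = "{w \<in> carrier V. ?X \<odot>\<^bsub>V\<^esub> w = \<zero>\<^bsub>V\<^esub>}"
  have "Module.submodule ?W H V"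
    unfolding V.submodule_iff
  proof (intro conjI ballI)
    fix a w assume a: "a \<in> carrier H" and w: "w \<in> ?W"
    obtain b where b: "b \<in> carrier H" "?X \<otimes>\<^bsub>H\<^esub> a = b \<otimes>\<^bsub>H\<^esub> ?X" using comm[OF a] by blast
    have "?X \<odot>\<^bsub>V\<^esub> (a \<odot>\<^bsub>V\<^esub> w) = (?X \<otimes>\<^bsub>H\<^esub> a) \<odot>\<^bsub>V\<^esub> w" using a w X by (simp add: V.smult_assoc)
    also have "\<dots> = b \<odot>\<^bsub>V\<^esub> (?X \<odot>\<^bsub>V\<^esub> w)" unfolding b(2) using b(1) w X by (simp add: V.smult_assoc)
    also have "\<dots> = \<zero>\<^bsub>V\<^esub>" using w b(1) by (simp add: V.smult_r_zero)
    finally show "a \<odot>\<^bsub>V\<^esub> w \<in> ?W" using a w by (simp add: V.smult_closed)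
  qed (use X in \<open>auto simp: V.smult_r_zero V.smult_r_distr\<close>)
  hence dich: "?W = {\<zero>\<^bsub>V\<^esub>} \<or> ?W = carrier V" using V unfolding simple_left_module_def by blast
  have "?W \<noteq> {\<zero>\<^bsub>V\<^esub>}"
  proof -
    obtain u where u: "u \<in> carrier V" "u \<noteq> \<zero>\<^bsub>V\<^esub>"
      using V V.M.zero_closed unfolding simple_left_module_def by blast
    define k where "k = (LEAST k::nat. (?X [^]\<^bsub>H\<^esub> k) \<odot>\<^bsub>V\<^esub> u = \<zero>\<^bsub>V\<^esub>)"
    have "\<exists>k::nat. (?X [^]\<^bsub>H\<^esub> k) \<odot>\<^bsub>V\<^esub> u = \<zero>\<^bsub>V\<^esub>"
      using tors u unfolding torsion_at_def skew_const_mon by blast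
    hence k: "(?X [^]\<^bsub>H\<^esub> k) \<odot>\<^bsub>V\<^esub> u = \<zero>\<^bsub>V\<^esub>" unfolding k_def by (rule LeastI_ex)
    have "k \<noteq> 0"
    proof
      assume "k = 0"
      thus False using k u V.smult_one[OF u(1)] by simp
    qed
    then obtain j where j: "k = Suc j" by (cases k) auto
    let ?w = "(?X [^]\<^bsub>H\<^esub> j) \<odot>\<^bsub>V\<^esub> u"
    have "?w \<noteq> \<zero>\<^bsub>V\<^esub>"
    proof
      assume "?w = \<zero>\<^bsub>V\<^esub>"
      hence "k \<le> j" unfolding k_def by (rule Least_le)
      thus False using j by simp
    qed
    moreover have "?X \<odot>\<^bsub>V\<^esub> ?w = (?X [^]\<^bsub>H\<^esub> Suc j) \<odot>\<^bsub>V\<^esub> u"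
      unfolding H.nat_pow_Suc2[OF X] using X u by (simp add: V.smult_assoc)
    hence "?X \<odot>\<^bsub>V\<^esub> ?w = \<zero>\<^bsub>V\<^esub>" using k j by simp
    moreover have "?w \<in> carrier V" using X u by (simp add: V.smult_closed)
    ultimately show ?thesis by blast
  qed
  thus ?thesis using dich v by (auto simp: skew_const_mon)
qed

lemma (in algebra) scalar_embedding_hom: "(\<lambda>c. c \<odot>\<^bsub>M\<^esub> \<one>\<^bsub>M\<^esub>) \<in> ring_hom R M"
proof (rule ring_hom_memI)
  fix c d assume c: "c \<in> carrier R" and d: "d \<in> carrier R"
  have "(c \<odot>\<^bsub>M\<^esub> \<one>\<^bsub>M\<^esub>) \<otimes>\<^bsub>M\<^esub> (d \<odot>\<^bsub>M\<^esub> \<one>\<^bsub>M\<^esub>) = c \<odot>\<^bsub>M\<^esub> (\<one>\<^bsub>M\<^esub> \<otimes>\<^bsub>M\<^esub> (d \<odot>\<^bsub>M\<^esub> \<one>\<^bsub>M\<^esub>))"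
    using c d by (intro smult_assoc2) simp_all
  thus "(c \<otimes> d) \<odot>\<^bsub>M\<^esub> \<one>\<^bsub>M\<^esub> = (c \<odot>\<^bsub>M\<^esub> \<one>\<^bsub>M\<^esub>) \<otimes>\<^bsub>M\<^esub> (d \<odot>\<^bsub>M\<^esub> \<one>\<^bsub>M\<^esub>)"
    using c d by (simp add: smult_assoc1)
qed (simp_all add: smult_l_distr)

locale skew_algebra = alg?: algebra K R + G?: group G
  for K :: "('k, 'b) ring_scheme" (structure) and R :: "('k, 'r, 'd) module_scheme" (structure)
    and G :: "('g, 'c) monoid_scheme" (structure) +
  fixes act :: "'g \<Rightarrow> 'r \<Rightarrow> 'r"
  assumes action: "algebra_action K G R act"
begin

sublocale SR: skew_ring R G act
  by (rule algebra_action_skew_ring[OF alg.algebra_axioms action])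

sublocale KG: skew_ring "regular_algebra K" G "\<lambda>g c. c"
  using alg.algebra_axioms
  by (intro group_algebra_skew_ring G.is_group) (simp add: algebra_def module_def cring_def)

lemma group_algebra_eq: "group_algebra K G = KG.H" by (simp add: group_algebra_def)

abbreviation "of_scalar c \<equiv> c \<odot>\<^bsub>R\<^esub> \<one>\<^bsub>R\<^esub>"
abbreviation "lift \<equiv> \<lambda>a g. a g \<odot>\<^bsub>R\<^esub> \<one>\<^bsub>R\<^esub>"

lemma cring_R: "cring R" by (rule algebra.axioms(2)[OF alg.algebra_axioms])

lemma ring_R: "ring R" by (rule cring.axioms(1)[OF cring_R])

lemma ring_K: "ring K"
  using alg.algebra_axioms by (simp add: algebra_def module_def cring_def)

lemma of_scalar_hom: "of_scalar \<in> ring_hom K R" by (rule alg.scalar_embedding_hom)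

lemma of_scalar_zero: "of_scalar \<zero>\<^bsub>K\<^esub> = \<zero>\<^bsub>R\<^esub>"
  by (rule ring_hom_zero[OF of_scalar_hom ring_K ring_R])

lemma lift_hom: "lift \<in> ring_hom (group_algebra K G) SR.H"
  unfolding group_algebra_eq
proof (rule skew_ring_hom[OF KG.skew_ring_axioms SR.skew_ring_axioms])
  show "of_scalar \<in> ring_hom (regular_algebra K) R" using of_scalar_hom by (simp add: ring_hom_regular)
  show "of_scalar c = act g (of_scalar c)" if "g \<in> carrier G" "c \<in> carrier (regular_algebra K)" for g c
    using that action by (simp add: algebra_action_def)
qed

lemma lift_mon: "lift (KG.mon c g) = SR.mon (of_scalar c) g"
  by (auto simp: KG.mon_def SR.mon_def of_scalar_zero)

lemma underlying_space_smult:
  assumes "c \<in> carrier K"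
  shows "c \<odot>\<^bsub>SR.H\<^esub> \<one>\<^bsub>SR.H\<^esub> = SR.mon (of_scalar c) \<one>\<^bsub>G\<^esub>"
proof
  fix k
  have "(c \<odot>\<^bsub>SR.H\<^esub> \<one>\<^bsub>SR.H\<^esub>) k = c \<odot>\<^bsub>R\<^esub> SR.mon \<one>\<^bsub>R\<^esub> \<one>\<^bsub>G\<^esub> k"
    unfolding SR.H_one by (simp add: skew_group_ring_def)
  thus "(c \<odot>\<^bsub>SR.H\<^esub> \<one>\<^bsub>SR.H\<^esub>) k = SR.mon (of_scalar c) \<one>\<^bsub>G\<^esub> k"
    using assms by (simp add: SR.mon_def)
qed

lemma underlying_space_hom: "(\<lambda>c. c \<odot>\<^bsub>SR.H\<^esub> \<one>\<^bsub>SR.H\<^esub>) \<in> ring_hom K SR.H"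
proof -
  have "(\<lambda>r. SR.mon r \<one>\<^bsub>G\<^esub>) \<circ> of_scalar \<in> ring_hom K SR.H"
    by (rule ring_hom_trans[OF of_scalar_hom SR.embedding_hom])
  thus ?thesis
    by (simp add: ring_hom_def underlying_space_smult)
qed

lemma underlying_space_left_module:
  assumes "left_module SR.H V" shows "left_module K (underlying_space SR.H V)"
  unfolding underlying_space_def
  by (rule restrict_scalars_left_module[OF ring_K underlying_space_hom assms])

text \<open>The elements of \<open>R\<close> that act on \<open>V\<close> like a scalar form a subring containing the scalars and the
  generators, which act as \<open>0\<close>; so this is \<open>R\<close>. Hence each element of \<open>R#G\<close> acts like one of
  \<open>K[G]\<close>.\<close>

lemma as_group_module_simple:
  assumes V: "simple_left_module SR.H V"
    and gen: "generates_algebra K R Z"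
    and ann: "\<And>x v. x \<in> Z \<Longrightarrow> v \<in> carrier V \<Longrightarrow> skew_const R G x \<odot>\<^bsub>V\<^esub> v = \<zero>\<^bsub>V\<^esub>"
  shows "simple_left_module (group_algebra K G) (as_group_module R V)"
proof -
  interpret H: ring SR.H by (rule SR.ring_H)
  interpret V: left_module SR.H V using V by (simp add: simple_left_module_def)
  let ?e = "\<lambda>r. SR.mon r \<one>\<^bsub>G\<^esub>"
  interpret e: ring_hom_ring R SR.H ?e using SR.embedding_hom by unfold_locales
  have Rgen: "carrier R = generate_ring R (Z \<union> {of_scalar c | c. c \<in> carrier K})" "Z \<subseteq> carrier R"
    using gen by (auto simp: generates_algebra_def)
  have sub: "Z \<union> {of_scalar c | c. c \<in> carrier K} \<subseteq> carrier R" using Rgen(2) by auto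
  have scal: "\<exists>c \<in> carrier K. \<forall>v \<in> carrier V. ?e r \<odot>\<^bsub>V\<^esub> v = ?e (of_scalar c) \<odot>\<^bsub>V\<^esub> v"
    if "r \<in> generate_ring R (Z \<union> {of_scalar c | c. c \<in> carrier K})" for r
    using that
  proof induct
    case one
    show ?case by (intro bexI[of _ "\<one>\<^bsub>K\<^esub>"]) simp_all
  next
    case (incl r)
    thus ?case
    proof
      assume "r \<in> Z"
      hence "?e r \<odot>\<^bsub>V\<^esub> v = ?e (of_scalar \<zero>\<^bsub>K\<^esub>) \<odot>\<^bsub>V\<^esub> v" if "v \<in> carrier V" for v
        using ann[OF \<open>r \<in> Z\<close> that] that V.smult_l_zero[OF that] e.hom_zero
        by (simp only: SR.skew_const_mon of_scalar_zero)
      thus ?thesis by (intro bexI[of _ "\<zero>\<^bsub>K\<^esub>"]) simp_all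
    qed blast
  next
    case (a_inv r)
    then obtain c where c: "c \<in> carrier K" "\<And>v. v \<in> carrier V \<Longrightarrow> ?e r \<odot>\<^bsub>V\<^esub> v = ?e (of_scalar c) \<odot>\<^bsub>V\<^esub> v" by blast
    have r: "r \<in> carrier R" using a_inv(1) Rgen by simp
    have m: "of_scalar (\<ominus>\<^bsub>K\<^esub> c) = \<ominus>\<^bsub>R\<^esub> of_scalar c" using c(1) by (simp add: alg.smult_l_minus)
    have "?e (\<ominus>\<^bsub>R\<^esub> r) \<odot>\<^bsub>V\<^esub> v = ?e (of_scalar (\<ominus>\<^bsub>K\<^esub> c)) \<odot>\<^bsub>V\<^esub> v" if v: "v \<in> carrier V" for v
    proof -
      have "?e (\<ominus>\<^bsub>R\<^esub> r) \<odot>\<^bsub>V\<^esub> v = \<ominus>\<^bsub>V\<^esub> (?e r \<odot>\<^bsub>V\<^esub> v)"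
        using e.hom_a_inv[OF r] V.smult_l_minus[of "?e r" v] r v by simp
      moreover have "?e (\<ominus>\<^bsub>R\<^esub> of_scalar c) \<odot>\<^bsub>V\<^esub> v = \<ominus>\<^bsub>V\<^esub> (?e (of_scalar c) \<odot>\<^bsub>V\<^esub> v)"
        using e.hom_a_inv[of "of_scalar c"] V.smult_l_minus[of "?e (of_scalar c)" v] c(1) v by simp
      ultimately show ?thesis using c(2)[OF v] by (simp only: m)
    qed
    thus ?case using c(1) by blast
  next
    case (eng_add r s)
    then obtain c d where c: "c \<in> carrier K" "\<And>v. v \<in> carrier V \<Longrightarrow> ?e r \<odot>\<^bsub>V\<^esub> v = ?e (of_scalar c) \<odot>\<^bsub>V\<^esub> v"
      and d: "d \<in> carrier K" "\<And>v. v \<in> carrier V \<Longrightarrow> ?e s \<odot>\<^bsub>V\<^esub> v = ?e (of_scalar d) \<odot>\<^bsub>V\<^esub> v" by blast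
    have r: "r \<in> carrier R" "s \<in> carrier R" using eng_add(1,3) Rgen by simp_all
    have m: "of_scalar (c \<oplus>\<^bsub>K\<^esub> d) = of_scalar c \<oplus>\<^bsub>R\<^esub> of_scalar d" using c(1) d(1) by (simp add: alg.smult_l_distr)
    have "?e (r \<oplus>\<^bsub>R\<^esub> s) \<odot>\<^bsub>V\<^esub> v = ?e (of_scalar (c \<oplus>\<^bsub>K\<^esub> d)) \<odot>\<^bsub>V\<^esub> v" if v: "v \<in> carrier V" for v
      unfolding m using r c(1) d(1) v c(2)[OF v] d(2)[OF v] by (simp add: V.smult_l_distr)
    thus ?case using c(1) d(1) by blast
  next
    case (eng_mult r s)
    then obtain c d where c: "c \<in> carrier K" "\<And>v. v \<in> carrier V \<Longrightarrow> ?e r \<odot>\<^bsub>V\<^esub> v = ?e (of_scalar c) \<odot>\<^bsub>V\<^esub> v"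
      and d: "d \<in> carrier K" "\<And>v. v \<in> carrier V \<Longrightarrow> ?e s \<odot>\<^bsub>V\<^esub> v = ?e (of_scalar d) \<odot>\<^bsub>V\<^esub> v" by blast
    have r: "r \<in> carrier R" "s \<in> carrier R" using eng_mult(1,3) Rgen by simp_all
    have "?e (r \<otimes>\<^bsub>R\<^esub> s) \<odot>\<^bsub>V\<^esub> v = ?e (of_scalar (c \<otimes>\<^bsub>K\<^esub> d)) \<odot>\<^bsub>V\<^esub> v" if v: "v \<in> carrier V" for v
    proof -
      have "?e (r \<otimes>\<^bsub>R\<^esub> s) \<odot>\<^bsub>V\<^esub> v = ?e r \<odot>\<^bsub>V\<^esub> (?e (of_scalar d) \<odot>\<^bsub>V\<^esub> v)"
        using r v d(2)[OF v] by (simp add: V.smult_assoc)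
      also have "\<dots> = ?e (of_scalar c) \<odot>\<^bsub>V\<^esub> (?e (of_scalar d) \<odot>\<^bsub>V\<^esub> v)"
        using d(1) v by (intro c(2)) (simp add: V.smult_closed)
      also have "\<dots> = ?e (of_scalar c \<otimes>\<^bsub>R\<^esub> of_scalar d) \<odot>\<^bsub>V\<^esub> v"
        using c(1) d(1) v by (simp add: V.smult_assoc)
      finally show ?thesis using ring_hom_mult[OF of_scalar_hom c(1) d(1)] by simp
    qed
    thus ?case using c(1) d(1) by blast
  qed
  have "\<exists>b \<in> carrier KG.H. \<forall>v \<in> carrier V. lift b \<odot>\<^bsub>V\<^esub> v = a \<odot>\<^bsub>V\<^esub> v" if "a \<in> carrier SR.H" for a
    using that
  proof (induct rule: SR.induct_mon)
    case zero
    have "lift \<zero>\<^bsub>KG.H\<^esub> = \<zero>\<^bsub>SR.H\<^esub>" by (simp add: KG.H_zero SR.H_zero of_scalar_zero)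
    thus ?case by (intro bexI[of _ "\<zero>\<^bsub>KG.H\<^esub>"]) (simp_all add: KG.H_zero_closed)
  next
    case (add a b)
    then obtain a' b' where a': "a' \<in> carrier KG.H" "\<forall>v \<in> carrier V. lift a' \<odot>\<^bsub>V\<^esub> v = a \<odot>\<^bsub>V\<^esub> v"
      and b': "b' \<in> carrier KG.H" "\<forall>v \<in> carrier V. lift b' \<odot>\<^bsub>V\<^esub> v = b \<odot>\<^bsub>V\<^esub> v" by blast
    have "lift (a' \<oplus>\<^bsub>KG.H\<^esub> b') = lift a' \<oplus>\<^bsub>SR.H\<^esub> lift b'"
      using ring_hom_add[OF lift_hom] a'(1) b'(1) by (simp only: group_algebra_eq)
    moreover have "lift a' \<in> carrier SR.H" "lift b' \<in> carrier SR.H"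
      using ring_hom_closed[OF lift_hom] a'(1) b'(1) by (simp_all only: group_algebra_eq)
    ultimately have "\<forall>v \<in> carrier V. lift (a' \<oplus>\<^bsub>KG.H\<^esub> b') \<odot>\<^bsub>V\<^esub> v = (a \<oplus>\<^bsub>SR.H\<^esub> b) \<odot>\<^bsub>V\<^esub> v"
      using a'(2) b'(2) add(1,2) by (simp add: V.smult_l_distr)
    thus ?case using KG.add_H_closed[OF a'(1) b'(1)] by blast
  next
    case (mon r g)
    obtain c where c: "c \<in> carrier K" "\<forall>v \<in> carrier V. ?e r \<odot>\<^bsub>V\<^esub> v = ?e (of_scalar c) \<odot>\<^bsub>V\<^esub> v"
      using scal mon(1) Rgen(1) by metis
    have split: "SR.mon r' g \<odot>\<^bsub>V\<^esub> v = ?e r' \<odot>\<^bsub>V\<^esub> (SR.mon \<one>\<^bsub>R\<^esub> g \<odot>\<^bsub>V\<^esub> v)"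
      if "r' \<in> carrier R" "v \<in> carrier V" for r' v
      using V.smult_assoc[of "?e r'" "SR.mon \<one>\<^bsub>R\<^esub> g" v] SR.mon_split[OF that(1) mon(2)] that mon(2) by simp
    have "lift (KG.mon c g) \<odot>\<^bsub>V\<^esub> v = SR.mon r g \<odot>\<^bsub>V\<^esub> v" if v: "v \<in> carrier V" for v
      unfolding lift_mon using c mon v split[OF mon(1) v] split[of "of_scalar c" v] by (simp add: V.smult_closed)
    thus ?case using c(1) mon(2) KG.mon_closed by (intro bexI[of _ "KG.mon c g"]) auto
  qed
  thus ?thesis
    unfolding as_group_module_def group_algebra_eq
    using lift_hom KG.ring_H V by (intro restrict_scalars_simple) (auto simp: group_algebra_eq)
qed

end

section \<open>The constant term on polynomials in two variables\<close>

lemma poly_xy_simps [simp]: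
  "carrier (poly_xy K) = carrier (UP (UP K))" "\<zero>\<^bsub>poly_xy K\<^esub> = \<zero>\<^bsub>UP (UP K)\<^esub>"
  "\<one>\<^bsub>poly_xy K\<^esub> = \<one>\<^bsub>UP (UP K)\<^esub>" "p \<oplus>\<^bsub>poly_xy K\<^esub> q = p \<oplus>\<^bsub>UP (UP K)\<^esub> q"
  "p \<otimes>\<^bsub>poly_xy K\<^esub> q = p \<otimes>\<^bsub>UP (UP K)\<^esub> q"
  "c \<odot>\<^bsub>poly_xy K\<^esub> p = up_ring.monom (UP K) c 0 \<odot>\<^bsub>UP (UP K)\<^esub> p"
  by (simp_all add: poly_xy_def restrict_scalars_def)

lemma ring_hom_poly_xy:
  "ring_hom (poly_xy K) B = ring_hom (UP (UP K)) B"
  by (simp add: ring_hom_def)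

lemma (in UP_ring) coeff_0_hom: "(\<lambda>p. up_ring.coeff P p 0) \<in> ring_hom P R"
  by (rule ring_hom_memI) simp_all

context cring
begin

interpretation PK: UP_cring R "UP R" by unfold_locales simp
interpretation PP: UP_cring "UP R" "UP (UP R)" by unfold_locales simp

lemma poly_xy_algebra: "algebra R (poly_xy R)"
proof (rule algebraI)
  show "cring R" by (rule cring_axioms)
  show "cring (poly_xy R)"
  proof (rule cringI)
    show "abelian_group (poly_xy R)"
    proof (rule abelian_groupI)
      fix p assume "p \<in> carrier (poly_xy R)"
      thus "\<exists>q \<in> carrier (poly_xy R). q \<oplus>\<^bsub>poly_xy R\<^esub> p = \<zero>\<^bsub>poly_xy R\<^esub>"
        by (intro bexI[of _ "\<ominus>\<^bsub>UP (UP R)\<^esub> p"]) (simp_all add: PP.P.l_neg)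
    qed (simp_all add: PP.P.a_ac)
    show "Group.comm_monoid (poly_xy R)"
      by (rule comm_monoidI) (simp_all add: PP.P.m_ac)
  qed (simp_all add: PP.P.l_distr)
qed (simp_all add: PP.UP_smult_l_distr PP.UP_smult_r_distr PP.UP_smult_assoc1 PP.UP_smult_assoc2
    PK.monom_mult[of _ _ 0 0, simplified])

lemma const_term_hom: "Defs.const_term R \<in> ring_hom (poly_xy R) R"
proof -
  have "(\<lambda>p. up_ring.coeff (UP R) p 0) \<circ> (\<lambda>p. up_ring.coeff (UP (UP R)) p 0) \<in> ring_hom (UP (UP R)) R"
    by (rule ring_hom_trans[OF PP.coeff_0_hom PK.coeff_0_hom])
  moreover have "(\<lambda>p. up_ring.coeff (UP R) p 0) \<circ> (\<lambda>p. up_ring.coeff (UP (UP R)) p 0) = Defs.const_term R"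
    by (simp add: fun_eq_iff Defs.const_term_def)
  ultimately show ?thesis by (simp add: ring_hom_poly_xy)
qed

lemma const_term_smult:
  assumes "c \<in> carrier R" "p \<in> carrier (poly_xy R)"
  shows "Defs.const_term R (c \<odot>\<^bsub>poly_xy R\<^esub> p) = c \<otimes> Defs.const_term R p"
  using assms by (simp add: Defs.const_term_def)

lemma vars_closed: "var_x R \<in> carrier (poly_xy R)" "var_y R \<in> carrier (poly_xy R)"
  by (simp_all add: var_x_def var_y_def)

lemma const_term_vars: "Defs.const_term R (var_x R) = \<zero>" "Defs.const_term R (var_y R) = \<zero>"
  by (simp_all add: Defs.const_term_def var_x_def var_y_def)

text \<open>Both sides are ring homomorphisms \<open>K[x,y] \<rightarrow> K\<close> that fix the scalars and send \<open>x\<close> and \<open>y\<close> to \<open>0\<close>,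
  so the universal property identifies them: first on \<open>K[x]\<close>, then on \<open>K[x][y]\<close>.\<close>

lemma const_term_invariant:
  assumes f: "f \<in> ring_hom (poly_xy R) (poly_xy R)"
    and lin: "\<And>c. c \<in> carrier R \<Longrightarrow> f (c \<odot>\<^bsub>poly_xy R\<^esub> \<one>\<^bsub>poly_xy R\<^esub>) = c \<odot>\<^bsub>poly_xy R\<^esub> \<one>\<^bsub>poly_xy R\<^esub>"
    and x: "Defs.const_term R (f (var_x R)) = \<zero>" and y: "Defs.const_term R (f (var_y R)) = \<zero>"
    and p: "p \<in> carrier (poly_xy R)"
  shows "Defs.const_term R (f p) = Defs.const_term R p"
proof -
  let ?c = "Defs.const_term R"
  have fc: "?c \<circ> f \<in> ring_hom (UP (UP R)) R"
    using ring_hom_trans[OF f const_term_hom] by (simp add: ring_hom_poly_xy)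
  have cc: "?c \<in> ring_hom (UP (UP R)) R" using const_term_hom by (simp add: ring_hom_poly_xy)
  let ?h = "\<lambda>q. up_ring.coeff (UP R) q 0"
  have h: "?h \<in> ring_hom (UP R) R" by (rule PK.coeff_0_hom)
  interpret U1: UP_pre_univ_prop R R id "UP R"
    by (rule UP_pre_univ_propI[OF cring_axioms cring_axioms id_ring_hom])
  interpret U2: UP_pre_univ_prop "UP R" R ?h "UP (UP R)"
    by (rule UP_pre_univ_propI[OF PK.UP_cring cring_axioms h])
  let ?m = "\<lambda>q. up_ring.monom (UP (UP R)) q 0"
  have m: "?m \<in> ring_hom (UP R) (UP (UP R))" by (rule PP.const_ring_hom)
  have fm: "(?c \<circ> f) \<circ> ?m \<in> ring_hom (UP R) R" by (rule ring_hom_trans[OF m fc])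
  have inner: "((?c \<circ> f) \<circ> ?m) q = ?h q" if q: "q \<in> carrier (UP R)" for q
  proof (rule U1.UP_hom_unique[where s = \<zero> and Phi = "(?c \<circ> f) \<circ> ?m" and Psi = ?h])
    show "ring_hom_cring (UP R) R ((?c \<circ> f) \<circ> ?m)"
      by (rule ring_hom_cringI[OF PK.UP_cring cring_axioms fm])
    show "ring_hom_cring (UP R) R ?h"
      by (rule ring_hom_cringI[OF PK.UP_cring cring_axioms h])
    show "((?c \<circ> f) \<circ> ?m) (up_ring.monom (UP R) \<one> (Suc 0)) = \<zero>"
      using x by (simp add: var_x_def)
    show "((?c \<circ> f) \<circ> ?m) (up_ring.monom (UP R) c 0) = id c" if c: "c \<in> carrier R" for c
    proof -
      have e: "?m (up_ring.monom (UP R) c 0) = c \<odot>\<^bsub>poly_xy R\<^esub> \<one>\<^bsub>poly_xy R\<^esub>"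
        using c PP.monom_mult_smult[of "up_ring.monom (UP R) c 0" "\<one>\<^bsub>UP R\<^esub>" 0] by simp
      show ?thesis using lin[OF c] const_term_smult[OF c] ring_hom_one[OF const_term_hom] c
        by (simp only: comp_apply e) (simp add: Defs.const_term_def)
    qed
  qed (use q in simp_all)
  have "(?c \<circ> f) p = ?c p"
  proof (rule U2.UP_hom_unique[where s = \<zero> and Phi = "?c \<circ> f" and Psi = ?c])
    show "ring_hom_cring (UP (UP R)) R (?c \<circ> f)"
      by (rule ring_hom_cringI[OF PP.UP_cring cring_axioms fc])
    show "ring_hom_cring (UP (UP R)) R ?c"
      by (rule ring_hom_cringI[OF PP.UP_cring cring_axioms cc])
    show "(?c \<circ> f) (up_ring.monom (UP (UP R)) \<one>\<^bsub>UP R\<^esub> (Suc 0)) = \<zero>" using y by (simp add: var_y_def)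
    show "?c (up_ring.monom (UP (UP R)) \<one>\<^bsub>UP R\<^esub> (Suc 0)) = \<zero>" by (simp add: Defs.const_term_def)
    show "(?c \<circ> f) (up_ring.monom (UP (UP R)) q 0) = ?h q" if "q \<in> carrier (UP R)" for q
      using inner[OF that] by simp
    show "?c (up_ring.monom (UP (UP R)) q 0) = ?h q" if "q \<in> carrier (UP R)" for q
      using that by (simp add: Defs.const_term_def)
  qed (use p in simp_all)
  thus ?thesis by simp
qed

end

section \<open>Torsion modules are one-dimensional\<close>

context skew_algebra
begin

text \<open>Elements \<open>z\<close> that are eigenvectors for \<open>G\<close>, with eigenvalue \<open>c\<close> for \<open>g\<close>, satisfy
  \<open>z r = (c\<inverse> r) (g z)\<close> because \<open>R\<close> is commutative. So they annihilate \<open>V\<close>, and \<open>V\<close> is a simple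
  \<open>K[G]\<close>-module.\<close>

lemma torsion_simple_one_dimensional:
  assumes K: "algebraically_closed K" and G: "comm_group G" and fg: "finitely_generated_group G"
    and gen: "generates_algebra K R Z"
    and eigen: "\<And>z g. z \<in> Z \<Longrightarrow> g \<in> carrier G \<Longrightarrow> \<exists>c \<in> Units K. act g z = c \<odot>\<^bsub>R\<^esub> z"
    and V: "simple_left_module SR.H V"
    and tors: "\<And>z. z \<in> Z \<Longrightarrow> torsion_at SR.H (skew_const R G z) V"
  shows "simple_left_module (group_algebra K G) (as_group_module R V)"
    and "\<And>z v. z \<in> Z \<Longrightarrow> v \<in> carrier V \<Longrightarrow> skew_const R G z \<odot>\<^bsub>V\<^esub> v = \<zero>\<^bsub>V\<^esub>"
    and "finite_dimensional K (underlying_space SR.H V)"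
    and "vectorspace.dim K (underlying_space SR.H V) = 1"
    and "\<exists>lam \<in> carrier (char_group G K).
      module_iso (group_algebra K G) (as_group_module R V) (char_module K G lam)"
proof -
  have fK: "field K" using K by (simp add: algebraically_closed_def)
  note R_comm = comm_monoid.m_comm[OF cring.axioms(2)[OF cring_R]]
  have ZR: "Z \<subseteq> carrier R" using gen by (simp add: generates_algebra_def)
  have ann: "skew_const R G z \<odot>\<^bsub>V\<^esub> v = \<zero>\<^bsub>V\<^esub>" if z: "z \<in> Z" and v: "v \<in> carrier V" for z v
  proof (rule SR.torsion_simple_annihilated[OF V _ tors[OF z] _ v])
    show zR: "z \<in> carrier R" using z ZR by blast
    fix r g assume r: "r \<in> carrier R" and g: "g \<in> carrier G"
    obtain c where c: "c \<in> Units K" "act g z = c \<odot>\<^bsub>R\<^esub> z" using eigen[OF z g] by blast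
    let ?d = "inv\<^bsub>K\<^esub> c"
    have cd: "c \<in> carrier K" "?d \<in> carrier K" "c \<otimes>\<^bsub>K\<^esub> ?d = \<one>\<^bsub>K\<^esub>"
      using c(1) alg.R.Units_closed alg.R.Units_inv_closed alg.R.Units_r_inv by auto
    have "(?d \<odot>\<^bsub>R\<^esub> r) \<otimes>\<^bsub>R\<^esub> (c \<odot>\<^bsub>R\<^esub> z) = (c \<odot>\<^bsub>R\<^esub> z) \<otimes>\<^bsub>R\<^esub> (?d \<odot>\<^bsub>R\<^esub> r)"
      using cd r zR by (intro R_comm) simp_all
    also have "\<dots> = c \<odot>\<^bsub>R\<^esub> (z \<otimes>\<^bsub>R\<^esub> (?d \<odot>\<^bsub>R\<^esub> r))"
      using cd r zR by (intro alg.smult_assoc2) simp_all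
    also have "z \<otimes>\<^bsub>R\<^esub> (?d \<odot>\<^bsub>R\<^esub> r) = (?d \<odot>\<^bsub>R\<^esub> r) \<otimes>\<^bsub>R\<^esub> z"
      using cd r zR by (intro R_comm) simp_all
    also have "\<dots> = ?d \<odot>\<^bsub>R\<^esub> (r \<otimes>\<^bsub>R\<^esub> z)"
      using cd r zR by (intro alg.smult_assoc2) simp_all
    also have "c \<odot>\<^bsub>R\<^esub> \<dots> = (c \<otimes>\<^bsub>K\<^esub> ?d) \<odot>\<^bsub>R\<^esub> (r \<otimes>\<^bsub>R\<^esub> z)"
      using cd r zR by (intro alg.smult_assoc1[symmetric]) simp_all
    also have "\<dots> = z \<otimes>\<^bsub>R\<^esub> r" using cd r zR R_comm[of r z] by simp
    finally show "\<exists>s \<in> carrier R. z \<otimes>\<^bsub>R\<^esub> r = s \<otimes>\<^bsub>R\<^esub> act g z"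
      using cd r unfolding c(2) by (intro bexI[of _ "?d \<odot>\<^bsub>R\<^esub> r"]) simp_all
  qed
  thus "\<And>z v. z \<in> Z \<Longrightarrow> v \<in> carrier V \<Longrightarrow> skew_const R G z \<odot>\<^bsub>V\<^esub> v = \<zero>\<^bsub>V\<^esub>" .
  show W: "simple_left_module (group_algebra K G) (as_group_module R V)"
    by (rule as_group_module_simple[OF V gen ann])
  interpret GA: commutative_group_algebra K G
    using fK G by (simp add: commutative_group_algebra_def field_def domain_def)
  let ?W = "as_group_module R V"
  obtain lam v where lam: "lam \<in> carrier (char_group G K)" "module_iso GA.A ?W (char_module K G lam)"
    and v: "v \<in> carrier ?W" "v \<noteq> \<zero>\<^bsub>?W\<^esub>"
    and span: "\<And>w. w \<in> carrier ?W \<Longrightarrow> \<exists>c \<in> carrier K. w = GA.scalar c \<odot>\<^bsub>?W\<^esub> v"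
    by (rule GA.simple_module_one_dimensional[OF K fg W]) blast
  show "\<exists>lam \<in> carrier (char_group G K). module_iso GA.A ?W (char_module K G lam)"
    using lam by blast
  have VL: "left_module SR.H V" using V by (simp add: simple_left_module_def)
  let ?U = "underlying_space SR.H V"
  have UL: "left_module K ?U" by (rule underlying_space_left_module[OF VL])
  have v': "v \<in> carrier ?U" "v \<noteq> \<zero>\<^bsub>?U\<^esub>"
    using v by (simp_all add: as_group_module_def underlying_space_def)
  have span': "\<exists>c \<in> carrier K. w = c \<odot>\<^bsub>?U\<^esub> v" if "w \<in> carrier ?U" for w
  proof -
    have "w \<in> carrier ?W" using that by (simp add: as_group_module_def underlying_space_def)
    then obtain c where c: "c \<in> carrier K" "w = GA.scalar c \<odot>\<^bsub>?W\<^esub> v" using span by blast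
    have "GA.scalar c \<odot>\<^bsub>?W\<^esub> v = c \<odot>\<^bsub>?U\<^esub> v"
      by (simp add: as_group_module_def underlying_space_def lift_mon underlying_space_smult[OF c(1)])
    thus ?thesis using c by auto
  qed
  show "finite_dimensional K ?U" by (rule one_dimensional(1)[OF fK UL v' span'])
  show "vectorspace.dim K ?U = 1" by (rule one_dimensional(2)[OF fK UL v' span'])
qed

end

section \<open>Characters as simple modules over the skew group ring of the plane\<close>

locale skew_plane = commutative_group_algebra K G + skew_algebra K "poly_xy K" G act
  for K :: "'k ring" and G :: "'g monoid" and act +
  fixes \<chi> \<eta> :: "'g \<Rightarrow> 'k"
  assumes field_K: "field K"
    and \<chi>: "\<chi> \<in> carrier (char_group G K)" and \<eta>: "\<eta> \<in> carrier (char_group G K)"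
    and act_x: "g \<in> carrier G \<Longrightarrow> act g (var_x K) = inv\<^bsub>K\<^esub> (\<chi> g) \<odot>\<^bsub>poly_xy K\<^esub> var_x K"
    and act_y: "g \<in> carrier G \<Longrightarrow> act g (var_y K) = inv\<^bsub>K\<^esub> (\<eta> g) \<odot>\<^bsub>poly_xy K\<^esub> var_y K"
begin

text \<open>The projection of \<open>K[x,y]#G\<close> onto \<open>K[G]\<close> that kills \<open>x\<close> and \<open>y\<close>.\<close>

abbreviation "\<epsilon> \<equiv> \<lambda>a g. Defs.const_term K (a g)"

lemma const_term_act:
  assumes g: "g \<in> carrier G" and p: "p \<in> carrier (poly_xy K)"
  shows "Defs.const_term K (act g p) = Defs.const_term K p"
proof (rule K.const_term_invariant[OF _ _ _ _ p])
  show "act g \<in> ring_hom (poly_xy K) (poly_xy K)" by (rule SR.act_ring_hom[OF g])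
  have one: "\<one>\<^bsub>poly_xy K\<^esub> \<in> carrier (poly_xy K)" by (rule ring.ring_simprules(6)[OF ring_R])
  show "act g (c \<odot>\<^bsub>poly_xy K\<^esub> \<one>\<^bsub>poly_xy K\<^esub>) = c \<odot>\<^bsub>poly_xy K\<^esub> \<one>\<^bsub>poly_xy K\<^esub>"
    if "c \<in> carrier K" for c
    using action g that one SR.act_hom(4)[OF g] unfolding algebra_action_def by metis
  show "Defs.const_term K (act g (var_x K)) = \<zero>\<^bsub>K\<^esub>"
    unfolding act_x[OF g] using char_closed(1)[OF \<chi> g]
    by (simp only: K.const_term_smult K.Units_inv_closed K.vars_closed K.const_term_vars K.r_null)
  show "Defs.const_term K (act g (var_y K)) = \<zero>\<^bsub>K\<^esub>"
    unfolding act_y[OF g] using char_closed(1)[OF \<eta> g]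
    by (simp only: K.const_term_smult K.Units_inv_closed K.vars_closed K.const_term_vars K.r_null)
qed

lemma \<epsilon>_hom: "\<epsilon> \<in> ring_hom SR.H A"
  unfolding group_algebra_eq
  by (rule skew_ring_hom[OF SR.skew_ring_axioms KG.skew_ring_axioms])
    (use K.const_term_hom const_term_act in \<open>simp_all only: ring_hom_regular\<close>)

lemma const_term_of_scalar: "c \<in> carrier K \<Longrightarrow> Defs.const_term K (of_scalar c) = c"
  using K.const_term_smult[of c "\<one>\<^bsub>poly_xy K\<^esub>"] ring_hom_one[OF K.const_term_hom]
    ring.ring_simprules(6)[OF ring_R] by simp

lemma \<epsilon>_mon: "\<epsilon> (SR.mon p g) = KG.mon (Defs.const_term K p) g"
  using ring_hom_zero[OF K.const_term_hom ring_R ring_K] by (auto simp: SR.mon_def KG.mon_def)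

text \<open>So every one of these modules is the simple \<open>K\<close>-module \<open>K\<close>, pulled back along
  \<open>K[x,y]#G \<rightarrow> K[G] \<rightarrow> K\<close>. This map is onto, so the module stays simple.\<close>

lemma char_module_xy_restrict:
  "char_module_xy K G lam = restrict_scalars (char_sum lam \<circ> \<epsilon>) (regular_algebra K)"
  by (simp add: char_module_xy_def char_module_restrict restrict_scalars_compose)

lemma char_module_xy_simps:
  "carrier (char_module_xy K G lam) = carrier K" "\<zero>\<^bsub>char_module_xy K G lam\<^esub> = \<zero>\<^bsub>K\<^esub>"
  "v \<oplus>\<^bsub>char_module_xy K G lam\<^esub> w = v \<oplus>\<^bsub>K\<^esub> w"
  "a \<odot>\<^bsub>char_module_xy K G lam\<^esub> v = char_sum lam (\<epsilon> a) \<otimes>\<^bsub>K\<^esub> v"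
  unfolding char_module_xy_restrict by simp_all

lemma char_module_xy_hom:
  "lam \<in> carrier (char_group G K) \<Longrightarrow> char_sum lam \<circ> \<epsilon> \<in> ring_hom SR.H K"
  by (rule ring_hom_trans[OF \<epsilon>_hom char_sum_hom])

lemma char_sum_scalar:
  assumes "lam \<in> carrier (char_group G K)" "c \<in> carrier K" shows "char_sum lam (scalar c) = c"
  using assms by (simp add: char_sum_mon char_one)

lemma char_module_xy_simple:
  assumes l: "lam \<in> carrier (char_group G K)"
  shows "simple_left_module SR.H (char_module_xy K G lam)"
  unfolding char_module_xy_restrict
proof (rule restrict_scalars_simple[OF SR.ring_H char_module_xy_hom[OF l] field.regular_simple[OF field_K]])
  fix c assume c: "c \<in> carrier K"
  have "of_scalar c \<in> carrier (poly_xy K)" by (rule ring_hom_closed[OF of_scalar_hom c])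
  hence "SR.mon (of_scalar c) \<one>\<^bsub>G\<^esub> \<in> carrier SR.H" using G.one_closed by (rule SR.mon_closed)
  moreover have "(char_sum lam \<circ> \<epsilon>) (SR.mon (of_scalar c) \<one>\<^bsub>G\<^esub>) = c"
    unfolding comp_apply \<epsilon>_mon const_term_of_scalar[OF c] by (rule char_sum_scalar[OF l c])
  ultimately show "\<exists>a \<in> carrier SR.H. \<forall>v \<in> carrier (regular_algebra K).
      (char_sum lam \<circ> \<epsilon>) a \<odot>\<^bsub>regular_algebra K\<^esub> v = c \<odot>\<^bsub>regular_algebra K\<^esub> v"
    by metis
qed

lemma char_module_xy_finite_dimensional:
  assumes l: "lam \<in> carrier (char_group G K)"
  shows "finite_dimensional K (underlying_space SR.H (char_module_xy K G lam))"
proof (rule one_dimensional(1)[OF field_K, where v = "\<one>\<^bsub>K\<^esub>"])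
  let ?M = "char_module_xy K G lam"
  have "left_module SR.H ?M" using char_module_xy_simple[OF l] by (simp add: simple_left_module_def)
  thus "left_module K (underlying_space SR.H ?M)" by (rule underlying_space_left_module)
  show "\<one>\<^bsub>K\<^esub> \<in> carrier (underlying_space SR.H ?M)" "\<one>\<^bsub>K\<^esub> \<noteq> \<zero>\<^bsub>underlying_space SR.H ?M\<^esub>"
    using domain.one_not_zero[OF field.axioms(1)[OF field_K]]
    by (simp_all add: underlying_space_def char_module_xy_simps)
  fix w assume "w \<in> carrier (underlying_space SR.H ?M)"
  hence w: "w \<in> carrier K" by (simp add: underlying_space_def char_module_xy_simps)
  have "w \<odot>\<^bsub>underlying_space SR.H ?M\<^esub> \<one>\<^bsub>K\<^esub> = char_sum lam (\<epsilon> (SR.mon (of_scalar w) \<one>\<^bsub>G\<^esub>)) \<otimes>\<^bsub>K\<^esub> \<one>\<^bsub>K\<^esub>"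
    unfolding underlying_space_def restrict_scalars_simps underlying_space_smult[OF w] char_module_xy_simps ..
  also have "\<dots> = w" unfolding \<epsilon>_mon const_term_of_scalar[OF w] char_sum_scalar[OF l w] using w by simp
  finally show "\<exists>c \<in> carrier K. w = c \<odot>\<^bsub>underlying_space SR.H ?M\<^esub> \<one>\<^bsub>K\<^esub>" using w by metis
qed

lemma char_module_xy_Irr:
  "lam \<in> carrier (char_group G K) \<Longrightarrow> iso_class SR.H (char_module_xy K G lam) \<in> Defs.Irr K SR.H"
  unfolding Defs.Irr_def using char_module_xy_simple char_module_xy_finite_dimensional by blast

lemma char_module_xy_vars_zero:
  assumes l: "lam \<in> carrier (char_group G K)" and v: "v \<in> carrier (char_module_xy K G lam)"
    and p: "Defs.const_term K p = \<zero>\<^bsub>K\<^esub>"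
  shows "skew_const (poly_xy K) G p \<odot>\<^bsub>char_module_xy K G lam\<^esub> v = \<zero>\<^bsub>char_module_xy K G lam\<^esub>"
  unfolding SR.skew_const_mon char_module_xy_simps \<epsilon>_mon p char_sum_scalar[OF l K.zero_closed]
  using v by (simp add: char_module_xy_simps)

lemma char_module_xy_as_group_module:
  assumes l: "lam \<in> carrier (char_group G K)"
  shows "module_iso A (as_group_module (poly_xy K) (char_module_xy K G lam)) (char_module K G lam)"
proof -
  have "\<epsilon> (lift a) = a" if "a \<in> carrier A" for a
    using KG.coeff_closed[of a] that const_term_of_scalar unfolding group_algebra_eq regular_algebra_simps by blast
  hence "(\<lambda>v. v) \<in> module_hom A (as_group_module (poly_xy K) (char_module_xy K G lam)) (char_module K G lam)"
    unfolding module_hom_def as_group_module_def char_module_restrict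
    by (auto simp: char_module_xy_simps simp del: poly_xy_simps)
  moreover have "bij_betw (\<lambda>v. v) (carrier (as_group_module (poly_xy K) (char_module_xy K G lam)))
      (carrier (char_module K G lam))"
    by (simp add: as_group_module_def char_module_restrict char_module_xy_simps bij_betw_def)
  ultimately show ?thesis unfolding module_iso_def by blast
qed

text \<open>An isomorphism between the modules of \<open>lam\<close> and \<open>mu\<close> commutes with scalars, so it is
  \<open>c \<mapsto> c f(1)\<close> with \<open>f(1) \<noteq> 0\<close>. Comparing the action of \<open>g\<close> on both sides gives \<open>lam g = mu g\<close>.\<close>

lemma char_module_xy_inj:
  "inj_on (\<lambda>lam. iso_class SR.H (char_module_xy K G lam)) (carrier (char_group G K))"
proof (rule inj_onI)
  fix lam mu
  assume l: "lam \<in> carrier (char_group G K)" and m: "mu \<in> carrier (char_group G K)"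
    and eq: "iso_class SR.H (char_module_xy K G lam) = iso_class SR.H (char_module_xy K G mu)"
  let ?M = "char_module_xy K G lam" and ?N = "char_module_xy K G mu"
  interpret F: field K by (rule field_K)
  have "(\<lambda>v. v) \<in> module_hom SR.H ?N ?N" by (simp add: module_hom_def)
  hence "module_iso SR.H ?N ?N" unfolding module_iso_def using bij_betw_id[unfolded id_def] by blast
  moreover have "left_module SR.H ?N" using char_module_xy_simple[OF m] by (simp add: simple_left_module_def)
  ultimately have "?N \<in> iso_class SR.H ?M" unfolding eq by (simp add: iso_class_def)
  hence "module_iso SR.H ?M ?N" by (simp only: iso_class_def mem_Collect_eq)
  then obtain f where f: "f \<in> module_hom SR.H ?M ?N" and "bij_betw f (carrier ?M) (carrier ?N)"
    unfolding module_iso_def by blast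
  hence bij: "bij_betw f (carrier K) (carrier K)" by (simp only: char_module_xy_simps)
  have fc: "f v \<in> carrier K" if "v \<in> carrier K" for v using bij that by (auto simp: bij_betw_def)
  have fs: "f (char_sum lam (\<epsilon> a) \<otimes>\<^bsub>K\<^esub> v) = char_sum mu (\<epsilon> a) \<otimes>\<^bsub>K\<^esub> f v"
    if "a \<in> carrier SR.H" "v \<in> carrier K" for a v
    using f that unfolding module_hom_def char_module_xy_simps by blast
  have ring1: "\<one>\<^bsub>poly_xy K\<^esub> \<in> carrier (poly_xy K)" by (rule ring.ring_simprules(6)[OF ring_R])
  have ct1: "Defs.const_term K \<one>\<^bsub>poly_xy K\<^esub> = \<one>\<^bsub>K\<^esub>" by (rule ring_hom_one[OF K.const_term_hom])
  have lin: "f c = c \<otimes>\<^bsub>K\<^esub> f \<one>\<^bsub>K\<^esub>" if c: "c \<in> carrier K" for c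
  proof -
    have "SR.mon (of_scalar c) \<one>\<^bsub>G\<^esub> \<in> carrier SR.H"
      by (rule SR.mon_closed[OF ring_hom_closed[OF of_scalar_hom c] G.one_closed])
    from fs[OF this K.one_closed] show ?thesis
      unfolding \<epsilon>_mon const_term_of_scalar[OF c] char_sum_scalar[OF l c] char_sum_scalar[OF m c]
      using c by simp
  qed
  have f1: "f \<one>\<^bsub>K\<^esub> \<noteq> \<zero>\<^bsub>K\<^esub>"
  proof
    assume "f \<one>\<^bsub>K\<^esub> = \<zero>\<^bsub>K\<^esub>"
    hence "f \<one>\<^bsub>K\<^esub> = f \<zero>\<^bsub>K\<^esub>" using lin[OF K.zero_closed] by simp
    thus False using bij F.one_not_zero K.one_closed K.zero_closed unfolding bij_betw_def inj_on_def by blast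
  qed
  show "lam = mu"
  proof (rule extensionalityI[of _ "carrier G"])
    show "lam \<in> extensional (carrier G)" "mu \<in> extensional (carrier G)"
      using l m by (simp_all add: char_group_def)
    fix g assume g: "g \<in> carrier G"
    note lc = char_closed(2)[OF l g] and mc = char_closed(2)[OF m g]
    have "f (lam g) = mu g \<otimes>\<^bsub>K\<^esub> f \<one>\<^bsub>K\<^esub>"
      using fs[OF SR.mon_closed[OF ring1 g] K.one_closed] lc mc
      unfolding \<epsilon>_mon ct1 char_sum_mon[OF l K.one_closed g] char_sum_mon[OF m K.one_closed g] by simp
    hence "lam g \<otimes>\<^bsub>K\<^esub> f \<one>\<^bsub>K\<^esub> = mu g \<otimes>\<^bsub>K\<^esub> f \<one>\<^bsub>K\<^esub>" using lin[OF lc] by simp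
    thus "lam g = mu g" using F.m_rcancel[OF f1 fc[OF K.one_closed] lc mc] by simp
  qed
qed

end

theorem lemma5p1:
  fixes K :: "'k ring" and G :: "'g monoid"
  assumes "algebraically_closed K" and "char_zero K"
    and "comm_group G" and "finitely_generated_group G"
  shows "(\<forall>(R :: ('k, 'r) module) (n :: nat) (x :: nat \<Rightarrow> 'r) (\<chi> :: nat \<Rightarrow> 'g \<Rightarrow> 'k)
        (act :: 'g \<Rightarrow> 'r \<Rightarrow> 'r) (V :: ('g \<Rightarrow> 'r, 'v) module).
      algebra K R \<and> generates_algebra K R (x ` {1..n}) \<and>
      (\<forall>i \<in> {1..n}. \<chi> i \<in> carrier (char_group G K)) \<and>
      algebra_action K G R act \<and>
      (\<forall>i \<in> {1..n}. \<forall>g \<in> carrier G. act g (x i) = inv\<^bsub>K\<^esub> (\<chi> i g) \<odot>\<^bsub>R\<^esub> x i) \<and>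
      simple_left_module (skew_group_ring R G act) V \<and>
      (\<forall>i \<in> {1..n}. torsion_at (skew_group_ring R G act) (skew_const R G (x i)) V)
      \<longrightarrow>
      simple_left_module (group_algebra K G) (as_group_module R V) \<and>
      (\<forall>i \<in> {1..n}. \<forall>v \<in> carrier V. skew_const R G (x i) \<odot>\<^bsub>V\<^esub> v = \<zero>\<^bsub>V\<^esub>) \<and>
      finite_dimensional K (underlying_space (skew_group_ring R G act) V) \<and>
      vectorspace.dim K (underlying_space (skew_group_ring R G act) V) = 1 \<and>
      (\<exists>lam \<in> carrier (char_group G K).
         module_iso (group_algebra K G) (as_group_module R V) (char_module K G lam)))
    \<and>
    (\<forall>\<chi> \<in> carrier (char_group G K). \<forall>\<eta> \<in> carrier (char_group G K). \<forall>act.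
      finite_order (char_group G K) \<chi> \<and> finite_order (char_group G K) \<eta> \<and>
      algebra_action K G (poly_xy K) act \<and>
      (\<forall>g \<in> carrier G.
         act g (var_x K) = inv\<^bsub>K\<^esub> (\<chi> g) \<odot>\<^bsub>poly_xy K\<^esub> var_x K \<and>
         act g (var_y K) = inv\<^bsub>K\<^esub> (\<eta> g) \<odot>\<^bsub>poly_xy K\<^esub> var_y K)
      \<longrightarrow>
      (\<forall>lam \<in> carrier (char_group G K).
         iso_class (skew_group_ring (poly_xy K) G act) (char_module_xy K G lam)
           \<in> Irr K (skew_group_ring (poly_xy K) G act) \<and>
         module_iso (group_algebra K G)
           (as_group_module (poly_xy K) (char_module_xy K G lam)) (char_module K G lam) \<and>
         (\<forall>v \<in> carrier (char_module_xy K G lam).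
            skew_const (poly_xy K) G (var_x K) \<odot>\<^bsub>char_module_xy K G lam\<^esub> v
              = \<zero>\<^bsub>char_module_xy K G lam\<^esub> \<and>
            skew_const (poly_xy K) G (var_y K) \<odot>\<^bsub>char_module_xy K G lam\<^esub> v
              = \<zero>\<^bsub>char_module_xy K G lam\<^esub>)) \<and>
      inj_on (\<lambda>lam. iso_class (skew_group_ring (poly_xy K) G act) (char_module_xy K G lam))
        (carrier (char_group G K)))"
  (is "?torsion \<and> ?plane")
proof
  note K = assms(1) and G = assms(3) and fg = assms(4)
  have fK: "field K" using K by (simp add: algebraically_closed_def)
  show ?torsion
  proof (intro allI impI)
    fix R :: "('k, 'r) module" and n :: nat and x :: "nat \<Rightarrow> 'r" and \<chi> :: "nat \<Rightarrow> 'g \<Rightarrow> 'k"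
      and act :: "'g \<Rightarrow> 'r \<Rightarrow> 'r" and V :: "('g \<Rightarrow> 'r, 'v) module"
    assume H: "algebra K R \<and> generates_algebra K R (x ` {1..n}) \<and>
      (\<forall>i \<in> {1..n}. \<chi> i \<in> carrier (char_group G K)) \<and>
      algebra_action K G R act \<and>
      (\<forall>i \<in> {1..n}. \<forall>g \<in> carrier G. act g (x i) = inv\<^bsub>K\<^esub> (\<chi> i g) \<odot>\<^bsub>R\<^esub> x i) \<and>
      simple_left_module (skew_group_ring R G act) V \<and>
      (\<forall>i \<in> {1..n}. torsion_at (skew_group_ring R G act) (skew_const R G (x i)) V)"
    interpret GA: commutative_group_algebra K G
      using fK G by (simp add: commutative_group_algebra_def field_def domain_def)
    interpret S: skew_algebra K R G act
      using H GA.G.is_group by (simp only: skew_algebra_def skew_algebra_axioms_def)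
    have eigen: "\<exists>c \<in> Units K. act g z = c \<odot>\<^bsub>R\<^esub> z" if z: "z \<in> x ` {1..n}" and g: "g \<in> carrier G" for z g
    proof -
      obtain i where i: "i \<in> {1..n}" "z = x i" using z by blast
      have "\<chi> i g \<in> Units K" using GA.char_closed(1) H i(1) g by blast
      hence "inv\<^bsub>K\<^esub> (\<chi> i g) \<in> Units K" by (rule GA.K.Units_inv_Units)
      thus ?thesis using H i g by blast
    qed
    have tors: "torsion_at S.SR.H (skew_const R G z) V" if "z \<in> x ` {1..n}" for z
      using H that by blast
    have gen: "generates_algebra K R (x ` {1..n})" and V: "simple_left_module S.SR.H V"
      using H by blast+
    have T1: "simple_left_module (group_algebra K G) (as_group_module R V)"
      by (rule S.torsion_simple_one_dimensional(1)[OF K G fg gen eigen V tors])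
    have T3: "finite_dimensional K (underlying_space S.SR.H V)"
      by (rule S.torsion_simple_one_dimensional(3)[OF K G fg gen eigen V tors])
    have T4: "vectorspace.dim K (underlying_space S.SR.H V) = 1"
      by (rule S.torsion_simple_one_dimensional(4)[OF K G fg gen eigen V tors])
    have T5: "\<exists>lam \<in> carrier (char_group G K).
         module_iso (group_algebra K G) (as_group_module R V) (char_module K G lam)"
      by (rule S.torsion_simple_one_dimensional(5)[OF K G fg gen eigen V tors])
    have T2: "\<forall>i \<in> {1..n}. \<forall>v \<in> carrier V. skew_const R G (x i) \<odot>\<^bsub>V\<^esub> v = \<zero>\<^bsub>V\<^esub>"
      using S.torsion_simple_one_dimensional(2)[OF K G fg gen eigen V tors] by simp
    show "simple_left_module (group_algebra K G) (as_group_module R V) \<and>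
      (\<forall>i \<in> {1..n}. \<forall>v \<in> carrier V. skew_const R G (x i) \<odot>\<^bsub>V\<^esub> v = \<zero>\<^bsub>V\<^esub>) \<and>
      finite_dimensional K (underlying_space (skew_group_ring R G act) V) \<and>
      vectorspace.dim K (underlying_space (skew_group_ring R G act) V) = 1 \<and>
      (\<exists>lam \<in> carrier (char_group G K).
         module_iso (group_algebra K G) (as_group_module R V) (char_module K G lam))"
      by (intro conjI T1 T2 T3 T4 T5)
  qed
  show ?plane
  proof (intro ballI allI impI)
    fix \<chi> \<eta> act
    assume \<chi>: "\<chi> \<in> carrier (char_group G K)" and \<eta>: "\<eta> \<in> carrier (char_group G K)"
      and H: "finite_order (char_group G K) \<chi> \<and> finite_order (char_group G K) \<eta> \<and>
      algebra_action K G (poly_xy K) act \<and>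
      (\<forall>g \<in> carrier G.
         act g (var_x K) = inv\<^bsub>K\<^esub> (\<chi> g) \<odot>\<^bsub>poly_xy K\<^esub> var_x K \<and>
         act g (var_y K) = inv\<^bsub>K\<^esub> (\<eta> g) \<odot>\<^bsub>poly_xy K\<^esub> var_y K)"
    interpret GA: commutative_group_algebra K G
      using fK G by (simp add: commutative_group_algebra_def field_def domain_def)
    have action: "algebra_action K G (poly_xy K) act"
      and act_x: "\<And>g. g \<in> carrier G \<Longrightarrow> act g (var_x K) = inv\<^bsub>K\<^esub> (\<chi> g) \<odot>\<^bsub>poly_xy K\<^esub> var_x K"
      and act_y: "\<And>g. g \<in> carrier G \<Longrightarrow> act g (var_y K) = inv\<^bsub>K\<^esub> (\<eta> g) \<odot>\<^bsub>poly_xy K\<^esub> var_y K"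
      using H by blast+
    interpret S: skew_algebra K "poly_xy K" G act
      by (intro skew_algebra.intro skew_algebra_axioms.intro action GA.K.poly_xy_algebra GA.G.is_group)
    interpret P: skew_plane K G act \<chi> \<eta>
      by (intro skew_plane.intro skew_plane_axioms.intro GA.commutative_group_algebra_axioms
          S.skew_algebra_axioms fK \<chi> \<eta> act_x act_y)
    show "(\<forall>lam \<in> carrier (char_group G K).
         iso_class (skew_group_ring (poly_xy K) G act) (char_module_xy K G lam)
           \<in> Defs.Irr K (skew_group_ring (poly_xy K) G act) \<and>
         module_iso (group_algebra K G)
           (as_group_module (poly_xy K) (char_module_xy K G lam)) (char_module K G lam) \<and>
         (\<forall>v \<in> carrier (char_module_xy K G lam).
            skew_const (poly_xy K) G (var_x K) \<odot>\<^bsub>char_module_xy K G lam\<^esub> v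
              = \<zero>\<^bsub>char_module_xy K G lam\<^esub> \<and>
            skew_const (poly_xy K) G (var_y K) \<odot>\<^bsub>char_module_xy K G lam\<^esub> v
              = \<zero>\<^bsub>char_module_xy K G lam\<^esub>)) \<and>
      inj_on (\<lambda>lam. iso_class (skew_group_ring (poly_xy K) G act) (char_module_xy K G lam))
        (carrier (char_group G K))"
      by (intro conjI ballI P.char_module_xy_Irr P.char_module_xy_as_group_module
          P.char_module_xy_vars_zero P.char_module_xy_inj GA.K.const_term_vars)
  qed
qed

end
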